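(* Let $\mathbb{K}$ be a field, $n\ge 1$, and let $q\in\mathbb{K}^*$ not be a root of unity. If $M$ is a nonzero finitely generated (right) module over the quantum symplectic space $\mathcal{O}_q(\mathfrak{sp}(\mathbb{K}^{2n}))$ that is not a $\mathscr{Z}$-torsion module, then $$\operatorname{GK-dim}(M)\ \ge\ n=\frac{\operatorname{GK-dim}(\mathcal{O}_q(\mathfrak{sp}(\mathbb{K}^{2n})))}{2}.$$
   Context: Definition of $K_n$: let $P=(p_1,\ldots,p_n)$ and $Q=(q_1,\ldots,q_n)$ be $n$-tuples of elements of $\mathbb{K}^*$ with $p_i\ne q_i$ for all $i$, and let $\Gamma=(\gamma_{ij})$ be a multiplicatively antisymmetric $n\times n$ matrix over $\mathbb{K}$ (that is, $\gamma_{ii}=1$ and $\gamma_{ij}\gamma_{ji}=1$ for all $i,j$). The algebra $K_n=K_{n,\Gamma}^{P,Q}(\mathbb{K})$ is the $\mathbb{K}$-algebra generated by $x_1,y_1,\ldots,x_n,y_n$ subject to the relations $x_ix_j=q_ip_j^{-1}\gamma_{ij}x_jx_i$ for $i<j$; $y_iy_j=\gamma_{ij}y_jy_i$ for $i<j$; $x_iy_j=p_j\gamma_{ij}^{-1}y_jx_i$ for $i<j$; $x_iy_j=q_j\gamma_{ij}^{-1}y_jx_i$ for $i>j$; $x_iy_i-q_iy_ix_i=\sum_{l=1}^{i-1}(q_l-p_l)y_lx_l$ for all $i$. The quantum symplectic space $\mathcal{O}_q(\mathfrak{sp}(\mathbb{K}^{2n}))$ is the algebra $K_{n,\Gamma}^{P,Q}(\mathbb{K})$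 with $p_i=1$, $q_i=q^{-2}$ for all $i$ and $\gamma_{ij}=q$ for all $i<j$. The elements $z_i:=\sum_{l\le i}(q_l-p_l)y_lx_l$ ($1\le i\le n$) are normal in $K_n$ and commute with each other, and $\mathscr{Z}:=\{z_1^{j_1}\cdots z_n^{j_n}: j_i\in\mathbb{Z}_{\ge 0}\}$ is an Ore set. A module $M$ is $\mathscr{Z}$-torsion if every $m\in M$ satisfies $ms=0$ for some $s\in\mathscr{Z}$. $\operatorname{GK-dim}$ denotes Gelfand--Kirillov dimension over $\mathbb{K}$. *)

theory Defs
  imports
    Complex_Main
    "HOL-Library.Extended_Real"
    "HOL-Library.Liminf_Limsup"
    "HOL-Library.Poly_Mapping"
    "HOL-Algebra.Module"
    "HOL-Algebra.QuotRing"
begin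

section \<open>The free algebra\<close>

datatype gen = X nat | Y nat

datatype word = Word (letters: "gen list")

text \<open>
  Words form the free monoid under concatenation, written additively because
  the convolution product on \<^typ>\<open>'a \<Rightarrow>\<^sub>0 'b\<close> uses the additive structure of the keys.
  Thus \<^typ>\<open>word \<Rightarrow>\<^sub>0 'k\<close> is the ring of noncommutative polynomials in the letters
  \<^term>\<open>X i\<close>, \<^term>\<open>Y i\<close>, \<open>i\<close> ranging over all natural numbers.
\<close>

instantiation word :: monoid_add
begin

definition zero_word :: word where "0 = Word []"

definition plus_word :: "word \<Rightarrow> word \<Rightarrow> word"
  where "v + w = Word (letters v @ letters w)"

instance
  by standard (simp_all add: zero_word_def plus_word_def)

end

type_synonym 'k ncpoly = "word \<Rightarrow>\<^sub>0 'k"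

definition const :: "'k::field \<Rightarrow> 'k ncpoly"
  where "const c = Poly_Mapping.single 0 c"

definition gx :: "nat \<Rightarrow> 'k::field ncpoly"
  where "gx i = Poly_Mapping.single (Word [X i]) 1"

definition gy :: "nat \<Rightarrow> 'k::field ncpoly"
  where "gy i = Poly_Mapping.single (Word [Y i]) 1"

definition words :: "nat \<Rightarrow> word set"
  where "words n = {w. set (letters w) \<subseteq> X ` {1..n} \<union> Y ` {1..n}}"

definition free_alg :: "nat \<Rightarrow> 'k::field ncpoly ring"
  where "free_alg n =
    \<lparr>carrier = {f. Poly_Mapping.keys f \<subseteq> words n},
     mult = (*), one = 1, zero = 0, add = (+)\<rparr>"

lemma free_alg_closed:
  fixes f g :: "'k::field ncpoly"
  shows "(0::'k ncpoly) \<in> carrier (free_alg n)" "(1::'k ncpoly) \<in> carrier (free_alg n)"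
    "const (c::'k) \<in> carrier (free_alg n)"
    "f \<in> carrier (free_alg n) \<Longrightarrow> - f \<in> carrier (free_alg n)"
    "f \<in> carrier (free_alg n) \<Longrightarrow> g \<in> carrier (free_alg n) \<Longrightarrow> f + g \<in> carrier (free_alg n)"
    "f \<in> carrier (free_alg n) \<Longrightarrow> g \<in> carrier (free_alg n) \<Longrightarrow> f - g \<in> carrier (free_alg n)"
    "f \<in> carrier (free_alg n) \<Longrightarrow> g \<in> carrier (free_alg n) \<Longrightarrow> f * g \<in> carrier (free_alg n)"
    "1 \<le> i \<Longrightarrow> i \<le> n \<Longrightarrow> (gx i::'k ncpoly) \<in> carrier (free_alg n)"
    "1 \<le> i \<Longrightarrow> i \<le> n \<Longrightarrow> (gy i::'k ncpoly) \<in> carrier (free_alg n)"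
proof -
  have add: "u + v \<in> words n" if "u \<in> words n" "v \<in> words n" for u v
    using that by (simp add: words_def plus_word_def)
  have zero: "0 \<in> words n"
    by (simp add: words_def zero_word_def)
  have letter: "Word [X i] \<in> words n" "Word [Y i] \<in> words n" if "1 \<le> i" "i \<le> n" for i
    using that by (simp_all add: words_def)
  show "f * g \<in> carrier (free_alg n)" if f: "f \<in> carrier (free_alg n)" and g: "g \<in> carrier (free_alg n)"
  proof -
    have "Poly_Mapping.keys (f * g) \<subseteq> words n"
    proof
      fix w assume "w \<in> Poly_Mapping.keys (f * g)"
      then obtain u v where "u \<in> Poly_Mapping.keys f" "v \<in> Poly_Mapping.keys g" "w = u + v"
        using keys_mult[of f g] by blast
      with f g show "w \<in> words n"
        using add[of u v] unfolding free_alg_def by (simp add: subset_iff)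
    qed
    then show ?thesis by (simp add: free_alg_def)
  qed
  show "f + g \<in> carrier (free_alg n)" if "f \<in> carrier (free_alg n)" "g \<in> carrier (free_alg n)"
    using that order_trans[OF Poly_Mapping.keys_add[of f g], of "words n"] by (simp add: free_alg_def)
  show "f - g \<in> carrier (free_alg n)" if "f \<in> carrier (free_alg n)" "g \<in> carrier (free_alg n)"
    using that order_trans[OF keys_diff[of f g], of "words n"] by (simp add: free_alg_def)
  show "(gx i::'k ncpoly) \<in> carrier (free_alg n)" "(gy i::'k ncpoly) \<in> carrier (free_alg n)"
    if "1 \<le> i" "i \<le> n"
    using letter[OF that] by (simp_all add: free_alg_def gx_def gy_def)
qed (simp_all add: free_alg_def const_def words_def zero_word_def)

lemma ring_free_alg: "ring (free_alg n :: 'k::field ncpoly ring)"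
proof (rule ringI)
  show "abelian_group (free_alg n :: 'k ncpoly ring)"
  proof (rule abelian_groupI)
    fix f :: "'k ncpoly" assume "f \<in> carrier (free_alg n)"
    then show "\<exists>g\<in>carrier (free_alg n). g \<oplus>\<^bsub>free_alg n\<^esub> f = \<zero>\<^bsub>free_alg n\<^esub>"
      by (intro bexI[of _ "- f"] free_alg_closed) (simp add: free_alg_def)
  qed (use free_alg_closed(1,5)[where 'k='k and n=n] in \<open>simp_all add: free_alg_def add_ac\<close>)
  show "Group.monoid (free_alg n :: 'k ncpoly ring)"
    by (rule monoidI)
       (use free_alg_closed(2,7)[where 'k='k and n=n] in \<open>simp_all add: free_alg_def mult.assoc\<close>)
qed (simp_all add: free_alg_def distrib_left distrib_right)

lemma free_alg_sum_closed: "(\<And>l. l \<in> S \<Longrightarrow> h l \<in> carrier (free_alg n)) \<Longrightarrow> sum h S \<in> carrier (free_alg n)"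
  by (induction S rule: infinite_finite_induct) (auto intro: free_alg_closed)

section \<open>The algebras $K_n$ and the quantum symplectic space\<close>

text \<open>The relation $u = v$ is represented by the element $u - v$ of the free algebra.\<close>

definition Kn_rels ::
    "nat \<Rightarrow> (nat \<Rightarrow> 'k::field) \<Rightarrow> (nat \<Rightarrow> 'k) \<Rightarrow> (nat \<Rightarrow> nat \<Rightarrow> 'k) \<Rightarrow> 'k ncpoly set"
  where "Kn_rels n p q \<gamma> =
    {gx i * gx j - const (q i * inverse (p j) * \<gamma> i j) * gx j * gx i
      | i j. 1 \<le> i \<and> i < j \<and> j \<le> n} \<union>
    {gy i * gy j - const (\<gamma> i j) * gy j * gy i
      | i j. 1 \<le> i \<and> i < j \<and> j \<le> n} \<union>
    {gx i * gy j - const (p j * inverse (\<gamma> i j)) * gy j * gx i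
      | i j. 1 \<le> i \<and> i < j \<and> j \<le> n} \<union>
    {gx i * gy j - const (q j * inverse (\<gamma> i j)) * gy j * gx i
      | i j. 1 \<le> j \<and> j < i \<and> i \<le> n} \<union>
    {gx i * gy i - const (q i) * gy i * gx i - (\<Sum>l = 1..<i. const (q l - p l) * gy l * gx l)
      | i. 1 \<le> i \<and> i \<le> n}"

definition Kn_ideal ::
    "nat \<Rightarrow> (nat \<Rightarrow> 'k::field) \<Rightarrow> (nat \<Rightarrow> 'k) \<Rightarrow> (nat \<Rightarrow> nat \<Rightarrow> 'k) \<Rightarrow> 'k ncpoly set"
  where "Kn_ideal n p q \<gamma> = genideal (free_alg n) (Kn_rels n p q \<gamma>)"

definition Kn_class ::
    "nat \<Rightarrow> (nat \<Rightarrow> 'k::field) \<Rightarrow> (nat \<Rightarrow> 'k) \<Rightarrow> (nat \<Rightarrow> nat \<Rightarrow> 'k) \<Rightarrow> 'k ncpoly \<Rightarrow> 'k ncpoly set"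
  where "Kn_class n p q \<gamma> f = Kn_ideal n p q \<gamma> +>\<^bsub>free_alg n\<^esub> f"

text \<open>
  A \<open>'k\<close>-algebra is a ring record extended by scalar multiplication; the library's record
  \<^type>\<open>module_scheme\<close> has exactly these fields (its locale \<open>algebra\<close> is not used, as it
  requires commutativity).
\<close>

definition Kn ::
    "nat \<Rightarrow> (nat \<Rightarrow> 'k::field) \<Rightarrow> (nat \<Rightarrow> 'k) \<Rightarrow> (nat \<Rightarrow> nat \<Rightarrow> 'k) \<Rightarrow> ('k, 'k ncpoly set) module"
  where "Kn n p q \<gamma> =
    ring.extend (free_alg n Quot Kn_ideal n p q \<gamma>)
      (module.fields (\<lambda>c a. Kn_class n p q \<gamma> (const c) \<otimes>\<^bsub>free_alg n Quot Kn_ideal n p q \<gamma>\<^esub> a))"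

lemma Kn_rels_carrier: "Kn_rels n p q \<gamma> \<subseteq> carrier (free_alg n)"
  unfolding Kn_rels_def by (safe; intro free_alg_closed free_alg_sum_closed; simp)

lemma ideal_Kn: "ideal (Kn_ideal n p q \<gamma>) (free_alg n)"
  unfolding Kn_ideal_def by (rule ring.genideal_ideal[OF ring_free_alg Kn_rels_carrier])

lemma ring_extend:
  assumes "ring R" shows "ring (ring.extend R r)"
proof -
  interpret ring R by fact
  have sel: "carrier (ring.extend R r) = carrier R" "mult (ring.extend R r) = mult R"
    "one (ring.extend R r) = one R" "zero (ring.extend R r) = zero R" "add (ring.extend R r) = add R"
    by (simp_all add: ring.defs)
  show ?thesis
  proof (rule ringI)
    show "abelian_group (ring.extend R r)"
    proof (rule abelian_groupI; unfold sel)
      fix x assume "x \<in> carrier R"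
      then show "\<exists>y\<in>carrier R. y \<oplus>\<^bsub>R\<^esub> x = \<zero>\<^bsub>R\<^esub>"
        by (intro bexI[of _ "\<ominus>\<^bsub>R\<^esub> x"]) (simp_all add: l_neg)
    qed (simp_all add: a_ac)
    show "Group.monoid (ring.extend R r)"
      by (rule monoidI; unfold sel) (simp_all add: m_assoc)
  qed (unfold sel, simp_all add: l_distr r_distr)
qed

lemma ring_Kn: "ring (Kn n p q \<gamma>)"
  unfolding Kn_def by (intro ring_extend ideal.quotient_is_ring[OF ideal_Kn])

lemma smult_Kn:
  assumes "f \<in> carrier (free_alg n)"
  shows "c \<odot>\<^bsub>Kn n p q \<gamma>\<^esub> Kn_class n p q \<gamma> f = Kn_class n p q \<gamma> (const c * f)"
  using ideal.rcoset_mult_add[OF ideal_Kn free_alg_closed(3) assms, of p q \<gamma> c]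
  by (simp add: Kn_def ring.defs module.defs Kn_class_def FactRing_def) (simp add: free_alg_def)

definition Kn_z ::
    "nat \<Rightarrow> (nat \<Rightarrow> 'k::field) \<Rightarrow> (nat \<Rightarrow> 'k) \<Rightarrow> (nat \<Rightarrow> nat \<Rightarrow> 'k) \<Rightarrow> nat \<Rightarrow> 'k ncpoly set"
  where "Kn_z n p q \<gamma> i =
    (\<Oplus>\<^bsub>Kn n p q \<gamma>\<^esub>l\<in>{1..i}.
      (q l - p l) \<odot>\<^bsub>Kn n p q \<gamma>\<^esub> (Kn_class n p q \<gamma> (gy l) \<otimes>\<^bsub>Kn n p q \<gamma>\<^esub> Kn_class n p q \<gamma> (gx l)))"

definition Kn_Z ::
    "nat \<Rightarrow> (nat \<Rightarrow> 'k::field) \<Rightarrow> (nat \<Rightarrow> 'k) \<Rightarrow> (nat \<Rightarrow> nat \<Rightarrow> 'k) \<Rightarrow> 'k ncpoly set set"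
  where "Kn_Z n p q \<gamma> =
    {foldr (\<lambda>i a. (Kn_z n p q \<gamma> i [^]\<^bsub>Kn n p q \<gamma>\<^esub> e i) \<otimes>\<^bsub>Kn n p q \<gamma>\<^esub> a) [1..<n + 1] \<one>\<^bsub>Kn n p q \<gamma>\<^esub>
      | e :: nat \<Rightarrow> nat. True}"

definition sp_p :: "nat \<Rightarrow> 'k::field"
  where "sp_p i = 1"

definition sp_q :: "'k::field \<Rightarrow> nat \<Rightarrow> 'k"
  where "sp_q q i = inverse (q ^ 2)"

text \<open>The entries with \<open>i \<ge> j\<close> are forced by multiplicative antisymmetry.\<close>

definition sp_gamma :: "'k::field \<Rightarrow> nat \<Rightarrow> nat \<Rightarrow> 'k"
  where "sp_gamma q i j = (if i < j then q else if i = j then 1 else inverse q)"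

text \<open>The standing conditions on the parameters $P$, $Q$, $\Gamma$ of $K_n$.\<close>

lemma sp_parameters:
  assumes "q \<noteq> 0" "q ^ 2 \<noteq> 1"
  shows "sp_p i \<noteq> (0::'k::field)" "sp_q q i \<noteq> 0" "sp_p i \<noteq> sp_q q i"
    "sp_gamma q i i = 1" "sp_gamma q i j * sp_gamma q j i = (1::'k)"
proof -
  have "inverse (q ^ 2) \<noteq> 1"
    using assms(2) inverse_eq_1_iff by blast
  then show "sp_p i \<noteq> sp_q q i"
    by (simp add: sp_p_def sp_q_def)
qed (use assms(1) in \<open>simp_all add: sp_p_def sp_q_def sp_gamma_def\<close>)

abbreviation quantum_symplectic :: "nat \<Rightarrow> 'k::field \<Rightarrow> ('k, 'k ncpoly set) module"
  where "quantum_symplectic n q \<equiv> Kn n sp_p (sp_q q) (sp_gamma q)"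

abbreviation quantum_symplectic_Z :: "nat \<Rightarrow> 'k::field \<Rightarrow> 'k ncpoly set set"
  where "quantum_symplectic_Z n q \<equiv> Kn_Z n sp_p (sp_q q) (sp_gamma q)"

section \<open>Right modules\<close>

record ('a, 'm) right_module = "'m ring" +
  ract :: "['m, 'a] \<Rightarrow> 'm" (infixl \<open>\<triangleleft>\<index>\<close> 70)

text \<open>As in \<^locale>\<open>module\<close>, the fields \<open>mult\<close> and \<open>one\<close> of \<open>M\<close> are irrelevant.\<close>

locale right_module = A?: ring A + M?: abelian_group M
  for A :: "('a, 'b) ring_scheme" (structure)
  and M :: "('a, 'm, 'c) right_module_scheme" (structure) +
  assumes ract_closed: "\<lbrakk>m \<in> carrier M; a \<in> carrier A\<rbrakk> \<Longrightarrow> m \<triangleleft>\<^bsub>M\<^esub> a \<in> carrier M"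
    and ract_add_left: "\<lbrakk>m \<in> carrier M; m' \<in> carrier M; a \<in> carrier A\<rbrakk>
      \<Longrightarrow> (m \<oplus>\<^bsub>M\<^esub> m') \<triangleleft>\<^bsub>M\<^esub> a = (m \<triangleleft>\<^bsub>M\<^esub> a) \<oplus>\<^bsub>M\<^esub> (m' \<triangleleft>\<^bsub>M\<^esub> a)"
    and ract_add_right: "\<lbrakk>m \<in> carrier M; a \<in> carrier A; b \<in> carrier A\<rbrakk>
      \<Longrightarrow> m \<triangleleft>\<^bsub>M\<^esub> (a \<oplus>\<^bsub>A\<^esub> b) = (m \<triangleleft>\<^bsub>M\<^esub> a) \<oplus>\<^bsub>M\<^esub> (m \<triangleleft>\<^bsub>M\<^esub> b)"
    and ract_mult: "\<lbrakk>m \<in> carrier M; a \<in> carrier A; b \<in> carrier A\<rbrakk>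
      \<Longrightarrow> m \<triangleleft>\<^bsub>M\<^esub> (a \<otimes>\<^bsub>A\<^esub> b) = (m \<triangleleft>\<^bsub>M\<^esub> a) \<triangleleft>\<^bsub>M\<^esub> b"
    and ract_one: "m \<in> carrier M \<Longrightarrow> m \<triangleleft>\<^bsub>M\<^esub> \<one>\<^bsub>A\<^esub> = m"

definition fin_gen_right_module ::
    "('a, 'b) ring_scheme \<Rightarrow> ('a, 'm, 'c) right_module_scheme \<Rightarrow> bool"
  where "fin_gen_right_module A M \<longleftrightarrow>
    (\<exists>S. finite S \<and> S \<subseteq> carrier M \<and>
      (\<forall>m\<in>carrier M. \<exists>a\<in>S \<rightarrow> carrier A. m = (\<Oplus>\<^bsub>M\<^esub>s\<in>S. s \<triangleleft>\<^bsub>M\<^esub> a s)))"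

definition torsion_right_module :: "'a set \<Rightarrow> ('a, 'm, 'c) right_module_scheme \<Rightarrow> bool"
  where "torsion_right_module Z M \<longleftrightarrow> (\<forall>m\<in>carrier M. \<exists>s\<in>Z. m \<triangleleft>\<^bsub>M\<^esub> s = \<zero>\<^bsub>M\<^esub>)"

section \<open>Gelfand--Kirillov dimension\<close>

text \<open>
  Linear algebra over the field \<open>'k\<close> in an abelian group \<open>G\<close> (given as a ring record of which only
  the additive part matters) with scalar multiplication \<open>sc\<close>.
\<close>

definition lin_span :: "('v, 'z) ring_scheme \<Rightarrow> ('k::field \<Rightarrow> 'v \<Rightarrow> 'v) \<Rightarrow> 'v set \<Rightarrow> 'v set"
  where "lin_span G sc S = {\<Oplus>\<^bsub>G\<^esub>v\<in>T. sc (c v) v | c T. finite T \<and> T \<subseteq> S}"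

definition lin_indep :: "('v, 'z) ring_scheme \<Rightarrow> ('k::field \<Rightarrow> 'v \<Rightarrow> 'v) \<Rightarrow> 'v set \<Rightarrow> bool"
  where "lin_indep G sc S \<longleftrightarrow>
    (\<forall>c T. finite T \<and> T \<subseteq> S \<and> (\<Oplus>\<^bsub>G\<^esub>v\<in>T. sc (c v) v) = \<zero>\<^bsub>G\<^esub> \<longrightarrow> (\<forall>v\<in>T. c v = 0))"

text \<open>Used only for finite-dimensional subspaces \<open>W\<close>.\<close>

definition lin_dim :: "('v, 'z) ring_scheme \<Rightarrow> ('k::field \<Rightarrow> 'v \<Rightarrow> 'v) \<Rightarrow> 'v set \<Rightarrow> nat"
  where "lin_dim G sc W =
    card (SOME B. B \<subseteq> W \<and> lin_indep G sc B \<and> lin_span G sc B = W)"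

definition fd_subspace :: "('v, 'z) ring_scheme \<Rightarrow> ('k::field \<Rightarrow> 'v \<Rightarrow> 'v) \<Rightarrow> 'v set \<Rightarrow> bool"
  where "fd_subspace G sc W \<longleftrightarrow> (\<exists>S. finite S \<and> S \<subseteq> carrier G \<and> W = lin_span G sc S)"

primrec sub_pow :: "('k::field, 'a, 'z) module_scheme \<Rightarrow> 'a set \<Rightarrow> nat \<Rightarrow> 'a set"
  where
    "sub_pow A V 0 = lin_span A (smult A) {\<one>\<^bsub>A\<^esub>}"
  | "sub_pow A V (Suc m) = lin_span A (smult A) {u \<otimes>\<^bsub>A\<^esub> v | u v. u \<in> sub_pow A V m \<and> v \<in> V}"

text \<open>
  The Gelfand--Kirillov dimension is
  $\sup_V \limsup_m \log_m \dim V^m$ for an algebra and $\sup_{V,F} \limsup_m \log_m \dim (F V^m)$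
  for a right module, $V$ ranging over the finite-dimensional subspaces of the algebra containing
  $1$ and $F$ over the nonzero finite-dimensional subspaces of the module. The zero module thus
  has dimension \<open>- \<infinity>\<close>.
\<close>

definition GKdim_alg :: "('k::field, 'a, 'z) module_scheme \<Rightarrow> ereal"
  where "GKdim_alg A =
    (SUP V \<in> {V. fd_subspace A (smult A) V \<and> \<one>\<^bsub>A\<^esub> \<in> V}.
      limsup (\<lambda>m. ereal (log (real m) (real (lin_dim A (smult A) (sub_pow A V m))))))"

definition mod_scale ::
    "('k::field, 'a, 'z) module_scheme \<Rightarrow> ('a, 'm, 'c) right_module_scheme \<Rightarrow> 'k \<Rightarrow> 'm \<Rightarrow> 'm"
  where "mod_scale A M c m = m \<triangleleft>\<^bsub>M\<^esub> (c \<odot>\<^bsub>A\<^esub> \<one>\<^bsub>A\<^esub>)"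

definition GKdim_mod ::
    "('k::field, 'a, 'z) module_scheme \<Rightarrow> ('a, 'm, 'c) right_module_scheme \<Rightarrow> ereal"
  where "GKdim_mod A M =
    (SUP (V, F) \<in> {(V, F). fd_subspace A (smult A) V \<and> \<one>\<^bsub>A\<^esub> \<in> V \<and>
                    fd_subspace M (mod_scale A M) F \<and> F \<noteq> {\<zero>\<^bsub>M\<^esub>}}.
      limsup (\<lambda>m. ereal (log (real m) (real (lin_dim M (mod_scale A M)
        (lin_span M (mod_scale A M) {f \<triangleleft>\<^bsub>M\<^esub> a | f a. f \<in> F \<and> a \<in> sub_pow A V m}))))))"

end

theory Submission
  imports Defs "HOL-Real_Asymp.Real_Asymp"
begin

text \<open>
  The algebra acts on a module through operators $x_i, y_i, z_i$, where
  $z_i y_j = q^{-2} y_j z_i$ and $x_j z_i = q^{-2} z_i x_j$ for $j \le i$, while $z_i$ commutes with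
  $x_j$ and $y_j$ for $j > i$. Modulo $\mathscr Z$-torsion the $z_i$ are injective. One finds a
  nonzero subspace $V$, stable under all $y_i$ and $z_i$, on which each $y_i$ is either injective or
  zero; put $w_i = y_i$ in the first case and $w_i = x_i$ in the second. If $0 \ne m \in V$, no
  monomial $w^b$ kills a nonzero element of $V$, and $z^e w^b = \chi(e,b)\, w^b z^e$ with a pairing
  $\chi$ that is nondegenerate because $q$ is not a root of unity. Two Vandermonde arguments show
  that the $(k+1)^{2n}$ operators $z^e w^b$ with exponents at most $k$ remain linearly independent
  on the span of the $m z^{e'} w^{b'}$ with exponents $O(k)$. Following Joseph's proof of Bernstein's
  inequality, these operators embed into the linear maps between two spaces of dimension at most
  $d_k = \dim \langle m z^e w^b : e, b = O(k)\rangle$, whence $(k+1)^{2n} \le d_k^2$. The same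
  independence gives the lower bound $2n$ for the algebra, and the ordered monomials in the $y_i$,
  $x_i$ give the upper bound.
\<close>

section \<open>Linear algebra\<close>

text \<open>The vectors m z^e w^b may well be dependent, since the z_i may act on m by scalars. Only
  as operators are the z^e w^b separated; this is why matrices between two spaces are counted and
  why a square root appears in the bound. If y_i kills v, then v x_i^t y_i is a nonzero Q-integer
  times v z_i x_i^{t-1}, where Q = q^{-2}. This carries injectivity over from z_i to x_i. The
  obstacle is that V is not stable under x_i, so the monomials w^b lead out of V. Their injectivity
  is claimed on V alone, which suffices because all m z^e lie in V. The O(k) is explicit: in each
  coordinate \<chi> takes values Q^s with |s| \<le> nk, that is, at most 2nk+1 values, and a
  Vandermonde argument with so many nodes needs exponents up to 2nk. Algebra and module are records
  over carrier sets, whereas the operators act on the type of noncommutative polynomials: f stands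
  for the vector m0 f. Dividing by an annihilator, and then by torsion, means composing every
  operator with a linear projection whose kernel is the subspace to be killed.\<close>

lemma homogeneous_system_nontrivial:
  fixes a :: "'i \<Rightarrow> 'j \<Rightarrow> 'k::field"
  assumes "finite J" "finite I" "card J < card I"
  shows "\<exists>c. (\<exists>i\<in>I. c i \<noteq> 0) \<and> (\<forall>j\<in>J. (\<Sum>i\<in>I. c i * a i j) = 0)"
  using assms
proof (induction J arbitrary: I a rule: finite_induct)
  case empty
  then have "I \<noteq> {}" by auto
  then show ?case by (intro exI[of _ "\<lambda>_. 1"]) auto
next
  case (insert j J)
  show ?case
  proof (cases "\<forall>i\<in>I. a i j = 0")
    case True
    with insert.IH[of I a] insert.prems insert.hyps show ?thesis by auto
  next
    case False
    then obtain i0 where i0: "i0 \<in> I" "a i0 j \<noteq> 0" by auto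
    \<comment> \<open>Gaussian elimination: equation \<open>j\<close> is solved for the unknown
      \<open>i0\<close>, and subtracting \<open>r i\<close> times row \<open>i0\<close> from row
      \<open>i\<close> leaves a system for \<open>J\<close> with one unknown fewer.\<close>
    define r where "r i = a i j / a i0 j" for i
    have "card J < card (I - {i0})"
      using insert i0 by (simp add: card_Diff_singleton)
    from insert.IH[OF _ this, of "\<lambda>i j'. a i j' - r i * a i0 j'"] insert.prems
    obtain c i1 where c: "i1 \<in> I - {i0}" "c i1 \<noteq> 0"
      and eq: "\<forall>j'\<in>J. (\<Sum>i\<in>I - {i0}. c i * (a i j' - r i * a i0 j')) = 0"
      by auto
    define c' where "c' = c(i0 := - (\<Sum>i\<in>I - {i0}. c i * r i))"
    have sum: "(\<Sum>i\<in>I. c' i * a i j') = (\<Sum>i\<in>I - {i0}. c i * (a i j' - r i * a i0 j'))" for j'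
    proof -
      have "(\<Sum>i\<in>I. c' i * a i j') = c' i0 * a i0 j' + (\<Sum>i\<in>I - {i0}. c i * a i j')"
        using i0 insert.prems by (simp add: sum.remove[of I i0] c'_def)
      also have "\<dots> = (\<Sum>i\<in>I - {i0}. c i * a i j') - (\<Sum>i\<in>I - {i0}. c i * r i * a i0 j')"
        by (simp add: c'_def sum_distrib_right)
      finally show ?thesis
        by (simp add: sum_subtractf[symmetric] algebra_simps)
    qed
    have "(\<Sum>i\<in>I. c' i * a i j) = 0"
      unfolding sum using i0 by (simp add: r_def)
    moreover have "c' i1 \<noteq> 0" using c by (simp add: c'_def)
    ultimately show ?thesis
      using sum eq c by (intro exI[of _ c']) auto
  qed
qed

text \<open>
  A separate locale because facts added to \<^locale>\<open>vector_space\<close> would be duplicated for real vector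
  spaces by its global interpretation.
\<close>

locale operator_space = vector_space scale
  for scale :: "'k::field \<Rightarrow> 'v::ab_group_add \<Rightarrow> 'v" (infixr \<open>*s\<close> 75)
begin

text \<open>A basis of \<open>R\<close> extends to a basis of the whole space; killing the former
  and fixing the added vectors projects along \<open>R\<close>. The range of \<rho> serves as the
  quotient by \<open>R\<close> without leaving the type.\<close>

lemma subspace_projection:
  assumes "subspace R"
  obtains \<rho> where "Vector_Spaces.linear scale scale \<rho>" "\<And>v. \<rho> v = 0 \<longleftrightarrow> v \<in> R" "\<And>v. \<rho> v - v \<in> R"
proof -
  interpret P: vector_space_pair scale scale ..
  obtain B where B: "B \<subseteq> R" "independent B" "R \<subseteq> span B"
    using maximal_independent_subset by blast
  obtain B' where B': "B \<subseteq> B'" "independent B'" "UNIV \<subseteq> span B'"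
    using maximal_independent_subset_extend[of B UNIV] B by auto
  obtain \<rho> where \<rho>: "Vector_Spaces.linear scale scale \<rho>" "\<forall>b\<in>B'. \<rho> b = (if b \<in> B then 0 else b)"
    using P.linear_independent_extend[OF B'(2), of "\<lambda>b. if b \<in> B then 0 else b"] by blast
  interpret \<rho>: Vector_Spaces.linear scale scale \<rho> by fact
  have diff: "\<rho> v - v \<in> R" for v
  proof -
    have "v \<in> span B'" using B' by auto
    then show ?thesis
    proof (induction rule: span_induct_alt)
      case (step c x y)
      have "x - \<rho> x \<in> R"
        using \<rho>(2) B(1) step(1) assms by (auto simp: subspace_0)
      then have "\<rho> x - x \<in> R"
        using subspace_neg[OF assms] by force
      then have "c *s (\<rho> x - x) + (\<rho> y - y) \<in> R"
        using step assms by (intro subspace_add subspace_scale)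
      then show ?case
        by (simp add: \<rho>.add \<rho>.scale scale_right_diff_distrib algebra_simps)
    qed (simp add: subspace_0[OF assms])
  qed
  have "\<rho> v = 0" if "v \<in> R" for v
    using \<rho>.eq_0_on_span[of B v] \<rho>(2) B B'(1) that by (metis subsetD)
  moreover have "v \<in> R" if "\<rho> v = 0" for v
    using diff[of v] that subspace_neg[OF assms, of "- v"] by simp
  ultimately show thesis
    using \<rho>(1) diff that by blast
qed

text \<open>Combine the equations with the coefficients of the polynomial vanishing at all values of \<open>t\<close> but \<open>s\<close>.\<close>

lemma power_sums_eq_0:
  assumes "finite B" "card (t ` B) \<le> Suc D"
    and "\<And>e. e \<le> D \<Longrightarrow> (\<Sum>b\<in>B. t b ^ e *s u b) = 0"
  shows "(\<Sum>b\<in>{b \<in> B. t b = s}. u b) = 0"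
proof (cases "s \<in> t ` B")
  case True
  have pol: "\<exists>p. (\<forall>x. (\<Sum>e\<le>card A. p e * x ^ e) = (\<Prod>a\<in>A. x - a))" if "finite A" for A :: "'k set"
    using that
  proof induction
    case empty
    show ?case by (intro exI[of _ "\<lambda>_. 1"]) simp
  next
    case (insert a A)
    then obtain p where p: "\<And>x. (\<Sum>e\<le>card A. p e * x ^ e) = (\<Prod>a\<in>A. x - a)" by blast
    \<comment> \<open>\<open>p'\<close> lists the coefficients of (x - a) times the polynomial given
      by \<open>p\<close>. The guard matters because the values of \<open>p\<close> above
      \<open>card A\<close> are arbitrary.\<close>
    define p' where "p' e = (if e = 0 then 0 else p (e - 1)) - (if e \<le> card A then a * p e else 0)" for e
    have "(\<Sum>e\<le>Suc (card A). p' e * x ^ e) = (x - a) * (\<Prod>a\<in>A. x - a)" for x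
    proof -
      have "(\<Sum>e\<le>Suc (card A). p' e * x ^ e) =
        (\<Sum>e\<le>Suc (card A). (if e = 0 then 0 else p (e - 1)) * x ^ e) -
        (\<Sum>e\<le>Suc (card A). (if e \<le> card A then a * p e else 0) * x ^ e)"
        by (simp add: p'_def left_diff_distrib sum_subtractf del: sum.atMost_Suc)
      also have "(\<Sum>e\<le>Suc (card A). (if e = 0 then 0 else p (e - 1)) * x ^ e) = x * (\<Sum>e\<le>card A. p e * x ^ e)"
        by (subst sum.atMost_Suc_shift) (simp add: sum_distrib_left mult_ac)
      also have "(\<Sum>e\<le>Suc (card A). (if e \<le> card A then a * p e else 0) * x ^ e) = a * (\<Sum>e\<le>card A. p e * x ^ e)"
        by (simp add: sum_distrib_left mult_ac)
      finally show ?thesis by (simp add: p left_diff_distrib)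
    qed
    with insert show ?case by (intro exI[of _ p']) simp
  qed
  define A where "A = t ` B - {s}"
  have fA: "finite A" using assms by (simp add: A_def)
  have cA: "card A \<le> D"
    using True assms(1,2) by (simp add: A_def)
  obtain p where p: "\<And>x. (\<Sum>e\<le>card A. p e * x ^ e) = (\<Prod>a\<in>A. x - a)"
    using pol[OF fA] by blast
  have "(\<Sum>b\<in>B. (\<Prod>a\<in>A. t b - a) *s u b) = (\<Sum>b\<in>B. \<Sum>e\<le>card A. p e *s t b ^ e *s u b)"
    by (simp add: p[symmetric] scale_sum_left)
  also have "\<dots> = (\<Sum>e\<le>card A. p e *s (\<Sum>b\<in>B. t b ^ e *s u b))"
    by (subst sum.swap) (simp add: scale_sum_right)
  also have "\<dots> = 0"
    using assms(3) cA by (intro sum.neutral) auto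
  also have "(\<Sum>b\<in>B. (\<Prod>a\<in>A. t b - a) *s u b) = (\<Sum>b\<in>{b \<in> B. t b = s}. (\<Prod>a\<in>A. s - a) *s u b)"
    using fA assms(1) by (intro sum.mono_neutral_cong_right) (auto simp: A_def)
  finally have "(\<Prod>a\<in>A. s - a) *s (\<Sum>b\<in>{b \<in> B. t b = s}. u b) = 0"
    by (simp add: scale_sum_right)
  then show ?thesis
    using fA by (auto simp: A_def)
next
  case False
  then have "{b \<in> B. t b = s} = {}" by auto
  then show ?thesis by (simp only: sum.empty)
qed

text \<open>Peel off the last coordinate: with the other exponents fixed, the one-variable statement
  cuts the sum down to a fibre of \<open>t (Suc n)\<close>, and the induction hypothesis applies to
  that fibre.\<close>

lemma multi_power_sums_eq_0:
  assumes "finite B" "\<And>i. i \<in> {1..n} \<Longrightarrow> card (t i ` B) \<le> Suc D"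
    and "\<And>e :: nat \<Rightarrow> nat. (\<And>i. i \<in> {1..n} \<Longrightarrow> e i \<le> D) \<Longrightarrow> (\<Sum>b\<in>B. (\<Prod>i\<in>{1..n}. t i b ^ e i) *s u b) = 0"
  shows "(\<Sum>b\<in>{b \<in> B. \<forall>i\<in>{1..n}. t i b = s i}. u b) = 0"
  using assms
proof (induction n arbitrary: B)
  case 0
  then show ?case by simp
next
  case (Suc n)
  let ?B = "{b \<in> B. t (Suc n) b = s (Suc n)}"
  have "(\<Sum>b\<in>{b \<in> ?B. \<forall>i\<in>{1..n}. t i b = s i}. u b) = 0"
  proof (rule Suc.IH)
    show "finite ?B" using Suc.prems by simp
    show "card (t i ` ?B) \<le> Suc D" if "i \<in> {1..n}" for i
    proof -
      have "card (t i ` ?B) \<le> card (t i ` B)"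
        using Suc.prems(1) by (intro card_mono) auto
      with Suc.prems(2)[of i] that show ?thesis by auto
    qed
    show "(\<Sum>b\<in>?B. (\<Prod>i\<in>{1..n}. t i b ^ e i) *s u b) = 0" if e: "\<And>i. i \<in> {1..n} \<Longrightarrow> e i \<le> D" for e
    proof (rule power_sums_eq_0)
      show "(\<Sum>b\<in>B. t (Suc n) b ^ d *s (\<Prod>i = 1..n. t i b ^ e i) *s u b) = 0" if "d \<le> D" for d
      proof -
        have "(\<Sum>b\<in>B. (\<Prod>i\<in>{1..Suc n}. t i b ^ (e(Suc n := d)) i) *s u b) = 0"
          using that e by (intro Suc.prems(3)) auto
        moreover have "(\<Prod>i\<in>{1..Suc n}. t i b ^ (e(Suc n := d)) i) = t (Suc n) b ^ d * (\<Prod>i = 1..n. t i b ^ e i)" for b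
        proof -
          have "(\<Prod>i\<in>{1..Suc n}. t i b ^ (e(Suc n := d)) i) = (\<Prod>i\<in>{1..n}. t i b ^ (e(Suc n := d)) i) * t (Suc n) b ^ d"
            by simp
          also have "(\<Prod>i\<in>{1..n}. t i b ^ (e(Suc n := d)) i) = (\<Prod>i\<in>{1..n}. t i b ^ e i)"
            by (intro prod.cong) auto
          finally show ?thesis by simp
        qed
        ultimately show ?thesis by (simp add: mult.commute)
      qed
    qed (use Suc.prems in auto)
  qed
  moreover have "{b \<in> ?B. \<forall>i\<in>{1..n}. t i b = s i} = {b \<in> B. \<forall>i\<in>{1..Suc n}. t i b = s i}"
    by (auto simp: atLeastAtMostSuc_conv)
  ultimately show ?case by simp
qed

text \<open>Vandermonde in several variables: the coordinates jointly separate the points of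
  \<open>B\<close>, so every fibre is a single point.\<close>

lemma multi_power_sums_separate:
  assumes "finite B" "\<And>i. i \<in> {1..n} \<Longrightarrow> card (t i ` B) \<le> Suc D"
    and "\<And>b b'. b \<in> B \<Longrightarrow> b' \<in> B \<Longrightarrow> (\<And>i. i \<in> {1..n} \<Longrightarrow> t i b = t i b') \<Longrightarrow> b = b'"
    and "\<And>e :: nat \<Rightarrow> nat. (\<And>i. i \<in> {1..n} \<Longrightarrow> e i \<le> D) \<Longrightarrow> (\<Sum>b\<in>B. (\<Prod>i\<in>{1..n}. t i b ^ e i) *s u b) = 0"
    and "b0 \<in> B"
  shows "u b0 = 0"
proof -
  have "(\<Sum>b\<in>{b \<in> B. \<forall>i\<in>{1..n}. t i b = t i b0}. u b) = 0"
    by (rule multi_power_sums_eq_0[where D=D]) (use assms in auto)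
  moreover have "{b \<in> B. \<forall>i\<in>{1..n}. t i b = t i b0} = {b0}"
    using assms(3,5) by auto
  ultimately show ?thesis by simp
qed

end

section \<open>Quasi-commuting operators\<close>

text \<open>\<open>A 1\<close> acts first. If the \<open>A i\<close> are right multiplications by
  a_i, this is right multiplication by the monomial a_1^(e 1) ... a_j^(e j), written in the usual
  order.\<close>

primrec op_mono :: "(nat \<Rightarrow> 'v \<Rightarrow> 'v) \<Rightarrow> nat \<Rightarrow> (nat \<Rightarrow> nat) \<Rightarrow> 'v \<Rightarrow> 'v"
  where
    "op_mono A 0 e v = v"
  | "op_mono A (Suc j) e v = (A (Suc j) ^^ e (Suc j)) (op_mono A j e v)"

lemma op_mono_cong:
  "(\<And>i. i \<in> {1..j} \<Longrightarrow> e i = e' i) \<Longrightarrow> op_mono A j e v = op_mono A j e' v"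
  by (induction j) auto

lemma op_mono_unit:
  "op_mono A j (\<lambda>l. if l = i then 1 else 0) v = (if i \<in> {1..j} then A i v else v)"
  by (induction j) auto

lemma funpow_closed: "(\<And>v. v \<in> S \<Longrightarrow> f v \<in> S) \<Longrightarrow> v \<in> S \<Longrightarrow> (f ^^ t) v \<in> S"
  by (induction t) auto

lemma op_mono_closed:
  "(\<And>i v. i \<in> {1..j} \<Longrightarrow> v \<in> S \<Longrightarrow> A i v \<in> S) \<Longrightarrow> v \<in> S \<Longrightarrow> op_mono A j e v \<in> S"
proof (induction j)
  case (Suc j)
  then show ?case by (auto intro!: funpow_closed)
qed simp

lemma op_mono_eq_0_imp:
  assumes closed: "\<And>i v. i \<in> {1..n} \<Longrightarrow> v \<in> S \<Longrightarrow> A i v \<in> S"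
    and inj: "\<And>i v. i \<in> {1..n} \<Longrightarrow> v \<in> S \<Longrightarrow> A i v = 0 \<Longrightarrow> v = 0"
    and "j \<le> n" "v \<in> S" "op_mono A j e v = 0"
  shows "v = (0::'v::zero)"
  using assms(3,5)
proof (induction j)
  case 0
  then show ?case by simp
next
  case (Suc j)
  have pow: "u = 0" if "u \<in> S" "(A (Suc j) ^^ t) u = 0" for u t
    using that(2)
  proof (induction t)
    case (Suc t)
    have "(A (Suc j) ^^ t) u \<in> S"
      using that(1) closed[of "Suc j"] \<open>Suc j \<le> n\<close> by (intro funpow_closed) auto
    with Suc inj[of "Suc j"] \<open>Suc j \<le> n\<close> show ?case by simp
  qed simp
  have "op_mono A j e v \<in> S"
    using Suc.prems(1) assms(4) by (intro op_mono_closed closed) auto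
  then have "op_mono A j e v = 0"
    using pow Suc.prems(2) by simp
  with Suc show ?case by simp
qed

context operator_space
begin

abbreviation lin :: "('v \<Rightarrow> 'v) \<Rightarrow> bool"
  where "lin \<equiv> Vector_Spaces.linear scale scale"

lemma lin_simps:
  assumes "lin f"
  shows "f (c *s v) = c *s f v" "f (u + v) = f u + f v" "f (u - v) = f u - f v" "f 0 = 0"
    "f (sum g S) = (\<Sum>s\<in>S. f (g s))"
proof -
  interpret Vector_Spaces.linear scale scale f by fact
  show "f (c *s v) = c *s f v" "f (u + v) = f u + f v" "f (u - v) = f u - f v" "f 0 = 0"
    "f (sum g S) = (\<Sum>s\<in>S. f (g s))"
    by (simp_all add: scale add diff sum)
qed

lemma linI: "(\<And>u v. f (u + v) = f u + f v) \<Longrightarrow> (\<And>c v. f (c *s v) = c *s f v) \<Longrightarrow> lin f"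
  by (simp add: Vector_Spaces.linear_iff vector_space_axioms)

lemma lin_funpow: "lin f \<Longrightarrow> lin (f ^^ t)"
  by (induction t) (auto intro!: linI simp: lin_simps)

lemma lin_op_mono: "(\<And>i. lin (A i)) \<Longrightarrow> lin (op_mono A j e)"
  by (induction j) (auto intro!: linI simp: lin_simps lin_funpow)

lemma lin_in_span_image:
  assumes "lin f" "v \<in> span S" "\<And>s. s \<in> S \<Longrightarrow> f s \<in> span T"
  shows "f v \<in> span T"
  using assms(2)
  by (induction rule: span_induct_alt)
     (auto simp: lin_simps[OF assms(1)] span_zero intro!: span_add span_scale assms(3))

lemma commute_funpow_right:
  assumes "\<And>v. f (g v) = c *s g (f v)" "lin g"
  shows "f ((g ^^ t) v) = c ^ t *s (g ^^ t) (f v)"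
  by (induction t) (simp_all add: assms(1) lin_simps(1)[OF assms(2)])

lemma commute_funpow:
  assumes "\<And>v. f (g v) = c *s g (f v)" "lin f" "lin g"
  shows "(f ^^ s) ((g ^^ t) v) = c ^ (t * s) *s (g ^^ t) ((f ^^ s) v)"
proof (induction s)
  case (Suc s)
  have "(f ^^ Suc s) ((g ^^ t) v) = c ^ (t * s) *s f ((g ^^ t) ((f ^^ s) v))"
    by (simp only: funpow.simps o_apply Suc.IH lin_simps(1)[OF assms(2)])
  also have "\<dots> = c ^ (t * Suc s) *s (g ^^ t) ((f ^^ Suc s) v)"
    by (simp only: funpow.simps o_apply commute_funpow_right[of f g c, OF assms(1,3)] scale_scale power_add[symmetric] mult_Suc_right add.commute)
  finally show ?case .
qed simp

lemma commute_funpow_op_mono: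
  assumes "\<And>i v. i \<in> {1..n} \<Longrightarrow> f (A i v) = c i *s A i (f v)" "lin f" "\<And>i. lin (A i)"
  shows "j \<le> n \<Longrightarrow>
    (f ^^ s) (op_mono A j e v) = (\<Prod>i = 1..j. c i ^ (e i * s)) *s op_mono A j e ((f ^^ s) v)"
proof (induction j)
  case (Suc j)
  let ?r = "\<Prod>i = 1..j. c i ^ (e i * s)"
  have "(f ^^ s) (op_mono A (Suc j) e v) =
      c (Suc j) ^ (e (Suc j) * s) *s (A (Suc j) ^^ e (Suc j)) ((f ^^ s) (op_mono A j e v))"
    using Suc.prems
    by (subst commute_funpow[of f "A (Suc j)" "c (Suc j)", OF _ assms(2,3), symmetric]) (simp_all add: assms(1))
  also have "(f ^^ s) (op_mono A j e v) = ?r *s op_mono A j e ((f ^^ s) v)"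
    using Suc by simp
  also have "(A (Suc j) ^^ e (Suc j)) (?r *s op_mono A j e ((f ^^ s) v)) =
      ?r *s op_mono A (Suc j) e ((f ^^ s) v)"
    by (simp add: lin_simps(1)[OF lin_funpow[OF assms(3)]])
  finally show ?case by (simp add: mult.commute)
qed simp

lemma commute_op_mono:
  assumes "\<And>i l v. i \<in> {1..n} \<Longrightarrow> l \<in> {1..n} \<Longrightarrow> B l (A i v) = c i l *s A i (B l v)"
    and "\<And>i. lin (A i)" "\<And>i. lin (B i)" "j \<le> n"
  shows "k \<le> n \<Longrightarrow> op_mono B k b (op_mono A j e v) =
    (\<Prod>i = 1..j. \<Prod>l = 1..k. c i l ^ (e i * b l)) *s op_mono A j e (op_mono B k b v)"
proof (induction k)
  case (Suc k)
  let ?r = "\<Prod>i = 1..j. \<Prod>l = 1..k. c i l ^ (e i * b l)"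
  have "op_mono B (Suc k) b (op_mono A j e v) =
      (B (Suc k) ^^ b (Suc k)) (?r *s op_mono A j e (op_mono B k b v))"
    using Suc by simp
  also have "\<dots> = ?r *s (B (Suc k) ^^ b (Suc k)) (op_mono A j e (op_mono B k b v))"
    by (simp only: lin_simps(1)[OF lin_funpow[OF assms(3)]])
  also have "(B (Suc k) ^^ b (Suc k)) (op_mono A j e (op_mono B k b v)) =
      (\<Prod>i = 1..j. c i (Suc k) ^ (e i * b (Suc k))) *s op_mono A j e (op_mono B (Suc k) b v)"
    using Suc.prems by (subst commute_funpow_op_mono[where n = n and c = "\<lambda>i. c i (Suc k)"]) (simp_all add: assms)
  finally show ?case
    by (simp add: prod.distrib[symmetric])
qed simp

text \<open>Sorting a product of two monomials only collects factors \<open>c\<close>. Hence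
  \<kappa> is nonzero and independent of \<open>v\<close>; its value never matters.\<close>

lemma op_mono_add:
  assumes "\<And>i l v. i \<in> {1..n} \<Longrightarrow> l \<in> {1..n} \<Longrightarrow> A l (A i v) = c i l *s A i (A l v)"
    and "\<And>i l. i \<in> {1..n} \<Longrightarrow> l \<in> {1..n} \<Longrightarrow> c i l \<noteq> 0" "\<And>i. lin (A i)"
  shows "j \<le> n \<Longrightarrow> \<exists>\<kappa>. \<kappa> \<noteq> 0 \<and> (\<forall>v. op_mono A j b (op_mono A j b' v) = \<kappa> *s op_mono A j (\<lambda>i. b i + b' i) v)"
proof (induction j)
  case 0
  then show ?case by (auto intro: exI[of _ 1])
next
  case (Suc j)
  then obtain \<kappa> where \<kappa>: "\<kappa> \<noteq> 0"
    "\<And>v. op_mono A j b (op_mono A j b' v) = \<kappa> *s op_mono A j (\<lambda>i. b i + b' i) v"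
    by auto
  let ?P = "A (Suc j) ^^ b (Suc j)" and ?P' = "A (Suc j) ^^ b' (Suc j)"
  define r where "r = (\<Prod>i = 1..j. c i (Suc j) ^ (b i * b' (Suc j)))"
  have r: "r \<noteq> 0" using assms(2) Suc.prems by (auto simp: r_def)
  have comm: "op_mono A j b (?P' u) = inverse r *s ?P' (op_mono A j b u)" for u
  proof -
    have "?P' (op_mono A j b u) = r *s op_mono A j b (?P' u)"
      unfolding r_def using Suc.prems by (intro commute_funpow_op_mono[where n = n] assms) auto
    with r show ?thesis by simp
  qed
  have "op_mono A (Suc j) b (op_mono A (Suc j) b' v) =
      (inverse r * \<kappa>) *s op_mono A (Suc j) (\<lambda>i. b i + b' i) v" for v
  proof -
    have "op_mono A (Suc j) b (op_mono A (Suc j) b' v) =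
        ?P (inverse r *s ?P' (\<kappa> *s op_mono A j (\<lambda>i. b i + b' i) v))"
      by (simp only: op_mono.simps comm \<kappa>(2))
    also have "\<dots> = (inverse r * \<kappa>) *s ?P (?P' (op_mono A j (\<lambda>i. b i + b' i) v))"
      by (simp only: lin_simps(1)[OF lin_funpow[OF assms(3)]] scale_scale)
    finally show ?thesis by (simp add: funpow_add)
  qed
  with \<kappa>(1) r show ?case by (intro exI[of _ "inverse r * \<kappa>"]) auto
qed

end

section \<open>Operators satisfying the relations of the quantum symplectic space\<close>

text \<open>\<open>X i\<close> and \<open>Y i\<close> are the right actions of $x_i$ and $y_i$, so products are read backwards.\<close>

locale qs_ops = operator_space scale
  for scale :: "'k::field \<Rightarrow> 'v::ab_group_add \<Rightarrow> 'v" (infixr \<open>*s\<close> 75) +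
  fixes n :: nat and q :: 'k and X Y :: "nat \<Rightarrow> 'v \<Rightarrow> 'v"
  assumes q_nz: "q \<noteq> 0" and q_nonroot: "k > 0 \<Longrightarrow> q ^ k \<noteq> 1"
    and lin_X: "lin (X i)" and lin_Y: "lin (Y i)"
    and XX: "1 \<le> i \<Longrightarrow> i < j \<Longrightarrow> j \<le> n \<Longrightarrow> X j (X i v) = inverse q *s X i (X j v)"
    and YY: "1 \<le> i \<Longrightarrow> i < j \<Longrightarrow> j \<le> n \<Longrightarrow> Y j (Y i v) = q *s Y i (Y j v)"
    and YX: "i \<in> {1..n} \<Longrightarrow> j \<in> {1..n} \<Longrightarrow> i \<noteq> j \<Longrightarrow> Y j (X i v) = inverse q *s X i (Y j v)"
    and YXi: "i \<in> {1..n} \<Longrightarrow> Y i (X i v) =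
      inverse (q ^ 2) *s X i (Y i v) + (\<Sum>l = 1..<i. (inverse (q ^ 2) - 1) *s X l (Y l v))"
begin

text \<open>The common value of the parameters q_i. As p_i = 1, the coefficients q_l - p_l of the
  z_i all equal Q - 1.\<close>

definition Q :: 'k where "Q = inverse (q ^ 2)"

definition Z :: "nat \<Rightarrow> 'v \<Rightarrow> 'v"
  where "Z i v = (\<Sum>l = 1..i. (Q - 1) *s X l (Y l v))"

lemma Q_nz: "Q \<noteq> 0"
  using q_nz by (simp add: Q_def)

lemma Q_nonroot: "k > 0 \<Longrightarrow> Q ^ k \<noteq> 1"
  using q_nonroot[of "2 * k"] by (simp add: Q_def power_inverse power_mult)

text \<open>Integer exponents are needed because x_i and y_i pass the z's with opposite powers of
  Q.\<close>

lemma powi_Q_inj: "Q powi a = Q powi b \<Longrightarrow> a = b"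
proof -
  have aux: False if "Q powi a = Q powi b" "a < b" for a b :: int
  proof -
    have "Q powi (b - a) = 1"
      using that Q_nz by (simp add: power_int_diff)
    moreover have "Q powi (b - a) = Q ^ nat (b - a)"
      using that by (simp add: power_int_def)
    ultimately show False
      using Q_nonroot[of "nat (b - a)"] that by simp
  qed
  show "Q powi a = Q powi b \<Longrightarrow> a = b"
    using aux[of a b] aux[of b a] by (metis linorder_neqE)
qed

lemmas X_simps = lin_simps[OF lin_X]
lemmas Y_simps = lin_simps[OF lin_Y]

lemma lin_Z: "lin (Z i)"
  by (rule linI)
     (simp_all add: Z_def X_simps Y_simps scale_right_distrib sum.distrib scale_sum_right mult.commute)

lemma Z_0 [simp]: "Z 0 v = 0"
  by (simp add: Z_def)

lemma Z_Suc: "Z (Suc i) v = Z i v + (Q - 1) *s X (Suc i) (Y (Suc i) v)"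
  by (simp add: Z_def)

lemma YX_same: "i \<in> {1..n} \<Longrightarrow> Y i (X i v) = Q *s X i (Y i v) + Z (i - 1) v"
proof -
  assume i: "i \<in> {1..n}"
  then have "{1..<i} = {1..i - 1}" by auto
  with YXi[OF i] show ?thesis by (simp add: Q_def Z_def)
qed

lemma XX': "1 \<le> i \<Longrightarrow> i < j \<Longrightarrow> j \<le> n \<Longrightarrow> X i (X j v) = q *s X j (X i v)"
  using XX[of i j v] q_nz by simp

lemma YY': "1 \<le> i \<Longrightarrow> i < j \<Longrightarrow> j \<le> n \<Longrightarrow> Y i (Y j v) = inverse q *s Y j (Y i v)"
  using YY[of i j v] q_nz by simp

lemma XY: "i \<in> {1..n} \<Longrightarrow> j \<in> {1..n} \<Longrightarrow> i \<noteq> j \<Longrightarrow> X i (Y j v) = q *s Y j (X i v)"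
  using YX[of i j v] q_nz by simp

text \<open>The summand of index l passes \<open>Y j\<close> with factor q^{-1} q = 1 if l < j and
  q^{-1} q^{-1} = Q if l > j. At l = j the inhomogeneous term z_{j-1} of the relation supplies
  exactly what the lower summands, so far with factor 1, need to get the factor Q as well.\<close>

lemma Y_Z: "j \<in> {1..n} \<Longrightarrow> i \<le> n \<Longrightarrow> Y j (Z i v) = (if j \<le> i then Q else 1) *s Z i (Y j v)"
proof (induction i arbitrary: v)
  case 0
  then show ?case by (simp add: Y_simps)
next
  case (Suc i)
  let ?i = "Suc i"
  have IH: "Y j (Z i v) = (if j \<le> i then Q else 1) *s Z i (Y j v)" for v
    using Suc by simp
  consider "j \<le> i" | "j = ?i" | "j > ?i" by linarith
  then show ?case
  proof cases
    case 1
    have "Y j (X ?i (Y ?i v)) = Q *s X ?i (Y ?i (Y j v))"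
      using 1 Suc.prems YX[of ?i j] YY'[of j ?i]
      by (simp add: X_simps Q_def power2_eq_square)
    then show ?thesis
      using 1 IH by (simp add: Z_Suc Y_simps scale_right_distrib mult.commute)
  next
    case 2
    have "Y j (Z ?i v) = Z i (Y j v) + (Q - 1) *s (Q *s X ?i (Y ?i (Y j v)) + Z i (Y j v))"
      using 2 Suc.prems IH YX_same[of ?i] by (simp add: Z_Suc Y_simps)
    also have "\<dots> = Q *s (Z i (Y j v) + (Q - 1) *s X ?i (Y ?i (Y j v)))"
      by (simp add: algebra_simps)
    finally show ?thesis using 2 by (simp add: Z_Suc)
  next
    case 3
    have "Y j (X ?i (Y ?i v)) = X ?i (Y ?i (Y j v))"
      using 3 Suc.prems YX[of ?i j] YY[of ?i j] q_nz by (simp add: X_simps)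
    then show ?thesis
      using 3 IH by (simp add: Z_Suc Y_simps)
  qed
qed

text \<open>The same bookkeeping with inverse factors. At index \<open>j\<close> the inhomogeneous
  relation is used in the other direction, starting from \<open>Z j (X j v)\<close>.\<close>

lemma X_Z: "j \<in> {1..n} \<Longrightarrow> i \<le> n \<Longrightarrow> X j (Z i v) = (if j \<le> i then inverse Q else 1) *s Z i (X j v)"
proof (induction i arbitrary: v)
  case 0
  then show ?case by (simp add: X_simps)
next
  case (Suc i)
  let ?i = "Suc i"
  have IH: "X j (Z i v) = (if j \<le> i then inverse Q else 1) *s Z i (X j v)" for v
    using Suc by simp
  consider "j \<le> i" | "j = ?i" | "j > ?i" by linarith
  then show ?case
  proof cases
    case 1
    have "X j (X ?i (Y ?i v)) = inverse Q *s X ?i (Y ?i (X j v))"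
      using 1 Suc.prems XX'[of j ?i] XY[of j ?i]
      by (simp add: X_simps Q_def power2_eq_square)
    then show ?thesis
      using 1 IH by (simp add: Z_Suc X_simps scale_right_distrib mult.commute)
  next
    case 2
    have "Z ?i (X j v) = X j (Z i v) + (Q - 1) *s X j (Q *s X j (Y j v) + Z i v)"
      using 2 Suc.prems IH YX_same[of ?i] by (simp add: Z_Suc X_simps)
    also have "\<dots> = Q *s X j (Z ?i v)"
      using 2 by (simp add: Z_Suc X_simps algebra_simps)
    finally show ?thesis using 2 Q_nz by simp
  next
    case 3
    have "X j (X ?i (Y ?i v)) = X ?i (Y ?i (X j v))"
      using 3 Suc.prems XX[of ?i j] XY[of j ?i] q_nz by (simp add: X_simps)
    then show ?thesis
      using 3 IH by (simp add: Z_Suc X_simps)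
  qed
qed

text \<open>x_j and y_j pass z_i with mutually inverse factors, so each y_j x_j commutes with
  z_i.\<close>

lemma Z_Z: "i \<le> n \<Longrightarrow> j \<le> n \<Longrightarrow> Z j (Z i v) = Z i (Z j v)"
proof (induction j)
  case (Suc j)
  have "X (Suc j) (Y (Suc j) (Z i v)) = Z i (X (Suc j) (Y (Suc j) v))"
    using Suc.prems Y_Z[of "Suc j" i] X_Z[of "Suc j" i] Q_nz by (auto simp: X_simps)
  with Suc show ?case by (simp add: Z_Suc lin_simps[OF lin_Z])
qed (simp add: lin_simps[OF lin_Z])

lemma Z_mono_comm: "op_mono Z n e (op_mono Z n e' v) = op_mono Z n e' (op_mono Z n e v)"
  using commute_op_mono[of n Z Z "\<lambda>_ _. 1" n n e e' v] Z_Z by (simp add: lin_Z)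

lemma Z_mono_add_eq: "op_mono Z n e (op_mono Z n e' v) = op_mono Z n (\<lambda>i. e i + e' i) v"
proof -
  have "op_mono Z j e (op_mono Z j e' v) = op_mono Z j (\<lambda>i. e i + e' i) v" if "j \<le> n" for j v
    using that
  proof (induction j)
    case (Suc j)
    have "(Z (Suc j) ^^ e' (Suc j)) (op_mono Z j e u) = op_mono Z j e ((Z (Suc j) ^^ e' (Suc j)) u)" for u
      using commute_funpow_op_mono[of n "Z (Suc j)" Z "\<lambda>_. 1" j "e' (Suc j)" e u] Suc.prems Z_Z lin_Z
      by simp
    then have "op_mono Z (Suc j) e (op_mono Z (Suc j) e' v) =
        (Z (Suc j) ^^ e (Suc j)) ((Z (Suc j) ^^ e' (Suc j)) (op_mono Z j e (op_mono Z j e' v)))"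
      by simp
    with Suc show ?case by (simp add: funpow_add)
  qed simp
  then show ?thesis by simp
qed

text \<open>y_i behaves like a Q-derivation on powers of x_i: z_{i-1} commutes with x_i, and the t
  places where it arises contribute 1, Q, ..., Q^{t-1}. At \<open>t = 0\<close> the truncated
  exponent \<open>t - 1\<close> is harmless, since its coefficient is an empty sum.\<close>

lemma Y_X_pow:
  assumes "i \<in> {1..n}"
  shows "Y i ((X i ^^ t) v) =
    Q ^ t *s (X i ^^ t) (Y i v) + (\<Sum>s<t. Q ^ s) *s (X i ^^ (t - 1)) (Z (i - 1) v)"
proof (induction t)
  case (Suc t)
  have Zpow: "Z (i - 1) ((X i ^^ t) v) = (X i ^^ t) (Z (i - 1) v)" for t
    using assms commute_funpow_right[of "Z (i - 1)" "X i" 1 t v] X_Z[of i "i - 1"] lin_X by auto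
  have shift: "X i ((X i ^^ (t - 1)) u) = (X i ^^ t) u" if "t > 0" for u
    using that by (cases t) auto
  have "Y i ((X i ^^ Suc t) v) = Q *s X i (Y i ((X i ^^ t) v)) + (X i ^^ t) (Z (i - 1) v)"
    using YX_same[OF assms] Zpow by simp
  also have "\<dots> = Q ^ Suc t *s (X i ^^ Suc t) (Y i v) +
      ((Q * (\<Sum>s<t. Q ^ s)) *s (X i ^^ t) (Z (i - 1) v) + (X i ^^ t) (Z (i - 1) v))"
    using shift[of "Z (i - 1) v"] by (cases "t = 0") (simp_all add: Suc.IH X_simps scale_right_distrib)
  also have "(Q * (\<Sum>s<t. Q ^ s)) *s (X i ^^ t) (Z (i - 1) v) + (X i ^^ t) (Z (i - 1) v) =
      (Q * (\<Sum>s<t. Q ^ s) + 1) *s (X i ^^ t) (Z (i - 1) v)"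
    by (simp add: scale_left_distrib)
  also have "Q * (\<Sum>s<t. Q ^ s) + 1 = (\<Sum>s<Suc t. Q ^ s)"
    by (simp add: sum.lessThan_Suc_shift sum_distrib_left del: sum.lessThan_Suc)
  finally show ?case by simp
qed simp

text \<open>True in every characteristic: the sum is (Q^t - 1) / (Q - 1), and Q is not a root of
  unity.\<close>

lemma geometric_nz: "t > 0 \<Longrightarrow> (\<Sum>s<t. Q ^ s) \<noteq> 0"
  using Q_nonroot[of t] Q_nonroot[of 1] by (simp add: geometric_sum)

end

section \<open>Lower bounds on a module on which the $z_i$ are injective\<close>

text \<open>Injectivity of \<open>Z i\<close> is demanded on \<open>U\<close> rather than on the
  whole type, because the quotient is modelled by the range of a projection: vectors in the kernel
  of the projection are killed by the compressed operators.\<close>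

locale qs_regular = qs_ops +
  fixes U :: "'b set"
  assumes U: "subspace U" 
    and U_X: "i \<in> {1..n} \<Longrightarrow> v \<in> U \<Longrightarrow> X i v \<in> U"
    and U_Y: "i \<in> {1..n} \<Longrightarrow> v \<in> U \<Longrightarrow> Y i v \<in> U"
    and Z_inj: "i \<in> {1..n} \<Longrightarrow> v \<in> U \<Longrightarrow> Z i v = 0 \<Longrightarrow> v = 0"
begin

lemma U_Z: "i \<in> {1..n} \<Longrightarrow> v \<in> U \<Longrightarrow> Z i v \<in> U"
  unfolding Z_def by (intro subspace_sum[OF U] subspace_scale[OF U] U_X U_Y) auto

text \<open>On the kernel of \<open>Y i\<close> the operators \<open>Z i\<close> and
  \<open>Z (i - 1)\<close> agree. Applying \<open>Y i\<close> to x_i^{t+1} v = 0 therefore leaves a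
  nonzero Q-integer times x_i^t applied to \<open>Z i v\<close>, which again lies in this kernel.
  Induction gives \<open>Z i v = 0\<close>.\<close>

lemma X_inj_ker_Y:
  assumes "i \<in> {1..n}" "v \<in> U" "Y i v = 0" "(X i ^^ t) v = 0"
  shows "v = 0"
  using assms(2-)
proof (induction t arbitrary: v)
  case (Suc t)
  have "Z i v = Z (i - 1) v"
    using Z_Suc[of "i - 1" v] assms(1) Suc.prems by (simp add: X_simps)
  then have "(\<Sum>s<Suc t. Q ^ s) *s (X i ^^ t) (Z i v) = 0"
    using Y_X_pow[OF assms(1), of "Suc t" v] Suc.prems(2,3) by (simp add: X_simps Y_simps lin_simps(4)[OF lin_funpow[OF lin_X]])
  then have "(X i ^^ t) (Z i v) = 0"
    using geometric_nz[of "Suc t"] by simp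
  moreover have "Y i (Z i v) = 0"
    using Y_Z[of i i v] assms(1) Suc.prems by (simp add: lin_simps[OF lin_Z])
  ultimately have "Z i v = 0"
    using Suc.IH[of "Z i v"] U_Z assms(1) Suc.prems by simp
  then show ?case using Z_inj assms(1) Suc.prems by simp
qed simp

text \<open>The y_j are treated one by one: if y_j is not injective on the current \<open>V\<close>,
  replace \<open>V\<close> by the kernel of y_j in it. The kernel stays stable because the y_i and
  z_i pass y_j up to scalars, and for earlier indices both being injective and being zero are
  inherited by subspaces.\<close>

lemma exists_Y_cone:
  assumes "v0 \<in> U" "v0 \<noteq> 0" "k \<le> n"
  shows "\<exists>\<epsilon> V m. subspace V \<and> V \<subseteq> U \<and> m \<in> V \<and> m \<noteq> 0 \<and>
    (\<forall>v\<in>V. \<forall>i\<in>{1..n}. Y i v \<in> V \<and> Z i v \<in> V) \<and>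
    (\<forall>i\<in>{1..k}. if \<epsilon> i then \<forall>v\<in>V. Y i v = 0 \<longrightarrow> v = 0 else \<forall>v\<in>V. Y i v = 0)"
  using assms(3)
proof (induction k)
  case 0
  show ?case
    by (rule exI[of _ "\<lambda>_. True"], rule exI[of _ U], rule exI[of _ v0])
       (use assms U U_Y U_Z in auto)
next
  case (Suc k)
  from Suc.IH[OF Suc_leD[OF Suc.prems]] obtain \<epsilon> V m where "subspace V \<and> V \<subseteq> U \<and> m \<in> V \<and> m \<noteq> 0 \<and>
      (\<forall>v\<in>V. \<forall>i\<in>{1..n}. Y i v \<in> V \<and> Z i v \<in> V) \<and>
      (\<forall>i\<in>{1..k}. if \<epsilon> i then \<forall>v\<in>V. Y i v = 0 \<longrightarrow> v = 0 else \<forall>v\<in>V. Y i v = 0)"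
    by (elim exE) (rule that)
  then have IH: "subspace V" "V \<subseteq> U" "m \<in> V" "m \<noteq> 0"
    "\<And>v i. v \<in> V \<Longrightarrow> i \<in> {1..n} \<Longrightarrow> Y i v \<in> V" "\<And>v i. v \<in> V \<Longrightarrow> i \<in> {1..n} \<Longrightarrow> Z i v \<in> V"
    "\<And>i. i \<in> {1..k} \<Longrightarrow> if \<epsilon> i then \<forall>v\<in>V. Y i v = 0 \<longrightarrow> v = 0 else \<forall>v\<in>V. Y i v = 0"
    by blast+
  let ?j = "Suc k"
  show ?case
  proof (cases "\<forall>v\<in>V. Y ?j v = 0 \<longrightarrow> v = 0")
    case True
    have "if (\<epsilon>(?j := True)) i then \<forall>v\<in>V. Y i v = 0 \<longrightarrow> v = 0 else \<forall>v\<in>V. Y i v = 0"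
      if "i \<in> {1..?j}" for i
      using that True IH(7)[of i] by (cases "i = ?j") auto
    then show ?thesis
      using IH(1-6) by (intro exI[of _ "\<epsilon>(?j := True)"] exI[of _ V] exI[of _ m]) blast
  next
    case False
    then obtain m' where m': "m' \<in> V" "Y ?j m' = 0" "m' \<noteq> 0" by auto
    define V' where "V' = {v \<in> V. Y ?j v = 0}"
    have "subspace V'"
      using IH(1) by (auto simp: V'_def subspace_def Y_simps)
    moreover have "Z i v \<in> V'" if "v \<in> V'" "i \<in> {1..n}" for i v
      using that IH(6) Y_Z[of ?j i v] Suc.prems by (auto simp: V'_def lin_simps[OF lin_Z])
    moreover have "Y i v \<in> V'" if "v \<in> V'" "i \<in> {1..n}" for i v
    proof -
      have "Y ?j (Y i v) = 0"
        using that Suc.prems YY[of i ?j v] YY'[of ?j i v]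
        by (cases i ?j rule: linorder_cases) (auto simp: V'_def Y_simps)
      then show ?thesis using that IH(5) by (auto simp: V'_def)
    qed
    moreover have "if (\<epsilon>(?j := False)) i then \<forall>v\<in>V'. Y i v = 0 \<longrightarrow> v = 0 else \<forall>v\<in>V'. Y i v = 0"
      if "i \<in> {1..?j}" for i
      using that IH(7)[of i] by (cases "i = ?j") (auto simp: V'_def)
    moreover have "V' \<subseteq> U" "m' \<in> V'" using m' IH(2) by (auto simp: V'_def)
    ultimately show ?thesis
      using m'(3) by (intro exI[of _ "\<epsilon>(?j := False)"] exI[of _ V'] exI[of _ m']) blast
  qed
qed

end

text \<open>
  Where \<open>Y i\<close> is zero on \<open>V\<close>, the operator \<open>X i\<close> is injective and takes its place. The monomials in
  these operators move \<open>m\<close> between pairwise different twists of the action of the \<open>Z i\<close>.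
\<close>

locale qs_cone = qs_regular +
  fixes \<epsilon> :: "nat \<Rightarrow> bool" and V and m :: 'b
  assumes V: "subspace V" "V \<subseteq> U" and m: "m \<in> V" "m \<noteq> 0"
    and V_Y: "i \<in> {1..n} \<Longrightarrow> v \<in> V \<Longrightarrow> Y i v \<in> V" and V_Z: "i \<in> {1..n} \<Longrightarrow> v \<in> V \<Longrightarrow> Z i v \<in> V"
    and dich: "i \<in> {1..n} \<Longrightarrow> if \<epsilon> i then \<forall>v\<in>V. Y i v = 0 \<longrightarrow> v = 0 else \<forall>v\<in>V. Y i v = 0"
begin

definition W :: "nat \<Rightarrow> 'b \<Rightarrow> 'b"
  where "W i = (if \<epsilon> i then Y i else X i)"

text \<open>The exponent of Q with which w_i passes the z's: y_i brings Q, x_i brings its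
  inverse.\<close>

definition sg :: "nat \<Rightarrow> int"
  where "sg i = (if \<epsilon> i then 1 else - 1)"

definition lam :: "nat \<Rightarrow> nat \<Rightarrow> 'a"
  where "lam i j = (if j \<le> i then Q powi sg j else 1)"

lemma lam_nz: "lam i j \<noteq> 0"
  using Q_nz by (simp add: lam_def)

lemma lin_W: "lin (W i)"
  by (simp add: W_def lin_X lin_Y)

lemma W_U: "i \<in> {1..n} \<Longrightarrow> v \<in> U \<Longrightarrow> W i v \<in> U"
  by (simp add: W_def U_X U_Y)

lemma W_Z: "i \<in> {1..n} \<Longrightarrow> j \<in> {1..n} \<Longrightarrow> W j (Z i v) = lam i j *s Z i (W j v)"
  using Y_Z[of j i v] X_Z[of j i v] by (auto simp: W_def lam_def sg_def)

lemma W_W: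
  "\<exists>c. \<forall>i\<in>{1..n}. \<forall>j\<in>{1..n}. c i j \<noteq> 0 \<and> (\<forall>v. W j (W i v) = c i j *s W i (W j v))"
proof -
  have "\<exists>c. c \<noteq> 0 \<and> (\<forall>v. W j (W i v) = c *s W i (W j v))" if ij: "i \<in> {1..n}" "j \<in> {1..n}" for i j
  proof (cases i j rule: linorder_cases)
    case less
    show ?thesis
      by (rule exI[of _ "if \<epsilon> j then (if \<epsilon> i then q else inverse q) else if \<epsilon> i then q else inverse q"])
         (use less ij q_nz XX[of i j] YY[of i j] YX[of i j] XY[of j i] in \<open>auto simp: W_def\<close>)
  next
    case equal
    then show ?thesis by (intro exI[of _ 1]) simp
  next
    case greater
    show ?thesis
      by (rule exI[of _ "if \<epsilon> j then inverse q else q"])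
         (use greater ij q_nz XX'[of j i] YY'[of j i] YX[of i j] XY[of j i] in \<open>auto simp: W_def\<close>)
  qed
  then show ?thesis by metis
qed

lemma Y_W: "i \<in> {1..n} \<Longrightarrow> j \<in> {1..n} \<Longrightarrow> i \<noteq> j \<Longrightarrow>
    Y j (W i v) = (if \<epsilon> i then if i < j then q else inverse q else inverse q) *s W i (Y j v)"
  using YY[of i j v] YY'[of j i v] YX[of i j v] by (auto simp: W_def)

text \<open>The intermediate vector \<open>?u\<close> has left \<open>V\<close> as soon as some w_i
  = x_i has acted, so the dichotomy does not apply to it directly. But \<open>Y (Suc j)\<close>
  passes all earlier w_i up to scalars. If w_{j+1} = y_{j+1}, its power is moved inwards to
  \<open>v\<close>, where it is injective; if w_{j+1} = x_{j+1}, then y_{j+1} kills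
  \<open>v\<close>, hence \<open>?u\<close>, and \<open>X_inj_ker_Y\<close> applies in
  \<open>U\<close>.\<close>

lemma W_mono_inj:
  assumes "j \<le> n" "v \<in> V" "op_mono W j b v = 0"
  shows "v = 0"
  using assms
proof (induction j arbitrary: v)
  case (Suc j)
  let ?j = "Suc j" and ?u = "op_mono W j b v"
  define c where "c i = (if \<epsilon> i then if i < ?j then q else inverse q else inverse q)" for i
  have j: "?j \<in> {1..n}" using Suc.prems by auto
  have "\<exists>r. r \<noteq> 0 \<and> (Y ?j ^^ s) ?u = r *s op_mono W j b ((Y ?j ^^ s) v)" for s
  proof (intro exI conjI)
    show "(Y ?j ^^ s) ?u = (\<Prod>i = 1..j. c i ^ (b i * s)) *s op_mono W j b ((Y ?j ^^ s) v)"
      unfolding c_def using Suc.prems Y_W[OF _ j]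
      by (intro commute_funpow_op_mono[where n = j]) (auto simp: lin_Y lin_W)
    show "(\<Prod>i = 1..j. c i ^ (b i * s)) \<noteq> 0"
      using q_nz by (auto simp: c_def)
  qed
  then obtain r where r: "\<And>s. r s \<noteq> 0"
    and comm: "\<And>s. (Y ?j ^^ s) ?u = r s *s op_mono W j b ((Y ?j ^^ s) v)"
    by metis
  show ?case
  proof (cases "\<epsilon> ?j")
    case True
    let ?v = "(Y ?j ^^ b ?j) v"
    have "?v \<in> V" using Suc.prems V_Y[OF j] by (intro funpow_closed) auto
    moreover have "op_mono W j b ?v = 0"
      using comm[of "b ?j"] r[of "b ?j"] Suc.prems(3) True by (simp add: W_def[of "Suc j"])
    ultimately have "?v = 0" using Suc.IH Suc.prems by auto
    moreover have "w = 0" if "w \<in> V" "(Y ?j ^^ t) w = 0" for t w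
      using that
    proof (induction t)
      case (Suc t)
      then have "Y ?j ((Y ?j ^^ t) w) = 0" "(Y ?j ^^ t) w \<in> V"
        using V_Y[OF j] by (auto intro: funpow_closed)
      with dich[OF j] True Suc show ?case by auto
    qed simp
    ultimately show ?thesis using Suc.prems(2) by blast
  next
    case False
    have "Y ?j v = 0" using dich[OF j] False Suc.prems by auto
    then have "Y ?j ?u = 0"
      using comm[of 1] by (simp add: lin_simps(4)[OF lin_op_mono] lin_W)
    moreover have "?u \<in> U"
      using V Suc.prems(1,2) by (intro op_mono_closed W_U) auto
    ultimately have "?u = 0"
      using X_inj_ker_Y[OF j, of ?u "b ?j"] Suc.prems(3) False by (simp add: W_def[of "Suc j"])
    then show ?thesis using Suc by auto
  qed
qed simp

definition chi :: "(nat \<Rightarrow> nat) \<Rightarrow> (nat \<Rightarrow> nat) \<Rightarrow> 'a"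
  where "chi e b = (\<Prod>i = 1..n. \<Prod>j = 1..n. lam i j ^ (e i * b j))"

lemma chi_nz: "chi e b \<noteq> 0"
  by (simp add: chi_def lam_nz)

lemma W_mono_Z_mono: "op_mono W n b (op_mono Z n e v) = chi e b *s op_mono Z n e (op_mono W n b v)"
  unfolding chi_def by (rule commute_op_mono[where n = n]) (auto simp: W_Z lin_Z lin_W)

lemma Z_mono_inj: "v \<in> U \<Longrightarrow> op_mono Z n e v = 0 \<Longrightarrow> v = 0"
  by (rule op_mono_eq_0_imp[of n U Z n]) (auto intro: U_Z Z_inj)

lemma powi_Q_sum: "Q powi (\<Sum>j\<in>A. f j) = (\<Prod>j\<in>A. Q powi f j)"
  by (induction A rule: infinite_finite_induct) (simp_all add: power_int_add Q_nz)

text \<open>For fixed \<open>b\<close> this is the monomial with exponents \<open>e\<close>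
  evaluated at n powers of Q, the shape to which the several-variable Vandermonde statement
  applies.\<close>

lemma chi_sep_b: "chi e b = (\<Prod>i = 1..n. (Q powi (\<Sum>j = 1..i. sg j * int (b j))) ^ e i)"
proof -
  have "(\<Prod>j = 1..n. lam i j ^ (e i * b j)) = (Q powi (\<Sum>j = 1..i. sg j * int (b j))) ^ e i"
    if "i \<in> {1..n}" for i
  proof -
    have "(\<Prod>j = 1..n. lam i j ^ (e i * b j)) = (\<Prod>j = 1..n. lam i j ^ b j) ^ e i"
      by (simp add: prod_power_distrib power_mult[symmetric] mult.commute)
    also have "(\<Prod>j = 1..n. lam i j ^ b j) = (\<Prod>j = 1..i. Q powi (sg j * int (b j)))"
      using that by (intro prod.mono_neutral_cong_right) (auto simp: lam_def power_int_mult)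
    finally show ?thesis by (simp add: powi_Q_sum)
  qed
  then show ?thesis by (simp add: chi_def)
qed

text \<open>The same with the roles exchanged. Tail sums occur because w_j picks up a factor only
  from the z_i with i \<ge> j.\<close>

lemma chi_sep_e: "chi e b = (\<Prod>j = 1..n. (Q powi (\<Sum>i = j..n. sg j * int (e i))) ^ b j)"
proof -
  have "(\<Prod>i = 1..n. lam i j ^ (e i * b j)) = (Q powi (\<Sum>i = j..n. sg j * int (e i))) ^ b j"
    if "j \<in> {1..n}" for j
  proof -
    have "(\<Prod>i = 1..n. lam i j ^ (e i * b j)) = (\<Prod>i = 1..n. lam i j ^ e i) ^ b j"
      by (simp add: prod_power_distrib power_mult[symmetric])
    also have "(\<Prod>i = 1..n. lam i j ^ e i) = (\<Prod>i = j..n. Q powi (sg j * int (e i)))"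
      using that by (intro prod.mono_neutral_cong_right) (auto simp: lam_def power_int_mult)
    finally show ?thesis by (simp add: powi_Q_sum)
  qed
  then show ?thesis
    unfolding chi_def by (subst prod.swap, intro prod.cong refl) blast
qed

end

text \<open>Extensional functions make the box finite and let agreement on \<open>{1..n}\<close>
  imply equality. This is why computed exponents are wrapped in \<open>restrict\<close>
  below.\<close>

definition exponents :: "nat \<Rightarrow> nat \<Rightarrow> (nat \<Rightarrow> nat) set"
  where "exponents n k = {1..n} \<rightarrow>\<^sub>E {..k}"

lemma finite_exponents: "finite (exponents n k)"
  by (simp add: exponents_def finite_PiE)

lemma card_exponents: "card (exponents n k) = Suc k ^ n"
  by (simp add: exponents_def card_PiE)

section \<open>Independence of the operators z^e w^b and Joseph's counting argument\<close>

context qs_cone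
begin

definition vec :: "(nat \<Rightarrow> nat) \<Rightarrow> (nat \<Rightarrow> nat) \<Rightarrow> 'b \<Rightarrow> 'b"
  where "vec e b v = op_mono W n b (op_mono Z n e v)"

abbreviation box :: "nat \<Rightarrow> (nat \<Rightarrow> nat) set"
  where "box \<equiv> exponents n"

lemma lin_vec: "lin (vec e b)"
  unfolding vec_def
  by (rule linI) (simp_all add: lin_simps[OF lin_op_mono] lin_W lin_Z)

lemma W_mono_add:
  "\<exists>\<kappa>. \<forall>b b'. \<kappa> b b' \<noteq> 0 \<and>
    (\<forall>v. op_mono W n b (op_mono W n b' v) = \<kappa> b b' *s op_mono W n (\<lambda>i. b i + b' i) v)"
proof -
  obtain c where c: "\<forall>i\<in>{1..n}. \<forall>j\<in>{1..n}. c i j \<noteq> 0 \<and> (\<forall>v. W j (W i v) = c i j *s W i (W j v))"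
    using W_W by blast
  have "\<exists>\<kappa>. \<kappa> \<noteq> 0 \<and> (\<forall>v. op_mono W n b (op_mono W n b' v) = \<kappa> *s op_mono W n (\<lambda>i. b i + b' i) v)" for b b'
    by (rule op_mono_add[where c = c and n = n]) (use c lin_W in blast)+
  then show ?thesis by metis
qed

text \<open>The product is rearranged so that \<open>e'\<close> enters only through the scalar
  \<open>chi e' (\<lambda>i. b i + b' i)\<close> and the injective outermost operator
  \<open>op_mono Z n e'\<close>. What remains inside does not depend on \<open>e'\<close>, as the
  Vandermonde argument in \<open>e'\<close> requires.\<close>

lemma vec_vec:
  "\<exists>\<kappa>. \<forall>b b'. \<kappa> b b' \<noteq> 0 \<and> (\<forall>e e' v. vec e b (vec e' b' v) =
    inverse (chi e b') *s \<kappa> b b' *s chi e' (\<lambda>i. b i + b' i) *s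
      op_mono Z n e' (vec e (\<lambda>i. b i + b' i) v))"
proof -
  obtain \<kappa> where \<kappa>: "\<And>b b'. \<kappa> b b' \<noteq> 0"
    "\<And>b b' v. op_mono W n b (op_mono W n b' v) = \<kappa> b b' *s op_mono W n (\<lambda>i. b i + b' i) v"
    using W_mono_add by blast
  have "vec e b (vec e' b' v) =
      inverse (chi e b') *s \<kappa> b b' *s chi e' (\<lambda>i. b i + b' i) *s op_mono Z n e' (vec e (\<lambda>i. b i + b' i) v)"
    for e e' b b' v
  proof -
    have "op_mono Z n e (op_mono W n b' u) = inverse (chi e b') *s op_mono W n b' (op_mono Z n e u)" for u
      by (simp add: W_mono_Z_mono chi_nz)
    then have "vec e b (vec e' b' v) =
        inverse (chi e b') *s \<kappa> b b' *s op_mono W n (\<lambda>i. b i + b' i) (op_mono Z n e (op_mono Z n e' v))"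
      by (simp only: vec_def lin_simps(1)[OF lin_op_mono[OF lin_W]] \<kappa>(2))
    then show ?thesis
      by (simp only: Z_mono_comm[of e e'] W_mono_Z_mono vec_def)
  qed
  with \<kappa>(1) show ?thesis by blast
qed

text \<open>Up to a scalar, monomials multiply by adding exponents, so an operator with exponents at
  most \<open>k\<close> enlarges the box by \<open>k\<close>.\<close>

lemma vec_span:
  assumes "b \<in> box k" "e \<in> box k" "v \<in> span {vec e' b' m | e' b'. e' \<in> box D \<and> b' \<in> box D}"
  shows "vec e b v \<in> span {vec e' b' m | e' b'. e' \<in> box (D + k) \<and> b' \<in> box (D + k)}"
proof (rule lin_in_span_image[OF lin_vec assms(3)])
  fix s assume "s \<in> {vec e' b' m | e' b'. e' \<in> box D \<and> b' \<in> box D}"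
  then obtain e' b' where s: "s = vec e' b' m" "e' \<in> box D" "b' \<in> box D" by auto
  obtain \<kappa> where \<kappa>: "\<And>b b' e e' v. vec e b (vec e' b' v) =
    inverse (chi e b') *s \<kappa> b b' *s chi e' (\<lambda>i. b i + b' i) *s op_mono Z n e' (vec e (\<lambda>i. b i + b' i) v)"
    using vec_vec by blast
  let ?e = "restrict (\<lambda>i. e' i + e i) {1..n}" and ?b = "restrict (\<lambda>i. b i + b' i) {1..n}"
  have "?e \<in> box (D + k)"
    using assms(2) s by (auto simp: exponents_def PiE_iff intro!: add_mono)
  moreover have "?b \<in> box (k + D)"
    using assms(1) s by (auto simp: exponents_def PiE_iff intro!: add_mono)
  ultimately have box: "?e \<in> box (D + k)" "?b \<in> box (D + k)"
    by (simp_all add: add.commute)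
  have "op_mono Z n e' (vec e (\<lambda>i. b i + b' i) m) = inverse (chi e' (\<lambda>i. b i + b' i)) *s vec ?e ?b m"
  proof -
    have "vec ?e ?b m = vec (\<lambda>i. e' i + e i) (\<lambda>i. b i + b' i) m"
      unfolding vec_def by (intro arg_cong2[where f = "op_mono W n"] trans[OF op_mono_cong[of n ?b "\<lambda>i. b i + b' i"]]
        arg_cong[where f = "op_mono W n (\<lambda>i. b i + b' i)"] op_mono_cong) auto
    also have "\<dots> = op_mono W n (\<lambda>i. b i + b' i) (op_mono Z n e' (op_mono Z n e m))"
      by (simp add: vec_def Z_mono_add_eq)
    finally show ?thesis by (simp add: W_mono_Z_mono chi_nz vec_def)
  qed
  with box show "vec e b s \<in> span {vec e' b' m | e' b'. e' \<in> box (D + k) \<and> b' \<in> box (D + k)}"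
    unfolding s(1) \<kappa> by (simp only:) (intro span_scale span_base, blast)
qed

text \<open>Differences of consecutive partial sums recover \<open>b\<close>. Together with
  \<open>powi_Q_inj\<close> this is one half of the nondegeneracy of the pairing.\<close>

lemma inj_sums:
  assumes "\<And>i. i \<in> {1..n} \<Longrightarrow> (\<Sum>j = 1..i. sg j * int (b j)) = (\<Sum>j = 1..i. sg j * int (b' j))" "i \<in> {1..n}"
  shows "b i = b' i"
proof -
  obtain i' where i': "i = Suc i'" using assms(2) by (cases i) auto
  have "(\<Sum>j = 1..i'. sg j * int (b j)) = (\<Sum>j = 1..i'. sg j * int (b' j))"
    using assms i' by (cases "i' = 0") auto
  with assms(1)[OF assms(2)] i' show ?thesis by (simp add: sg_def split: if_splits)
qed

text \<open>The other half: the sign depends on \<open>j\<close> alone and cancels, and differences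
  of consecutive tail sums recover \<open>e\<close>, starting from the empty tail at
  \<open>Suc n\<close>.\<close>

lemma inj_sums':
  assumes "\<And>j. j \<in> {1..n} \<Longrightarrow> (\<Sum>i = j..n. sg j * int (e i)) = (\<Sum>i = j..n. sg j * int (e' i))" "i \<in> {1..n}"
  shows "e i = e' i"
proof -
  have eq: "(\<Sum>i = j..n. int (e i)) = (\<Sum>i = j..n. int (e' i))" if "j \<in> {1..Suc n}" for j
  proof (cases "j = Suc n")
    case False
    with assms(1)[of j] that show ?thesis by (simp add: sg_def sum_negf split: if_splits)
  qed simp
  have "(\<Sum>l = i..n. f l) = f i + (\<Sum>l = Suc i..n. f l)" for f :: "nat \<Rightarrow> int"
    using assms(2) by (simp add: sum.atLeast_Suc_atMost)
  then show ?thesis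
    using eq[of i] eq[of "Suc i"] assms(2) by simp
qed

text \<open>The exponents lie among the 2nk+1 integers between -nk and nk. This is the origin of the
  bound \<open>2 * n * k\<close> on the auxiliary exponents \<open>e'\<close> and
  \<open>b'\<close>.\<close>

lemma card_powi_image:
  assumes "\<And>x. x \<in> B \<Longrightarrow> \<bar>f x\<bar> \<le> int (n * k)"
  shows "card ((\<lambda>x. Q powi f x) ` B) \<le> Suc (2 * n * k)"
proof -
  have "(\<lambda>x. Q powi f x) ` B \<subseteq> (\<lambda>x. Q powi x) ` {- int (n * k)..int (n * k)}"
  proof safe
    fix x assume "x \<in> B"
    with assms[of x] show "Q powi f x \<in> (\<lambda>x. Q powi x) ` {- int (n * k)..int (n * k)}"
      by (intro imageI) (simp add: abs_le_iff)
  qed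
  then have "card ((\<lambda>x. Q powi f x) ` B) \<le> card {- int (n * k)..int (n * k)}"
    by (rule surj_card_le[OF finite_atLeastAtMost_int])
  moreover have "card {- int (n * k)..int (n * k)} = Suc (2 * n * k)"
    by (simp add: mult.assoc del: of_nat_mult)
  ultimately show ?thesis by simp
qed

lemma abs_signed_sum_le:
  assumes "b \<in> box k" "A \<subseteq> {1..n}" "\<And>j. \<bar>s j\<bar> = (1::int)"
  shows "\<bar>\<Sum>j\<in>A. s j * int (b j)\<bar> \<le> int (n * k)"
proof -
  have "\<bar>\<Sum>j\<in>A. s j * int (b j)\<bar> \<le> (\<Sum>j\<in>A. \<bar>s j * int (b j)\<bar>)"
    by (rule sum_abs)
  also have "\<dots> \<le> (\<Sum>j\<in>A. int k)"
    using assms by (intro sum_mono) (auto simp: abs_mult exponents_def PiE_iff)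
  also have "\<dots> \<le> int (n * k)"
    using card_mono[OF _ assms(2)] by (simp add: mult_right_mono)
  finally show ?thesis .
qed

text \<open>Multiplying by $z^{e'}$ separates the different \<open>b\<close>, multiplying by $w_{b'}$ the different \<open>e\<close>.\<close>

lemma vec_operators_independent:
  assumes "\<And>e' b'. e' \<in> box (2 * n * k) \<Longrightarrow> b' \<in> box (2 * n * k) \<Longrightarrow>
      (\<Sum>b\<in>box k. \<Sum>e\<in>box k. c e b *s vec e b (vec e' b' m)) = 0"
    and "e0 \<in> box k" "b0 \<in> box k"
  shows "c e0 b0 = 0"
proof -
  let ?D = "2 * n * k"
  obtain \<kappa> where \<kappa>: "\<And>b b'. \<kappa> b b' \<noteq> 0" "\<And>b b' e e' v. vec e b (vec e' b' v) =
      inverse (chi e b') *s \<kappa> b b' *s chi e' (\<lambda>i. b i + b' i) *s op_mono Z n e' (vec e (\<lambda>i. b i + b' i) v)"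
    using vec_vec by blast
  have chi_add: "chi e (\<lambda>i. b i + b' i) = chi e b' * chi e b" for e b b'
    by (simp add: chi_def distrib_left power_add prod.distrib mult.commute)
  have mU: "op_mono Z n e m \<in> U" "op_mono Z n e m \<in> V" for e
    using V m by (auto intro!: op_mono_closed U_Z V_Z)
  have vecU: "vec e b m \<in> U" for e b
    unfolding vec_def by (intro op_mono_closed[where S = U] W_U mU)
  \<comment> \<open>First Vandermonde argument: \<open>b'\<close> is fixed and \<open>e'\<close>
    varies, which isolates the single index \<open>b0\<close>.\<close>
  have step1: "(\<Sum>e\<in>box k. (inverse (chi e b') * c e b0) *s op_mono Z n e m) = 0"
    if b': "b' \<in> box ?D" for b'
  proof -
    \<comment> \<open>\<open>u b\<close> collects what does not depend on \<open>e'\<close>. The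
      hypothesis becomes z^{e'} applied to a nonzero multiple of \<Sum> \<chi>(e',b)
      \<open>u b\<close>, and z^{e'} can be stripped off because it is injective on
      \<open>U\<close>.\<close>
    define u where "u b = \<kappa> b b' *s op_mono W n (\<lambda>i. b i + b' i)
        (\<Sum>e\<in>box k. (inverse (chi e b') * c e b) *s op_mono Z n e m)" for b
    have u: "u b = (\<Sum>e\<in>box k. (\<kappa> b b' * inverse (chi e b') * c e b) *s vec e (\<lambda>i. b i + b' i) m)" for b
      by (simp add: u_def vec_def lin_simps[OF lin_op_mono[OF lin_W]] scale_sum_right mult.assoc)
    have uU: "u b \<in> U" for b
      unfolding u by (intro subspace_sum[OF U] subspace_scale[OF U] vecU)
    have "u b0 = 0"
    proof (rule multi_power_sums_separate[where n = n and D = ?D and B = "box k" and u = u and ?b0.0 = b0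
          and t = "\<lambda>i b. Q powi (\<Sum>j = 1..i. sg j * int (b j))"])
      show "card ((\<lambda>b. Q powi (\<Sum>j = 1..i. sg j * int (b j))) ` box k) \<le> Suc ?D" if "i \<in> {1..n}" for i
        using that by (intro card_powi_image abs_signed_sum_le) (auto simp: sg_def)
      show "b = b''" if "b \<in> box k" "b'' \<in> box k"
        "\<And>i. i \<in> {1..n} \<Longrightarrow> Q powi (\<Sum>j = 1..i. sg j * int (b j)) = Q powi (\<Sum>j = 1..i. sg j * int (b'' j))"
        for b b''
        using that inj_sums[of b b''] powi_Q_inj unfolding exponents_def
        by (intro PiE_ext[of _ "{1..n}" "\<lambda>_. {..k}"]) blast+
      show "(\<Sum>b\<in>box k. (\<Prod>i = 1..n. (Q powi (\<Sum>j = 1..i. sg j * int (b j))) ^ e i) *s u b) = 0"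
        if e: "\<And>i. i \<in> {1..n} \<Longrightarrow> e i \<le> ?D" for e
      proof -
        let ?e = "restrict e {1..n}"
        have chi_e: "chi ?e b = chi e b" for b
          by (simp add: chi_def)
        have Z_e: "op_mono Z n ?e v = op_mono Z n e v" for v
          by (rule op_mono_cong) simp
        have "0 = (\<Sum>b\<in>box k. \<Sum>e'\<in>box k. c e' b *s vec e' b (vec ?e b' m))"
          using e b' by (subst assms(1)) (auto simp: exponents_def)
        also have "\<dots> = op_mono Z n e (chi e b' *s (\<Sum>b\<in>box k. chi e b *s u b))"
          unfolding \<kappa>(2) chi_e Z_e
          by (simp add: chi_add u lin_simps[OF lin_op_mono[OF lin_Z]] scale_sum_right mult_ac)
        finally have "chi e b' *s (\<Sum>b\<in>box k. chi e b *s u b) = 0"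
          by (rule Z_mono_inj[rotated, OF sym]) (intro subspace_scale[OF U] subspace_sum[OF U] uU)
        then have "(\<Sum>b\<in>box k. chi e b *s u b) = 0"
          by (simp add: chi_nz)
        then show ?thesis by (simp only: chi_sep_b)
      qed
    qed (use finite_exponents assms(3) in auto)
    then have "op_mono W n (\<lambda>i. b0 i + b' i)
        (\<Sum>e\<in>box k. (inverse (chi e b') * c e b0) *s op_mono Z n e m) = 0"
      using \<kappa>(1) by (simp add: u_def)
    \<comment> \<open>The w-monomial acts on a combination of the z^e applied to \<open>m\<close>, a
      vector of \<open>V\<close>, and is injective there.\<close>
    then show ?thesis
      by (rule W_mono_inj[OF order_refl, rotated])
         (intro subspace_sum[OF V(1)] subspace_scale[OF V(1)] mU)
  qed
  \<comment> \<open>Second Vandermonde argument, now with \<open>b'\<close> varying. The scalar left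
    over by \<open>step1\<close> is the inverse of \<open>chi e b'\<close>, hence the minus sign in
    the nodes.\<close>
  have "c e0 b0 *s op_mono Z n e0 m = 0"
  proof (rule multi_power_sums_separate[where n = n and D = ?D and B = "box k"
        and u = "\<lambda>e. c e b0 *s op_mono Z n e m" and ?b0.0 = e0 and t = "\<lambda>j e. Q powi (- (\<Sum>i = j..n. sg j * int (e i)))"])
    show "card ((\<lambda>e. Q powi (- (\<Sum>i = j..n. sg j * int (e i)))) ` box k) \<le> Suc ?D" if "j \<in> {1..n}" for j
      using that by (intro card_powi_image, subst abs_minus_cancel, intro abs_signed_sum_le) (auto simp: sg_def)
    show "e = e'" if ee': "e \<in> box k" "e' \<in> box k"
      and eq: "\<And>j. j \<in> {1..n} \<Longrightarrow> Q powi (- (\<Sum>i = j..n. sg j * int (e i))) = Q powi (- (\<Sum>i = j..n. sg j * int (e' i)))"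
      for e e'
    proof -
      have "(\<Sum>i = j..n. sg j * int (e i)) = (\<Sum>i = j..n. sg j * int (e' i))" if "j \<in> {1..n}" for j
        using powi_Q_inj[OF eq[OF that]] by simp
      with ee' inj_sums'[of e e'] show ?thesis unfolding exponents_def
        by (intro PiE_ext[of _ "{1..n}" "\<lambda>_. {..k}"]) blast+
    qed
    show "(\<Sum>e\<in>box k. (\<Prod>j = 1..n. (Q powi (- (\<Sum>i = j..n. sg j * int (e i)))) ^ b' j) *s c e b0 *s op_mono Z n e m) = 0"
      if b': "\<And>i. i \<in> {1..n} \<Longrightarrow> b' i \<le> ?D" for b'
    proof -
      have "(\<Prod>j = 1..n. (Q powi (- (\<Sum>i = j..n. sg j * int (e i)))) ^ b' j) = inverse (chi e b')" for e
        by (simp add: chi_sep_e power_int_minus power_inverse prod_inversef[symmetric] o_def)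
      moreover have "chi e (restrict b' {1..n}) = chi e b'" for e
        by (simp add: chi_def)
      ultimately show ?thesis
        using step1[of "restrict b' {1..n}"] b' by (simp add: exponents_def)
    qed
  qed (use finite_exponents assms(2) in auto)
  moreover have "op_mono Z n e0 m \<noteq> 0"
    using Z_mono_inj V m by blast
  ultimately show ?thesis by simp
qed

text \<open>
  Joseph's trick: the $(k+1)^{2n}$ independent operators map a space of dimension \<open>card B1\<close> to one
  of dimension \<open>card B2\<close>, so $(k+1)^{2n}$ is at most the product of these dimensions.
\<close>

lemma vec_independent_family:
  "\<exists>I. I \<subseteq> box (2 * n * k + k) \<times> box (2 * n * k + k) \<and> Suc k ^ n \<le> card I \<and>
    (\<forall>c. (\<Sum>(e, b)\<in>I. c (e, b) *s vec e b m) = 0 \<longrightarrow> (\<forall>i\<in>I. c i = 0))"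
proof -
  let ?D = "2 * n * k"
  define F where "F D = {vec e b m | e b. e \<in> box D \<and> b \<in> box D}" for D
  have F: "F D = (\<lambda>(e, b). vec e b m) ` (box D \<times> box D)" for D
    by (auto simp: F_def)
  have finF: "finite (F D)" for D
    using finite_exponents by (simp add: F)
  obtain B1 where B1: "B1 \<subseteq> F ?D" "independent B1" "F ?D \<subseteq> span B1"
    using maximal_independent_subset by blast
  obtain B2 where B2: "B2 \<subseteq> F (?D + k)" "independent B2" "F (?D + k) \<subseteq> span B2"
    using maximal_independent_subset by blast
  have fin: "finite B1" "finite B2"
    using B1(1) B2(1) finF finite_subset by blast+
  have "box ?D \<subseteq> box (?D + k)"
    unfolding exponents_def by (intro PiE_mono) auto
  then have "F ?D \<subseteq> F (?D + k)" by (auto simp: F_def)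
  then have "card B1 \<le> card B2"
    using independent_span_bound[of B2 B1] fin B1 B2 by blast
  have "Suc k ^ n \<le> card B2"
  proof (rule ccontr)
    assume "\<not> Suc k ^ n \<le> card B2"
    \<comment> \<open>There are then fewer matrix entries than operators, so some nontrivial
      combination of the operators has zero matrix with respect to \<open>B1\<close> and
      \<open>B2\<close>, and hence vanishes on the span of \<open>B1\<close>. This contradicts the
      independence of the operators.\<close>
    then have "card (B1 \<times> B2) < card (box k \<times> box k)"
      using \<open>card B1 \<le> card B2\<close> by (simp add: card_cartesian_product card_exponents mult_strict_mono')
    then have "\<exists>c. (\<exists>i\<in>box k \<times> box k. c i \<noteq> 0) \<and> (\<forall>j\<in>B1 \<times> B2.
        (\<Sum>i\<in>box k \<times> box k. c i * representation B2 (vec (fst i) (snd i) (fst j)) (snd j)) = 0)"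
      using fin finite_exponents by (intro homogeneous_system_nontrivial) auto
    then obtain c where c: "\<exists>i\<in>box k \<times> box k. c i \<noteq> 0"
      and eq: "\<And>j. j \<in> B1 \<times> B2 \<Longrightarrow>
        (\<Sum>i\<in>box k \<times> box k. c i * representation B2 (vec (fst i) (snd i) (fst j)) (snd j)) = 0"
      by blast
    have zero: "(\<Sum>b\<in>box k. \<Sum>e\<in>box k. c (e, b) *s vec e b v) = 0" if "v \<in> span B1" for v
      using that
    proof (induction rule: span_induct_alt)
      case base
      show ?case by (simp add: lin_simps[OF lin_vec])
    next
      case (step a x y)
      let ?s = "\<lambda>v. \<Sum>i\<in>box k \<times> box k. c i *s vec (fst i) (snd i) v"
      have s: "?s v = (\<Sum>b\<in>box k. \<Sum>e\<in>box k. c (e, b) *s vec e b v)" for v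
        by (subst sum.swap) (simp add: sum.cartesian_product case_prod_unfold)
      have span: "vec e b x \<in> span B2" if "e \<in> box k" "b \<in> box k" for e b
      proof -
        have "x \<in> span (F ?D)" using step(1) B1(1) by (auto intro: span_base)
        then have "vec e b x \<in> span (F (?D + k))"
          using vec_span[OF that(2,1), of x ?D] by (simp add: F_def)
        then show ?thesis using B2(3) by (metis span_mono span_span subsetD)
      qed
      have "representation B2 (?s x) \<beta> = 0" for \<beta>
      proof (cases "\<beta> \<in> B2")
        case True
        have "representation B2 (?s x) \<beta> = (\<Sum>i\<in>box k \<times> box k. c i * representation B2 (vec (fst i) (snd i) x) \<beta>)"
          using span by (subst representation_sum[OF B2(2)])
            (auto intro!: span_scale sum.cong simp: representation_scale[OF B2(2)])
        with eq[of "(x, \<beta>)"] step(1) True show ?thesis by simp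
      next
        case False
        then show ?thesis using representation_ne_zero by blast
      qed
      moreover have "?s x \<in> span B2"
        using span by (auto intro!: span_sum span_scale)
      ultimately have "?s x = 0"
        using sum_nonzero_representation_eq[OF B2(2), of "?s x"] by simp
      have "(\<Sum>b\<in>box k. \<Sum>e\<in>box k. c (e, b) *s vec e b (a *s x + y)) =
          a *s (\<Sum>b\<in>box k. \<Sum>e\<in>box k. c (e, b) *s vec e b x) + (\<Sum>b\<in>box k. \<Sum>e\<in>box k. c (e, b) *s vec e b y)"
        by (simp add: lin_simps[OF lin_vec] scale_right_distrib sum.distrib scale_sum_right mult.commute)
      with \<open>?s x = 0\<close> step(2) show ?case by (simp add: s)
    qed
    have "c (e0, b0) = 0" if "e0 \<in> box k" "b0 \<in> box k" for e0 b0
    proof (rule vec_operators_independent[where c = "\<lambda>e b. c (e, b)" and k = k])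
      show "(\<Sum>b\<in>box k. \<Sum>e\<in>box k. c (e, b) *s vec e b (vec e' b' m)) = 0"
        if "e' \<in> box ?D" "b' \<in> box ?D" for e' b'
        using that B1(3) by (intro zero) (auto simp: F_def)
    qed (use that in auto)
    with c show False by auto
  qed
  \<comment> \<open>The basis is pulled back to pairs of exponents: an independent family of
    monomials, unlike a set of vectors, can be carried from the quotient back to the module.\<close>
  moreover obtain I where I: "I \<subseteq> box (?D + k) \<times> box (?D + k)" "inj_on (\<lambda>(e, b). vec e b m) I"
    "B2 = (\<lambda>(e, b). vec e b m) ` I"
    using B2(1) unfolding F subset_image_inj by blast
  moreover have "\<forall>i\<in>I. c i = 0" if "(\<Sum>(e, b)\<in>I. c (e, b) *s vec e b m) = 0" for c
  proof -
    let ?g = "\<lambda>(e, b). vec e b m"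
    have "(\<Sum>v\<in>B2. c (the_inv_into I ?g v) *s v) = (\<Sum>i\<in>I. c i *s ?g i)"
      unfolding I(3) sum.reindex[OF I(2)] using I(2) by (intro sum.cong) (auto simp: the_inv_into_f_f)
    also have "\<dots> = 0" using that by (simp add: case_prod_unfold)
    finally have "c (the_inv_into I ?g v) = 0" if "v \<in> B2" for v
      using independentD[OF B2(2) fin(2) subset_refl, of "\<lambda>v. c (the_inv_into I ?g v)"] that by simp
    then show ?thesis
      using I(2,3) by (metis (no_types, lifting) imageI the_inv_into_f_f)
  qed
  ultimately show ?thesis
    by (intro exI[of _ I]) (auto simp: card_image)
qed

end

section \<open>Compressing operators to a quotient and removing torsion\<close>

context operator_space
begin

text \<open>Since \<psi> moves vectors only by elements of the stable subspace \<open>T\<close>, an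
  inner \<psi> is absorbed by an outer one, and relations valid modulo \<open>T\<close> become
  equations for the compressed operators. Used for right ideals of the free algebra and again for
  the torsion subspace.\<close>

lemma quotient_ops:
  fixes X Y :: "nat \<Rightarrow> 'v \<Rightarrow> 'v" and q :: 'k and n :: nat
  assumes T: "subspace T" "\<And>i v. i \<in> {1..n} \<Longrightarrow> v \<in> T \<Longrightarrow> X i v \<in> T" "\<And>i v. i \<in> {1..n} \<Longrightarrow> v \<in> T \<Longrightarrow> Y i v \<in> T"
    and lin: "\<And>i. lin (X i)" "\<And>i. lin (Y i)"
    and q: "q \<noteq> 0" "\<And>k. k > 0 \<Longrightarrow> q ^ k \<noteq> 1"
    and XX: "\<And>i j v. 1 \<le> i \<Longrightarrow> i < j \<Longrightarrow> j \<le> n \<Longrightarrow> X j (X i v) - inverse q *s X i (X j v) \<in> T"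
    and YY: "\<And>i j v. 1 \<le> i \<Longrightarrow> i < j \<Longrightarrow> j \<le> n \<Longrightarrow> Y j (Y i v) - q *s Y i (Y j v) \<in> T"
    and YX: "\<And>i j v. i \<in> {1..n} \<Longrightarrow> j \<in> {1..n} \<Longrightarrow> i \<noteq> j \<Longrightarrow> Y j (X i v) - inverse q *s X i (Y j v) \<in> T"
    and YXi: "\<And>i v. i \<in> {1..n} \<Longrightarrow> Y i (X i v) - inverse (q ^ 2) *s X i (Y i v) -
      (\<Sum>l = 1..<i. (inverse (q ^ 2) - 1) *s X l (Y l v)) \<in> T"
  obtains \<psi> where "lin \<psi>" "\<And>v. \<psi> v = 0 \<longleftrightarrow> v \<in> T"
    "\<And>i v. i \<in> {1..n} \<Longrightarrow> \<psi> (X i (\<psi> v)) = \<psi> (X i v)"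
    "\<And>i v. i \<in> {1..n} \<Longrightarrow> \<psi> (Y i (\<psi> v)) = \<psi> (Y i v)"
    "qs_ops scale n q (\<lambda>i v. \<psi> (X i v)) (\<lambda>i v. \<psi> (Y i v))"
proof -
  obtain \<psi> where \<psi>: "lin \<psi>" "\<And>v. \<psi> v = 0 \<longleftrightarrow> v \<in> T" "\<And>v. \<psi> v - v \<in> T"
    using subspace_projection[OF T(1)] by blast
  note s = lin_simps[OF \<psi>(1)]
  have eq: "\<psi> u = \<psi> v" if "u - v \<in> T" for u v
    using \<psi>(2)[of "u - v"] that by (simp add: s)
  have X: "\<psi> (X i (\<psi> v)) = \<psi> (X i v)" and Y: "\<psi> (Y i (\<psi> v)) = \<psi> (Y i v)" if "i \<in> {1..n}" for i v
    using T(2,3)[OF that \<psi>(3)[of v]]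
    by (simp_all add: eq lin_simps[OF lin(1)] lin_simps[OF lin(2)])
  have "qs_ops scale n q (\<lambda>i v. \<psi> (X i v)) (\<lambda>i v. \<psi> (Y i v))"
  proof (intro qs_ops.intro qs_ops_axioms.intro operator_space_axioms)
    show "lin (\<lambda>v. \<psi> (X i v))" "lin (\<lambda>v. \<psi> (Y i v))" for i
      by (auto intro!: linI simp: s lin_simps[OF lin(1)] lin_simps[OF lin(2)])
    show "\<psi> (X j (\<psi> (X i v))) = inverse q *s \<psi> (X i (\<psi> (X j v)))" if "1 \<le> i" "i < j" "j \<le> n" for i j v
      using eq[OF XX[OF that]] that by (simp add: X s)
    show "\<psi> (Y j (\<psi> (Y i v))) = q *s \<psi> (Y i (\<psi> (Y j v)))" if "1 \<le> i" "i < j" "j \<le> n" for i j v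
      using eq[OF YY[OF that]] that by (simp add: Y s)
    show "\<psi> (Y j (\<psi> (X i v))) = inverse q *s \<psi> (X i (\<psi> (Y j v)))"
      if "i \<in> {1..n}" "j \<in> {1..n}" "i \<noteq> j" for i j v
      using eq[OF YX[OF that]] that by (simp add: X Y s)
    show "\<psi> (Y i (\<psi> (X i v))) = inverse (q ^ 2) *s \<psi> (X i (\<psi> (Y i v))) +
        (\<Sum>l = 1..<i. (inverse (q ^ 2) - 1) *s \<psi> (X l (\<psi> (Y l v))))" if "i \<in> {1..n}" for i v
      using eq[of "Y i (X i v)" "inverse (q ^ 2) *s X i (Y i v) + (\<Sum>l = 1..<i. (inverse (q ^ 2) - 1) *s X l (Y l v))"]
        YXi[OF that, of v] that by (simp add: X Y s diff_diff_add)
  qed (use q in auto)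
  with \<psi>(1,2) X Y show thesis by (rule that)
qed

lemma op_mono_intertwine:
  assumes "\<And>i v. i \<in> {1..n} \<Longrightarrow> \<psi> (A i v) = B i (\<psi> v)" "j \<le> n"
  shows "\<psi> (op_mono A j e v) = op_mono B j e (\<psi> v)"
proof -
  have pow: "\<psi> ((A i ^^ t) v) = (B i ^^ t) (\<psi> v)" if "i \<in> {1..n}" for i t v
    using assms(1) that by (induction t) auto
  from assms(2) show ?thesis
    by (induction j) (simp_all add: pow)
qed

end

context qs_ops
begin

text \<open>Here \<open>w\<close> is the vector \<open>m\<close> of \<^locale>\<open>qs_cone\<close>, found in the quotient by the torsion subspace.\<close>

theorem torsion_free_growth:
  assumes v0: "\<And>e. op_mono Z n e v0 \<noteq> 0" "v0 \<in> S"
    and S: "subspace S" "\<And>i v. i \<in> {1..n} \<Longrightarrow> v \<in> S \<Longrightarrow> X i v \<in> S" "\<And>i v. i \<in> {1..n} \<Longrightarrow> v \<in> S \<Longrightarrow> Y i v \<in> S"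
  obtains \<epsilon> w
  where "w \<in> S" and "\<And>k. \<exists>I. I \<subseteq> exponents n (2 * n * k + k) \<times> exponents n (2 * n * k + k) \<and> Suc k ^ n \<le> card I \<and>
      (\<forall>c. (\<Sum>(e, b)\<in>I. c (e, b) *s
          op_mono (\<lambda>i. if \<epsilon> i then Y i else X i) n b (op_mono Z n e w)) = 0 \<longrightarrow> (\<forall>i\<in>I. c i = 0))"
    and "\<And>k c. (\<And>v. v \<in> S \<Longrightarrow> (\<Sum>b\<in>exponents n k. \<Sum>e\<in>exponents n k. c e b *s
          op_mono (\<lambda>i. if \<epsilon> i then Y i else X i) n b (op_mono Z n e v)) = 0) \<Longrightarrow>
      \<forall>e\<in>exponents n k. \<forall>b\<in>exponents n k. c e b = 0"
proof -
  \<comment> \<open>The torsion vectors. They are closed under addition because the z-monomials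
    commute, so the product of two annihilating monomials kills both summands.\<close>
  define T where "T = {v. \<exists>e. op_mono Z n e v = 0}"
  note sZ = lin_simps[OF lin_op_mono[OF lin_Z]]
  have T: "subspace T"
  proof (rule subspaceI)
    show "0 \<in> T" by (auto simp: T_def sZ)
    show "u + v \<in> T" if "u \<in> T" "v \<in> T" for u v
    proof -
      from that obtain e e' where "op_mono Z n e u = 0" "op_mono Z n e' v = 0"
        by (auto simp: T_def)
      then have "op_mono Z n e (op_mono Z n e' (u + v)) = 0"
        by (simp add: sZ Z_mono_comm[of e e' u])
      then show ?thesis by (auto simp: T_def Z_mono_add_eq)
    qed
  qed (auto simp: T_def sZ)
  have commT: "f v \<in> T" if "v \<in> T" "lin f" "\<And>i u. i \<in> {1..n} \<Longrightarrow> f (Z i u) = c i *s Z i (f u)"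
    "\<And>i. c i \<noteq> 0" for f v c
  proof -
    from \<open>v \<in> T\<close> obtain e where e: "op_mono Z n e v = 0" by (auto simp: T_def)
    have "(\<Prod>i = 1..n. c i ^ e i) *s op_mono Z n e (f v) = 0"
      using commute_funpow_op_mono[of n f Z c n 1 e v] that(2,3) lin_Z e lin_simps(4)[OF that(2)] by simp
    moreover have "(\<Prod>i = 1..n. c i ^ e i) \<noteq> 0" using that(4) by simp
    ultimately show ?thesis unfolding T_def by (metis (mono_tags, lifting) mem_Collect_eq scale_eq_0_iff)
  qed
  have TX: "X i v \<in> T" if "i \<in> {1..n}" "v \<in> T" for i v
    by (rule commT[OF that(2) lin_X, where c = "\<lambda>j. if i \<le> j then inverse Q else 1"])
       (use that X_Z[of i] Q_nz in auto)
  have TY: "Y i v \<in> T" if "i \<in> {1..n}" "v \<in> T" for i v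
    by (rule commT[OF that(2) lin_Y, where c = "\<lambda>j. if i \<le> j then Q else 1"])
       (use that Y_Z[of i] Q_nz in auto)
  \<comment> \<open>The quotient has no torsion left: a monomial killing \<open>Z i v\<close>,
    multiplied by z_i, kills \<open>v\<close>.\<close>
  have TZ: "v \<in> T" if "i \<in> {1..n}" "Z i v \<in> T" for i v
  proof -
    have unit: "op_mono Z n (\<lambda>l. if l = i then 1 else 0) v = Z i v"
      using that(1) by (simp add: op_mono_unit)
    from that(2) obtain e where "op_mono Z n e (op_mono Z n (\<lambda>l. if l = i then 1 else 0) v) = 0"
      unfolding unit by (auto simp: T_def)
    then show ?thesis
      unfolding Z_mono_add_eq by (auto simp: T_def)
  qed
  have zero: "u - v \<in> T" if "u = v" for u v
    using that subspace_0[OF T] by simp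
  have zero': "u - v - v' \<in> T" if "u = v + v'" for u v v'
    using that subspace_0[OF T] by simp
  obtain \<psi> where \<psi>: "lin \<psi>" "\<And>v. \<psi> v = 0 \<longleftrightarrow> v \<in> T"
    and \<psi>_X: "\<And>i v. i \<in> {1..n} \<Longrightarrow> \<psi> (X i (\<psi> v)) = \<psi> (X i v)"
    and \<psi>_Y: "\<And>i v. i \<in> {1..n} \<Longrightarrow> \<psi> (Y i (\<psi> v)) = \<psi> (Y i v)"
    and ops: "qs_ops scale n q (\<lambda>i v. \<psi> (X i v)) (\<lambda>i v. \<psi> (Y i v))"
    by (rule quotient_ops[where T = T and n = n and X = X and Y = Y and q = q, OF T TX TY lin_X lin_Y q_nz q_nonroot zero[OF XX] zero[OF YY] zero[OF YX] zero'[OF YXi]])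
      (assumption | rule that)+
  note s\<psi> = lin_simps[OF \<psi>(1)]
  interpret A: qs_ops scale n q "\<lambda>i v. \<psi> (X i v)" "\<lambda>i v. \<psi> (Y i v)" by (fact ops)
  have \<psi>_Z: "A.Z i (\<psi> v) = \<psi> (Z i v)" if "i \<le> n" for i v
    using that by (auto simp: A.Z_def Z_def A.Q_def Q_def s\<psi> \<psi>_X \<psi>_Y intro!: sum.cong)
  interpret A: qs_regular scale n q "\<lambda>i v. \<psi> (X i v)" "\<lambda>i v. \<psi> (Y i v)" "\<psi> ` S"
  proof unfold_locales
    show "subspace (\<psi> ` S)"
      using \<psi>(1) S(1) by (intro module_hom.subspace_image) (simp_all add: module_hom_iff_linear)
    show "v = 0" if "i \<in> {1..n}" "v \<in> \<psi> ` S" "A.Z i v = 0" for i v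
      using that TZ[of i] by (auto simp: \<psi>_Z \<psi>(2))
  qed (use S(2,3) \<psi>_X \<psi>_Y in auto)
  have "\<psi> v0 \<noteq> 0"
    using v0(1) \<psi>(2) by (auto simp: T_def)
  then obtain \<epsilon> V m where cone: "subspace V \<and> V \<subseteq> \<psi> ` S \<and> m \<in> V \<and> m \<noteq> 0 \<and>
      (\<forall>v\<in>V. \<forall>i\<in>{1..n}. \<psi> (Y i v) \<in> V \<and> A.Z i v \<in> V) \<and>
      (\<forall>i\<in>{1..n}. if \<epsilon> i then \<forall>v\<in>V. \<psi> (Y i v) = 0 \<longrightarrow> v = 0 else \<forall>v\<in>V. \<psi> (Y i v) = 0)"
    using A.exists_Y_cone[of "\<psi> v0" n] v0(2) by blast
  interpret C: qs_cone scale n q "\<lambda>i v. \<psi> (X i v)" "\<lambda>i v. \<psi> (Y i v)" "\<psi> ` S" \<epsilon> V m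
    by unfold_locales (use cone in blast)+
  obtain w where w: "m = \<psi> w" "w \<in> S" using cone by blast
  let ?W = "\<lambda>i. if \<epsilon> i then Y i else X i"
  have vec: "C.vec e b (\<psi> v) = \<psi> (op_mono ?W n b (op_mono Z n e v))" for e b v
  proof -
    have "\<psi> (op_mono Z n e v) = op_mono A.Z n e (\<psi> v)" for v
      by (rule op_mono_intertwine[where n = n]) (simp_all add: \<psi>_Z)
    moreover have "\<psi> (op_mono ?W n b v) = op_mono C.W n b (\<psi> v)" for v
      by (rule op_mono_intertwine[where n = n]) (simp_all add: C.W_def \<psi>_X \<psi>_Y)
    ultimately show ?thesis by (simp add: C.vec_def)
  qed
  show thesis
  proof (rule that[of w \<epsilon>])
    show "w \<in> S" by fact
  next
    fix k
    obtain I where I: "I \<subseteq> exponents n (2 * n * k + k) \<times> exponents n (2 * n * k + k)" "Suc k ^ n \<le> card I"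
      "\<And>c. (\<Sum>(e, b)\<in>I. c (e, b) *s C.vec e b m) = 0 \<Longrightarrow> \<forall>i\<in>I. c i = 0"
      using C.vec_independent_family[of k] by blast
    have "\<forall>i\<in>I. c i = 0"
      if "(\<Sum>(e, b)\<in>I. c (e, b) *s op_mono ?W n b (op_mono Z n e w)) = 0" for c
      using arg_cong[OF that, of \<psi>] by (intro I(3)) (simp add: s\<psi> w(1) vec case_prod_unfold)
    with I(1,2) show "\<exists>I. I \<subseteq> exponents n (2 * n * k + k) \<times> exponents n (2 * n * k + k) \<and> Suc k ^ n \<le> card I \<and>
      (\<forall>c. (\<Sum>(e, b)\<in>I. c (e, b) *s op_mono ?W n b (op_mono Z n e w)) = 0 \<longrightarrow> (\<forall>i\<in>I. c i = 0))"
      by blast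
  next
    fix k c
    assume *: "\<And>v. v \<in> S \<Longrightarrow> (\<Sum>b\<in>exponents n k. \<Sum>e\<in>exponents n k. c e b *s op_mono ?W n b (op_mono Z n e v)) = 0"
    \<comment> \<open>A relation between operators that holds on all of \<open>S\<close> holds in
      particular at every monomial image of \<open>w\<close>, which is what the independence
      statement in the quotient consumes.\<close>
    have "Z i v \<in> S" if "i \<in> {1..n}" "v \<in> S" for i v
      unfolding Z_def using that by (intro subspace_sum[OF S(1)] subspace_scale[OF S(1)] S(2,3)) auto
    then have "op_mono ?W n b' (op_mono Z n e' w) \<in> S" for e' b'
      using w(2) S(2,3) by (intro op_mono_closed[where S = S]) auto
    then have "(\<Sum>b\<in>exponents n k. \<Sum>e\<in>exponents n k. c e b *s C.vec e b (C.vec e' b' m)) = 0" for e' b'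
      using arg_cong[OF *[of "op_mono ?W n b' (op_mono Z n e' w)"], of \<psi>] by (simp add: s\<psi> w(1) vec)
    then show "\<forall>e\<in>exponents n k. \<forall>b\<in>exponents n k. c e b = 0"
      using C.vec_operators_independent[of k c] by blast
  qed
qed

section \<open>Ordered monomials span, with control of the degree\<close>

primrec pbw :: "nat \<Rightarrow> (nat \<Rightarrow> nat) \<Rightarrow> (nat \<Rightarrow> nat) \<Rightarrow> 'v \<Rightarrow> 'v"
  where
    "pbw 0 a b v = v"
  | "pbw (Suc j) a b v = (X (Suc j) ^^ b (Suc j)) ((Y (Suc j) ^^ a (Suc j)) (pbw j a b v))"

lemma pbw_cong:
  "(\<And>i. i \<in> {1..j} \<Longrightarrow> a i = a' i \<and> b i = b' i) \<Longrightarrow> pbw j a b v = pbw j a' b' v"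
  by (induction j) auto

definition pbw_span :: "nat \<Rightarrow> nat \<Rightarrow> 'v \<Rightarrow> 'v set"
  where "pbw_span j L v = span {pbw j a b v | a b. (\<Sum>i = 1..j. a i + b i) \<le> L}"

lemma pbw_span_step:
  assumes "u \<in> pbw_span j L v" "L + s + t \<le> L'"
  shows "(X (Suc j) ^^ t) ((Y (Suc j) ^^ s) u) \<in> pbw_span (Suc j) L' v"
  unfolding pbw_span_def
proof (rule lin_in_span_image[of "\<lambda>u. (X (Suc j) ^^ t) ((Y (Suc j) ^^ s) u)", OF _ assms(1)[unfolded pbw_span_def]])
  show "lin (\<lambda>u. (X (Suc j) ^^ t) ((Y (Suc j) ^^ s) u))"
    by (intro linI) (simp_all add: lin_simps[OF lin_funpow[OF lin_X]] lin_simps[OF lin_funpow[OF lin_Y]])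
  fix u assume "u \<in> {pbw j a b v |a b. (\<Sum>i = 1..j. a i + b i) \<le> L}"
  then obtain a b where ab: "u = pbw j a b v" "(\<Sum>i = 1..j. a i + b i) \<le> L" by auto
  let ?a = "a(Suc j := s)" and ?b = "b(Suc j := t)"
  have "(X (Suc j) ^^ t) ((Y (Suc j) ^^ s) u) = pbw (Suc j) ?a ?b v"
    using pbw_cong[of j a ?a b ?b] by (simp add: ab)
  moreover have "(\<Sum>i = 1..Suc j. ?a i + ?b i) \<le> L'"
  proof -
    have "(\<Sum>i = 1..j. ?a i + ?b i) = (\<Sum>i = 1..j. a i + b i)"
      by (intro sum.cong) auto
    with ab(2) assms(2) show ?thesis by simp
  qed
  ultimately show "(X (Suc j) ^^ t) ((Y (Suc j) ^^ s) u) \<in> span {pbw (Suc j) a b v |a b. (\<Sum>i = 1..Suc j. a i + b i) \<le> L'}"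
    by (intro span_base) blast
qed

lemma pbw_span_mono: "L \<le> L' \<Longrightarrow> pbw_span j L v \<subseteq> pbw_span j L' v"
  unfolding pbw_span_def by (intro span_mono) (blast intro: order_trans)

lemma Z_pbw_span:
  assumes "\<And>u L i. u \<in> pbw_span j L v \<Longrightarrow> i \<in> {1..j} \<Longrightarrow> X i u \<in> pbw_span j (Suc L) v \<and> Y i u \<in> pbw_span j (Suc L) v"
    and "u \<in> pbw_span j L v"
  shows "Z j u \<in> pbw_span j (Suc (Suc L)) v"
proof -
  have "X i (Y i u) \<in> pbw_span j (Suc (Suc L)) v" if "i \<in> {1..j}" for i
    using assms that by blast
  then show ?thesis
    unfolding Z_def pbw_span_def by (intro span_sum span_scale)
qed

lemma quasi_commute_funpow2:
  assumes "\<And>v. f (A v) = c *s A (f v)" "\<And>v. f (B v) = d *s B (f v)" "lin A" "lin B"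
  shows "f ((A ^^ t) ((B ^^ s) u)) = (c ^ t * d ^ s) *s (A ^^ t) ((B ^^ s) (f u))"
  using commute_funpow_right[of f A c, OF assms(1,3)] commute_funpow_right[of f B d, OF assms(2,4)]
  by (simp add: lin_simps[OF lin_funpow[OF assms(3)]])

text \<open>A letter of lower index passes the powers of x_j and y_j up to scalars and is absorbed
  by the inner monomial. The letter y_j itself, passing x_j^t, creates z_{j-1}, which involves only
  lower indices: it adds two to the inner degree while one x_j is lost, so the total grows by one
  only. The induction must therefore cover all \<open>u\<close> and \<open>L\<close>.\<close>

lemma pbw_span_closed:
  assumes "j \<le> n" "u \<in> pbw_span j L v" "i \<in> {1..j}"
  shows "X i u \<in> pbw_span j (Suc L) v \<and> Y i u \<in> pbw_span j (Suc L) v"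
  using assms
proof (induction j arbitrary: u L i)
  case 0
  then show ?case by simp
next
  case (Suc j)
  let ?j = "Suc j"
  have gen: "X i (pbw ?j a b v) \<in> pbw_span ?j (Suc L) v \<and> Y i (pbw ?j a b v) \<in> pbw_span ?j (Suc L) v"
    if "(\<Sum>i = 1..?j. a i + b i) \<le> L" for a b
  proof -
    define L1 s t w where "L1 = (\<Sum>i = 1..j. a i + b i)" and "s = a ?j" and "t = b ?j" and "w = pbw j a b v"
    have L: "L1 + s + t \<le> L" using that by (simp add: L1_def s_def t_def)
    have w: "w \<in> pbw_span j L1 v"
      unfolding pbw_span_def w_def L1_def by (intro span_base) auto
    have pbw: "pbw ?j a b v = (X ?j ^^ t) ((Y ?j ^^ s) w)"
      by (simp add: s_def t_def w_def)
    have j: "?j \<in> {1..n}" using Suc.prems by simp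
    show ?thesis
    proof (cases "i = ?j")
      case True
      have "X i (pbw ?j a b v) = (X ?j ^^ Suc t) ((Y ?j ^^ s) w)"
        by (simp only: pbw True funpow.simps o_apply)
      also have "\<dots> \<in> pbw_span ?j (Suc L) v"
        using L by (intro pbw_span_step[OF w]) simp
      finally have X: "X i (pbw ?j a b v) \<in> pbw_span ?j (Suc L) v" .
      have "Z j ((Y ?j ^^ s) w) = (Y ?j ^^ s) (Z j w)"
        using commute_funpow_right[of "Z j" "Y ?j" 1 s w] Y_Z[of ?j j] lin_Y Suc.prems by simp
      then have "Y i (pbw ?j a b v) = Q ^ t *s (X ?j ^^ t) ((Y ?j ^^ Suc s) w) +
          (\<Sum>s<t. Q ^ s) *s (X ?j ^^ (t - 1)) ((Y ?j ^^ s) (Z j w))"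
        using Y_X_pow[OF j, of t "(Y ?j ^^ s) w"] unfolding pbw True by simp
      moreover have "(X ?j ^^ t) ((Y ?j ^^ Suc s) w) \<in> pbw_span ?j (Suc L) v"
        using L by (intro pbw_span_step[OF w]) simp
      moreover have "(\<Sum>s<t. Q ^ s) *s (X ?j ^^ (t - 1)) ((Y ?j ^^ s) (Z j w)) \<in> pbw_span ?j (Suc L) v"
      proof (cases t)
        case 0
        then show ?thesis by (simp add: pbw_span_def span_zero)
      next
        case (Suc t')
        have "Z j w \<in> pbw_span j (Suc (Suc L1)) v"
          using Suc.IH Suc.prems(1) by (intro Z_pbw_span w) auto
        then have "(X ?j ^^ (t - 1)) ((Y ?j ^^ s) (Z j w)) \<in> pbw_span ?j (Suc L) v"
          using L Suc by (intro pbw_span_step) auto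
        then show ?thesis by (simp add: pbw_span_def span_scale)
      qed
      ultimately show ?thesis
        using X by (auto simp: pbw_span_def intro!: span_add span_scale)
    next
      case False
      then have i: "i \<in> {1..j}" using Suc.prems(3) by auto
      then have ij: "1 \<le> i" "i < ?j" "?j \<le> n" "i \<in> {1..n}" using Suc.prems by auto
      have IH: "X i w \<in> pbw_span j (Suc L1) v" "Y i w \<in> pbw_span j (Suc L1) v"
        using Suc.IH[OF _ w i] Suc.prems by auto
      have "X i (pbw ?j a b v) = (q ^ t * q ^ s) *s (X ?j ^^ t) ((Y ?j ^^ s) (X i w))"
        unfolding pbw by (rule quasi_commute_funpow2[OF XX'[OF ij(1-3)] XY[OF ij(4) j] lin_X lin_Y]) (use False in simp)
      moreover have "Y i (pbw ?j a b v) = (inverse q ^ t * inverse q ^ s) *s (X ?j ^^ t) ((Y ?j ^^ s) (Y i w))"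
        unfolding pbw by (rule quasi_commute_funpow2[OF YX[OF j ij(4)] YY'[OF ij(1-3)] lin_X lin_Y]) (use False in simp)
      moreover have "(X ?j ^^ t) ((Y ?j ^^ s) u) \<in> pbw_span ?j (Suc L) v" if "u \<in> pbw_span j (Suc L1) v" for u
        using L by (intro pbw_span_step[OF that]) simp
      ultimately show ?thesis
        using IH by (auto simp: pbw_span_def intro!: span_scale)
    qed
  qed
  show ?case
    unfolding pbw_span_def
    by (intro conjI lin_in_span_image[OF lin_X Suc.prems(2)[unfolded pbw_span_def]]
        lin_in_span_image[OF lin_Y Suc.prems(2)[unfolded pbw_span_def]])
       (use gen in \<open>auto simp: pbw_span_def\<close>)
qed

text \<open>Replacing the bound on total degree by a box overcounts, but leaves the order of growth
  2n unchanged.\<close>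

lemma pbw_span_exponents:
  "pbw_span n L v \<subseteq> span ((\<lambda>(a, b). pbw n a b v) ` (exponents n L \<times> exponents n L))"
  unfolding pbw_span_def
proof (rule span_mono, safe)
  fix a b :: "nat \<Rightarrow> nat" assume le: "(\<Sum>i = 1..n. a i + b i) \<le> L"
  have "a i \<le> L" "b i \<le> L" if "i \<in> {1..n}" for i
    using member_le_sum[of i "{1..n}" "\<lambda>i. a i + b i"] that le by simp_all
  then have "restrict a {1..n} \<in> exponents n L" "restrict b {1..n} \<in> exponents n L"
    by (auto simp: exponents_def)
  moreover have "pbw n a b v = pbw n (restrict a {1..n}) (restrict b {1..n}) v"
    by (rule pbw_cong) simp
  ultimately show "pbw n a b v \<in> (\<lambda>(a, b). pbw n a b v) ` (exponents n L \<times> exponents n L)"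
    by force
qed

end

section \<open>Spans and dimensions in an abelian group with scalar multiplication\<close>

locale lin_space = abelian_group G
  for G :: "('v, 'z) ring_scheme" (structure) +
  fixes sc :: "'k::field \<Rightarrow> 'v \<Rightarrow> 'v"
  assumes sc_closed [simp, intro]: "x \<in> carrier G \<Longrightarrow> sc c x \<in> carrier G"
    and sc_add: "x \<in> carrier G \<Longrightarrow> y \<in> carrier G \<Longrightarrow> sc c (x \<oplus> y) = sc c x \<oplus> sc c y"
    and add_sc: "x \<in> carrier G \<Longrightarrow> sc (c + d) x = sc c x \<oplus> sc d x"
    and sc_sc: "x \<in> carrier G \<Longrightarrow> sc c (sc d x) = sc (c * d) x"
    and sc_one: "x \<in> carrier G \<Longrightarrow> sc 1 x = x"
begin

lemma sc_0_left [simp]: "x \<in> carrier G \<Longrightarrow> sc 0 x = \<zero>"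
  using add_sc[of x 0 0] by (simp add: add.l_cancel_one)

lemma sc_0_right [simp]: "sc c \<zero> = \<zero>"
  using sc_add[of \<zero> \<zero> c] by (simp add: add.l_cancel_one)

text \<open>Combinations of indexed families, so that vectors belonging to different exponents may
  coincide. Spans and independence of sets are the case of the identity family.\<close>

definition comb :: "'i set \<Rightarrow> ('i \<Rightarrow> 'k) \<Rightarrow> ('i \<Rightarrow> 'v) \<Rightarrow> 'v"
  where "comb A c v = (\<Oplus>i\<in>A. sc (c i) (v i))"

lemma comb_closed: "v \<in> A \<rightarrow> carrier G \<Longrightarrow> comb A c v \<in> carrier G"
  unfolding comb_def by (rule finsum_closed) auto

lemma comb_empty: "comb {} c v = \<zero>"
  by (simp add: comb_def)

lemma comb_insert:
  "finite A \<Longrightarrow> i \<notin> A \<Longrightarrow> v \<in> insert i A \<rightarrow> carrier G \<Longrightarrow> comb (insert i A) c v = sc (c i) (v i) \<oplus> comb A c v"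
  unfolding comb_def by (intro finsum_insert) auto

lemma comb_cong:
  assumes "v \<in> A \<rightarrow> carrier G" "\<And>i. i \<in> A \<Longrightarrow> c i = d i" "\<And>i. i \<in> A \<Longrightarrow> v i = w i"
  shows "comb A c v = comb A d w"
proof -
  have "w i \<in> carrier G" if "i \<in> A" for i
    using assms(1,3) that by (metis PiE)
  then show ?thesis
    unfolding comb_def using assms by (intro finsum_cong') auto
qed

lemma comb_extend:
  assumes "finite B" "A \<subseteq> B" "v \<in> B \<rightarrow> carrier G"
  shows "comb A c v = comb B (\<lambda>i. if i \<in> A then c i else 0) v"
  unfolding comb_def using assms
  by (intro add.finprod_mono_neutral_cong_left) (auto simp: Pi_iff)

lemma comb_add:
  assumes "finite A" "v \<in> A \<rightarrow> carrier G"
  shows "comb A c v \<oplus> comb A d v = comb A (\<lambda>i. c i + d i) v"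
  using assms
proof (induction A)
  case (insert i A)
  then have "v i \<in> carrier G" "v \<in> A \<rightarrow> carrier G" by auto
  with insert show ?case
    by (simp add: comb_insert comb_closed add_sc a_ac flip: insert.IH)
qed (simp add: comb_empty)

lemma sc_comb:
  assumes "finite A" "v \<in> A \<rightarrow> carrier G"
  shows "sc r (comb A c v) = comb A (\<lambda>i. r * c i) v"
  using assms
proof (induction A)
  case (insert i A)
  then have "v i \<in> carrier G" "v \<in> A \<rightarrow> carrier G" by auto
  with insert show ?case
    by (simp add: comb_insert comb_closed sc_add sc_sc)
qed (simp add: comb_empty)

lemma comb_comb:
  assumes "finite I" "finite J" "v \<in> J \<rightarrow> carrier G"
  shows "comb I x (\<lambda>i. comb J (a i) v) = comb J (\<lambda>j. \<Sum>i\<in>I. x i * a i j) v"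
  using assms(1)
proof (induction I)
  case empty
  then show ?case
    unfolding comb_empty using assms by (auto simp: comb_def Pi_iff intro!: add.finprod_one_eqI[symmetric])
next
  case (insert i I)
  then show ?case
    using assms by (simp add: comb_insert comb_closed sc_comb comb_add)
qed

definition subsp :: "'v set \<Rightarrow> bool"
  where "subsp W \<longleftrightarrow> W \<subseteq> carrier G \<and> \<zero> \<in> W \<and> (\<forall>x\<in>W. \<forall>y\<in>W. x \<oplus> y \<in> W) \<and> (\<forall>c. \<forall>x\<in>W. sc c x \<in> W)"

lemma lin_span_comb: "lin_span G sc S = {comb T c (\<lambda>v. v) | c T. finite T \<and> T \<subseteq> S}"
  by (simp add: lin_span_def comb_def)

lemma lin_span_finite:
  assumes "finite S" "S \<subseteq> carrier G"
  shows "lin_span G sc S = range (\<lambda>c. comb S c (\<lambda>v. v))"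
proof -
  have "comb T c (\<lambda>v. v) \<in> range (\<lambda>c. comb S c (\<lambda>v. v))" if "T \<subseteq> S" for T c
    using comb_extend[OF assms(1) that, of "\<lambda>v. v" c] assms by auto
  then show ?thesis
    using assms(1) by (auto simp: lin_span_comb)
qed

lemma comb_in_subsp:
  assumes "subsp W" "v \<in> A \<rightarrow> W"
  shows "comb A c v \<in> W"
proof (cases "finite A")
  case True
  then show ?thesis
    using assms(2)
  proof (induction A)
    case (insert i A)
    then have "comb (insert i A) c v = sc (c i) (v i) \<oplus> comb A c v"
      using assms(1) by (intro comb_insert) (auto simp: subsp_def)
    with insert assms(1) show ?case by (auto simp: subsp_def)
  qed (use assms(1) in \<open>simp add: comb_empty subsp_def\<close>)
next
  case False
  then show ?thesis
    using assms(1) by (simp add: comb_def finsum_infinite subsp_def)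
qed

lemma subsp_lin_span:
  assumes "S \<subseteq> carrier G"
  shows "subsp (lin_span G sc S)"
  unfolding subsp_def
proof (intro conjI ballI allI subsetI)
  show "x \<in> carrier G" if "x \<in> lin_span G sc S" for x
    using that assms by (auto simp: lin_span_comb intro!: comb_closed)
  show "\<zero> \<in> lin_span G sc S"
    unfolding lin_span_comb by (auto intro!: exI[of _ "{}"] simp: comb_empty)
  show "x \<oplus> y \<in> lin_span G sc S" if "x \<in> lin_span G sc S" "y \<in> lin_span G sc S" for x y
  proof -
    from that obtain T T' c c' where T: "finite T" "T \<subseteq> S" "finite T'" "T' \<subseteq> S"
      and xy: "x = comb T c (\<lambda>v. v)" "y = comb T' c' (\<lambda>v. v)"
      by (auto simp: lin_span_comb)
    let ?e = "\<lambda>A c v. if v \<in> A then c v else (0 :: 'k)"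
    have "x \<oplus> y = comb (T \<union> T') (\<lambda>v. ?e T c v + ?e T' c' v) (\<lambda>v. v)"
      using T assms unfolding xy comb_extend[of "T \<union> T'" T "\<lambda>v. v", simplified]
      by (subst comb_extend[of "T \<union> T'" T], force, force, force,
          subst comb_extend[of "T \<union> T'" T'], force, force, force, subst comb_add) auto
    then show ?thesis
      unfolding lin_span_comb using T by blast
  qed
  show "sc r x \<in> lin_span G sc S" if "x \<in> lin_span G sc S" for r x
  proof -
    from that obtain T c where T: "finite T" "T \<subseteq> S" "x = comb T c (\<lambda>v. v)"
      by (auto simp: lin_span_comb)
    then have "sc r x = comb T (\<lambda>v. r * c v) (\<lambda>v. v)"
      using assms by (auto intro!: sc_comb)
    with T show ?thesis unfolding lin_span_comb by blast
  qed
qed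

lemma lin_span_least: "S \<subseteq> W \<Longrightarrow> subsp W \<Longrightarrow> lin_span G sc S \<subseteq> W"
  unfolding lin_span_comb by (auto intro!: comb_in_subsp)

lemma lin_span_base: "S \<subseteq> carrier G \<Longrightarrow> x \<in> S \<Longrightarrow> x \<in> lin_span G sc S"
  unfolding lin_span_comb
  by (rule CollectI, rule exI[of _ "\<lambda>_. 1"], rule exI[of _ "{x}"])
     (auto simp: comb_insert comb_empty sc_one subset_iff)

text \<open>Coordinates with respect to \<open>S\<close> turn a relation into a homogeneous system
  with \<open>card S\<close> equations in \<open>card I\<close> unknowns.\<close>

lemma family_dependent:
  assumes "finite S" "S \<subseteq> carrier G" "finite I" "card S < card I" "v \<in> I \<rightarrow> lin_span G sc S"
  shows "\<exists>c. (\<exists>i\<in>I. c i \<noteq> 0) \<and> comb I c v = \<zero>"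
proof -
  have "\<forall>i. \<exists>a. i \<in> I \<longrightarrow> v i = comb S a (\<lambda>v. v)"
    using assms(5) unfolding lin_span_finite[OF assms(1,2)] by blast
  then obtain a where a: "\<And>i. i \<in> I \<Longrightarrow> v i = comb S (a i) (\<lambda>v. v)" by metis
  obtain c where c: "\<exists>i\<in>I. c i \<noteq> 0" "\<And>s. s \<in> S \<Longrightarrow> (\<Sum>i\<in>I. c i * a i s) = 0"
    using homogeneous_system_nontrivial[OF assms(1,3,4), of a] by blast
  have cl: "v \<in> I \<rightarrow> carrier G"
    using assms(5) subsp_lin_span[OF assms(2)] by (auto simp: subsp_def)
  have "comb I c v = comb I c (\<lambda>i. comb S (a i) (\<lambda>v. v))"
    by (rule comb_cong[OF cl]) (simp_all add: a)
  also have "\<dots> = comb S (\<lambda>s. \<Sum>i\<in>I. c i * a i s) (\<lambda>v. v)"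
    using assms by (intro comb_comb) auto
  also have "\<dots> = comb S (\<lambda>_. 0) (\<lambda>v. v)"
    using assms(2) c(2) by (intro comb_cong) auto
  also have "\<dots> = \<zero>"
    using assms(2) by (auto simp: comb_def intro!: add.finprod_one_eqI)
  finally show ?thesis using c(1) by blast
qed

lemma lin_indep_comb: "lin_indep G sc S \<longleftrightarrow>
    (\<forall>c T. finite T \<and> T \<subseteq> S \<and> comb T c (\<lambda>v. v) = \<zero> \<longrightarrow> (\<forall>v\<in>T. c v = 0))"
  by (simp add: lin_indep_def comb_def)

lemma lin_indep_finite_card:
  assumes "finite S" "S \<subseteq> carrier G" "B \<subseteq> lin_span G sc S" "lin_indep G sc B"
  shows "finite B \<and> card B \<le> card S"
proof -
  have le: "card T \<le> card S" if T: "finite T" "T \<subseteq> B" for T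
  proof (rule ccontr)
    assume "\<not> card T \<le> card S"
    then obtain c where "\<exists>i\<in>T. c i \<noteq> 0" "comb T c (\<lambda>v. v) = \<zero>"
      using family_dependent[OF assms(1,2) T(1), of "\<lambda>v. v"] T assms(3) by auto
    with T assms(4) show False by (auto simp: lin_indep_comb)
  qed
  have "finite B"
  proof (rule ccontr)
    assume "infinite B"
    then obtain T where "T \<subseteq> B" "finite T" "card T = Suc (card S)"
      using infinite_arbitrarily_large by blast
    with le[of T] show False by simp
  qed
  with le show ?thesis by blast
qed

text \<open>An independent subset of \<open>W\<close> of maximal size exists because sizes are
  bounded by \<open>card S\<close>, and a vector outside its span could be added. This gives meaning
  to the choice made in \<open>lin_dim\<close>.\<close>

lemma exists_basis:
  assumes "finite S" "S \<subseteq> carrier G" "W \<subseteq> lin_span G sc S" "subsp W"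
  shows "\<exists>B. B \<subseteq> W \<and> lin_indep G sc B \<and> lin_span G sc B = W"
proof -
  let ?P = "\<lambda>B. B \<subseteq> W \<and> lin_indep G sc B"
  define K where "K = card ` {B. ?P B}"
  have "{} \<in> {B. ?P B}" by (simp add: lin_indep_comb)
  then have ne: "K \<noteq> {}" unfolding K_def by blast
  have "K \<subseteq> {..card S}"
    using lin_indep_finite_card[OF assms(1,2)] assms(3) unfolding K_def by blast
  then have fin: "finite K" by (rule finite_subset) simp
  have "Max K \<in> K" using fin ne by (rule Max_in)
  then obtain B where "B \<in> {B. ?P B}" and B3: "card B = Max K"
    unfolding K_def image_iff by metis
  then have B: "B \<subseteq> W" "lin_indep G sc B" "card B = Max K" by simp_all
  have max: "card B' \<le> card B" if "B' \<subseteq> W" "lin_indep G sc B'" for B'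
  proof -
    have "card B' \<in> K" unfolding K_def using that by (intro imageI CollectI conjI)
    then show ?thesis unfolding B(3) by (rule Max_ge[OF fin])
  qed
  have fin: "finite B"
    using lin_indep_finite_card[OF assms(1,2) _ B(2)] B(1) assms(3) by blast
  have W: "W \<subseteq> carrier G" using assms(4) by (simp add: subsp_def)
  have "w \<in> lin_span G sc B" if w: "w \<in> W" for w
  proof (rule ccontr)
    assume nw: "w \<notin> lin_span G sc B"
    have "w \<notin> B" using nw lin_span_base[of B w] B(1) W by blast
    have wG: "w \<in> carrier G" using w W by blast
    have BG: "(\<lambda>v. v) \<in> T \<rightarrow> carrier G" if "T \<subseteq> B" for T using B(1) W that by blast
    have "lin_indep G sc (insert w B)"
      unfolding lin_indep_comb
    proof (intro allI impI, elim conjE)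
      fix c T assume T: "finite T" "T \<subseteq> insert w B" "comb T c (\<lambda>v. v) = \<zero>"
      show "\<forall>v\<in>T. c v = 0"
      proof (cases "w \<in> T")
        case False
        with T B(2) show ?thesis unfolding lin_indep_comb by blast
      next
        case True
        let ?T = "T - {w}"
        have T': "?T \<subseteq> B" "finite ?T" "insert w ?T = T" using T True by auto
        have "(\<lambda>v. v) \<in> insert w ?T \<rightarrow> carrier G"
          using wG BG[OF T'(1)] by auto
        then have sum: "sc (c w) w \<oplus> comb ?T c (\<lambda>v. v) = \<zero>"
          using comb_insert[OF T'(2), of w "\<lambda>v. v" c] T(3) T'(3) by simp
        have "c w = 0"
        proof (rule ccontr)
          assume cw: "c w \<noteq> 0"
          have "sc (- inverse (c w)) (sc (c w) w \<oplus> comb ?T c (\<lambda>v. v)) = \<zero>"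
            by (simp add: sum)
          then have eq: "sc (- 1) w \<oplus> comb ?T (\<lambda>v. - inverse (c w) * c v) (\<lambda>v. v) = \<zero>"
            using cw wG comb_closed[OF BG[OF T'(1)]]
            by (simp add: sc_add sc_sc sc_comb[OF T'(2) BG[OF T'(1)]])
          have "w \<oplus> sc (- 1) w = \<zero>"
            using add_sc[OF wG, of 1 "- 1"] wG by (simp add: sc_one)
          then have "w = comb ?T (\<lambda>v. - inverse (c w) * c v) (\<lambda>v. v)"
            using eq wG comb_closed[OF BG[OF T'(1)]]
            by (metis (no_types, lifting) a_assoc l_zero r_zero sc_closed)
          with nw T' show False unfolding lin_span_comb by blast
        qed
        moreover from this sum have "comb ?T c (\<lambda>v. v) = \<zero>"
          using wG comb_closed[OF BG[OF T'(1)]] by simp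
        then have "\<forall>v\<in>?T. c v = 0"
          using B(2) T' unfolding lin_indep_comb by blast
        ultimately show ?thesis by blast
      qed
    qed
    then have "card (insert w B) \<le> card B" using max w B(1) by blast
    with \<open>w \<notin> B\<close> fin show False by simp
  qed
  moreover have "lin_span G sc B \<subseteq> W" using lin_span_least B(1) assms(4) by blast
  ultimately show ?thesis using B by blast
qed

lemma lin_dim_basis:
  assumes "finite S" "S \<subseteq> carrier G" "W \<subseteq> lin_span G sc S" "subsp W"
  obtains B where "finite B" "B \<subseteq> W" "lin_span G sc B = W" "lin_dim G sc W = card B" "card B \<le> card S"
proof -
  define B where "B = (SOME B. B \<subseteq> W \<and> lin_indep G sc B \<and> lin_span G sc B = W)"
  have B: "B \<subseteq> W \<and> lin_indep G sc B \<and> lin_span G sc B = W"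
    unfolding B_def by (rule someI_ex[OF exists_basis[OF assms]])
  moreover have "finite B \<and> card B \<le> card S"
    using B assms(3) by (intro lin_indep_finite_card[OF assms(1,2)]) auto
  moreover have "lin_dim G sc W = card B" by (simp add: lin_dim_def B_def)
  ultimately show thesis using that by blast
qed

lemma lin_dim_le:
  assumes "finite S" "S \<subseteq> carrier G" "W \<subseteq> lin_span G sc S" "subsp W"
  shows "lin_dim G sc W \<le> card S"
  using lin_dim_basis[OF assms] by metis

text \<open>The source of all lower bounds on dimensions: a basis of \<open>W\<close> with fewer
  than \<open>card I\<close> elements would make the family dependent. The set \<open>S\<close>
  guarantees that a finite basis exists.\<close>

lemma card_le_lin_dim:
  assumes "finite S" "S \<subseteq> carrier G" "W \<subseteq> lin_span G sc S" "subsp W"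
    and "finite I" "v \<in> I \<rightarrow> W" "\<And>c. comb I c v = \<zero> \<Longrightarrow> \<forall>i\<in>I. c i = 0"
  shows "card I \<le> lin_dim G sc W"
proof (rule ccontr)
  obtain B where B: "finite B" "B \<subseteq> W" "lin_span G sc B = W" "lin_dim G sc W = card B"
    using lin_dim_basis[OF assms(1-4)] by metis
  assume "\<not> card I \<le> lin_dim G sc W"
  then have "\<exists>c. (\<exists>i\<in>I. c i \<noteq> 0) \<and> comb I c v = \<zero>"
    using B assms by (intro family_dependent[of B]) (auto simp: subsp_def)
  with assms(7) show False by blast
qed

end

section \<open>Noncommutative polynomials\<close>

lemma const_simps:
  "const 0 = 0" "const 1 = 1" "const (c + d) = const c + const d" "const (c * d) = const c * const d"
  by (simp_all add: const_def single_add mult_single)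

lemma poly_mapping_sum_single:
  "f = (\<Sum>w\<in>Poly_Mapping.keys f. Poly_Mapping.single w (Poly_Mapping.lookup f w))"
proof (rule poly_mapping_eqI)
  fix k
  show "Poly_Mapping.lookup f k =
      Poly_Mapping.lookup (\<Sum>w\<in>Poly_Mapping.keys f. Poly_Mapping.single w (Poly_Mapping.lookup f w)) k"
    by (cases "k \<in> Poly_Mapping.keys f")
       (auto simp: lookup_sum lookup_single when_def in_keys_iff sum.delta)
qed

lemma ncpoly_eqI:
  assumes "\<And>f g. F (f + g) = F f + F g" "\<And>f g. G (f + g) = G f + (G g :: 'c::ab_group_add)"
    and "\<And>w c. F (Poly_Mapping.single w c) = G (Poly_Mapping.single w c)"
  shows "F f = G (f :: 'a \<Rightarrow>\<^sub>0 'b::ab_group_add)"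
proof -
  have zero: "F 0 = 0" "G 0 = 0"
    using assms(1)[of 0 0] assms(2)[of 0 0] by simp_all
  have sum: "F (sum h A) = G (sum h A)" if "\<And>w. w \<in> A \<Longrightarrow> F (h w) = G (h w)" for h :: "'a \<Rightarrow> 'a \<Rightarrow>\<^sub>0 'b" and A
    using that by (induction A rule: infinite_finite_induct) (simp_all add: zero assms(1,2))
  show ?thesis
    by (subst (1 2) poly_mapping_sum_single) (intro sum assms(3))
qed

lemma const_central: "f * const c = const c * f"
  by (rule ncpoly_eqI[where f = f])
     (simp_all add: distrib_left distrib_right const_def mult_single mult.commute)

interpretation nc: operator_space "\<lambda>c f. const c * f"
  by unfold_locales (simp_all add: const_simps distrib_left distrib_right mult.assoc)

lemma lin_times_right: "nc.lin (\<lambda>f. f * g)"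
  by (rule nc.linI) (simp_all add: distrib_right mult.assoc)

text \<open>Polynomials of the type may use letters of any index. Deleting words with foreign
  letters is a ring homomorphism onto \<open>free_alg n\<close>, because a product of words lies in
  \<open>words n\<close> only if both factors do. It lets maps defined on the carrier be extended to
  the whole type.\<close>

definition restr :: "nat \<Rightarrow> 'k::field ncpoly \<Rightarrow> 'k ncpoly"
  where "restr n = Poly_Mapping.mapp (\<lambda>w c. if w \<in> words n then c else 0)"

lemma lookup_restr: "Poly_Mapping.lookup (restr n f) w = (if w \<in> words n then Poly_Mapping.lookup f w else 0)"
  by (auto simp: restr_def lookup_mapp when_def in_keys_iff)

lemma restr_add: "restr n (f + g) = restr n f + restr n g"
  by (rule poly_mapping_eqI) (simp add: lookup_restr lookup_add)

lemma restr_single: "restr n (Poly_Mapping.single w c) = (if w \<in> words n then Poly_Mapping.single w c else 0)"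
  by (rule poly_mapping_eqI) (simp add: lookup_restr lookup_single when_def)

lemma words_add_iff: "v + w \<in> words n \<longleftrightarrow> v \<in> words n \<and> w \<in> words n"
  by (auto simp: words_def plus_word_def)

lemma restr_mult: "restr n (f * g) = restr n f * restr n g"
proof (rule ncpoly_eqI[where f = f])
  fix w c
  show "restr n (Poly_Mapping.single w c * g) = restr n (Poly_Mapping.single w c) * restr n g"
    by (rule ncpoly_eqI[where f = g])
       (auto simp: distrib_left restr_add restr_single mult_single words_add_iff)
qed (simp_all add: distrib_right restr_add)

lemma restr_carrier: "restr n f \<in> carrier (free_alg n)"
  by (auto simp: free_alg_def in_keys_iff lookup_restr split: if_splits)

lemma restr_id: "f \<in> carrier (free_alg n) \<Longrightarrow> restr n f = f"
  by (rule poly_mapping_eqI) (auto simp: lookup_restr free_alg_def in_keys_iff)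

primrec nc_mono :: "(nat \<Rightarrow> 'a::monoid_mult) \<Rightarrow> nat \<Rightarrow> (nat \<Rightarrow> nat) \<Rightarrow> 'a"
  where
    "nc_mono a 0 e = 1"
  | "nc_mono a (Suc j) e = nc_mono a j e * a (Suc j) ^ e (Suc j)"

lemma op_mono_times: "op_mono (\<lambda>i v. v * a i) j e v = v * nc_mono a j e"
proof (induction j)
  case (Suc j)
  have "((\<lambda>v. v * x) ^^ t) u = u * x ^ t" for x u :: 'a and t
    by (induction t) (simp_all add: mult.assoc power_commutes)
  with Suc show ?case by (simp add: mult.assoc)
qed simp

lemma nc_mono_closed:
  "(\<And>i. i \<in> {1..j} \<Longrightarrow> a i \<in> carrier (free_alg n)) \<Longrightarrow> nc_mono a j e \<in> carrier (free_alg n)"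
proof (induction j)
  case (Suc j)
  have "f ^ t \<in> carrier (free_alg n)" if "f \<in> carrier (free_alg n)" for f :: "'a ncpoly" and t
    using that by (induction t) (auto intro: free_alg_closed)
  with Suc show ?case by (auto intro!: free_alg_closed)
qed (simp add: free_alg_closed)

primrec nc_pbw :: "nat \<Rightarrow> (nat \<Rightarrow> nat) \<Rightarrow> (nat \<Rightarrow> nat) \<Rightarrow> 'k::field ncpoly"
  where
    "nc_pbw 0 a b = 1"
  | "nc_pbw (Suc j) a b = nc_pbw j a b * gy (Suc j) ^ a (Suc j) * gx (Suc j) ^ b (Suc j)"

definition gz :: "'k::field \<Rightarrow> nat \<Rightarrow> 'k ncpoly"
  where "gz q i = (\<Sum>l = 1..i. const (inverse (q ^ 2) - 1) * (gy l * gx l))"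

lemma gz_closed: "i \<le> n \<Longrightarrow> gz q i \<in> carrier (free_alg n)"
  unfolding gz_def by (intro free_alg_sum_closed free_alg_closed) auto

abbreviation sp_rels :: "nat \<Rightarrow> 'k::field \<Rightarrow> 'k ncpoly set"
  where "sp_rels n q \<equiv> Kn_rels n sp_p (sp_q q) (sp_gamma q)"

text \<open>
  Right multiplication on the quotient of the free algebra by the right ideal \<open>R\<close>, with the quotient
  realised as a complement of \<open>R\<close>, the range of the projection \<open>\<psi>\<close>.
\<close>

lemma right_ideal_ops:
  fixes q :: "'k::field" and R :: "'k ncpoly set"
  assumes q: "q \<noteq> 0" "\<And>k. k > 0 \<Longrightarrow> q ^ k \<noteq> 1"
    and R: "nc.subspace R" "\<And>v i. i \<in> {1..n} \<Longrightarrow> v \<in> R \<Longrightarrow> v * gx i \<in> R"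
      "\<And>v i. i \<in> {1..n} \<Longrightarrow> v \<in> R \<Longrightarrow> v * gy i \<in> R"
    and rels: "\<And>v r. r \<in> sp_rels n q \<Longrightarrow> v * r \<in> R"
  obtains \<psi> where "nc.lin \<psi>" "\<And>v. \<psi> v = 0 \<longleftrightarrow> v \<in> R"
    "\<And>i v. i \<in> {1..n} \<Longrightarrow> \<psi> (\<psi> v * gx i) = \<psi> (v * gx i)"
    "\<And>i v. i \<in> {1..n} \<Longrightarrow> \<psi> (\<psi> v * gy i) = \<psi> (v * gy i)"
    "qs_ops (\<lambda>c f. const c * f) n q (\<lambda>i v. \<psi> (v * gx i)) (\<lambda>i v. \<psi> (v * gy i))"
proof -
  have XX: "v * gx i * gx j - const (inverse q) * (v * gx j * gx i) \<in> R" if "1 \<le> i" "i < j" "j \<le> n" for i j v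
  proof -
    have "v * (gx i * gx j - const (sp_q q i * inverse (sp_p j) * sp_gamma q i j) * gx j * gx i) \<in> R"
      using that by (intro rels, unfold Kn_rels_def) blast
    moreover have "sp_q q i * inverse (sp_p j) * sp_gamma q i j = inverse q"
      using that q by (simp add: sp_q_def sp_p_def sp_gamma_def power2_eq_square)
    ultimately show ?thesis
      by (simp add: right_diff_distrib mult.assoc[symmetric] const_central)
  qed
  have YY: "v * gy i * gy j - const q * (v * gy j * gy i) \<in> R" if "1 \<le> i" "i < j" "j \<le> n" for i j v
  proof -
    have "v * (gy i * gy j - const (sp_gamma q i j) * gy j * gy i) \<in> R"
      using that by (intro rels, unfold Kn_rels_def) blast
    moreover have "sp_gamma q i j = q"
      using that q by (simp add: sp_gamma_def)
    ultimately show ?thesis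
      by (simp add: right_diff_distrib mult.assoc[symmetric] const_central)
  qed
  have YX: "v * gx i * gy j - const (inverse q) * (v * gy j * gx i) \<in> R"
    if "i \<in> {1..n}" "j \<in> {1..n}" "i \<noteq> j" for i j v
  proof (cases "i < j")
    case True
    have "v * (gx i * gy j - const (sp_p j * inverse (sp_gamma q i j)) * gy j * gx i) \<in> R"
      using that True unfolding atLeastAtMost_iff by (intro rels, unfold Kn_rels_def) blast
    moreover have "sp_p j * inverse (sp_gamma q i j) = inverse q"
      using True q by (simp add: sp_p_def sp_gamma_def)
    ultimately show ?thesis
      by (simp add: right_diff_distrib mult.assoc[symmetric] const_central)
  next
    case False
    have "v * (gx i * gy j - const (sp_q q j * inverse (sp_gamma q i j)) * gy j * gx i) \<in> R"
      using that False unfolding atLeastAtMost_iff linorder_neq_iff by (intro rels, unfold Kn_rels_def) blast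
    moreover have "sp_q q j * inverse (sp_gamma q i j) = inverse q"
      using that False q by (simp add: sp_q_def sp_gamma_def power2_eq_square)
    ultimately show ?thesis
      by (simp add: right_diff_distrib mult.assoc[symmetric] const_central)
  qed
  have YXi: "v * gx i * gy i - const (inverse (q ^ 2)) * (v * gy i * gx i) -
      (\<Sum>l = 1..<i. const (inverse (q ^ 2) - 1) * (v * gy l * gx l)) \<in> R" if "i \<in> {1..n}" for i v
  proof -
    have "v * (gx i * gy i - const (sp_q q i) * gy i * gx i -
        (\<Sum>l = 1..<i. const (sp_q q l - sp_p l) * gy l * gx l)) \<in> R"
      using that unfolding atLeastAtMost_iff by (intro rels, unfold Kn_rels_def) blast
    then show ?thesis
      by (simp add: sp_q_def sp_p_def right_diff_distrib sum_distrib_left mult.assoc[symmetric] const_central)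
  qed
  show thesis
    by (rule nc.quotient_ops[where T = R and n = n and X = "\<lambda>i v. v * gx i" and Y = "\<lambda>i v. v * gy i" and q = q,
          OF R lin_times_right lin_times_right q XX YY YX YXi])
       (assumption | rule that)+
qed

text \<open>Two instances are used: the annihilator of a vector of the module, which yields growth,
  and the kernel of the map onto the algebra, which yields straightening. The left factor
  \<open>v\<close> in \<open>rels\<close> reflects that the relations generate a two-sided
  ideal.\<close>

locale right_ideal =
  fixes n :: nat and q :: "'k::field" and R :: "'k ncpoly set"
  assumes q: "q \<noteq> 0" "\<And>k. k > 0 \<Longrightarrow> q ^ k \<noteq> 1"
    and R: "nc.subspace R" "\<And>v i. i \<in> {1..n} \<Longrightarrow> v \<in> R \<Longrightarrow> v * gx i \<in> R"
      "\<And>v i. i \<in> {1..n} \<Longrightarrow> v \<in> R \<Longrightarrow> v * gy i \<in> R"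
    and rels: "\<And>v r. r \<in> sp_rels n q \<Longrightarrow> v * r \<in> R"
begin

text \<open>The class of 1 is the vector to which \<open>torsion_free_growth\<close> applies: the
  assumption says that no z-monomial kills it modulo \<open>R\<close>. The results are then lifted
  from the range of \<psi> to polynomials.\<close>

lemma growth:
  assumes "\<And>e. nc_mono (gz q) n e \<notin> R"
  obtains \<epsilon> w
  where "\<And>k. \<exists>I. I \<subseteq> exponents n (2 * n * k + k) \<times> exponents n (2 * n * k + k) \<and> Suc k ^ n \<le> card I \<and>
      (\<forall>c. (\<Sum>(e, b)\<in>I. const (c (e, b)) *
          (w * nc_mono (gz q) n e * nc_mono (\<lambda>i. if \<epsilon> i then gy i else gx i) n b)) \<in> R \<longrightarrow> (\<forall>i\<in>I. c i = 0))"
    and "\<And>k c. (\<And>v. (\<Sum>b\<in>exponents n k. \<Sum>e\<in>exponents n k. const (c e b) *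
          (v * nc_mono (gz q) n e * nc_mono (\<lambda>i. if \<epsilon> i then gy i else gx i) n b)) \<in> R) \<Longrightarrow>
      \<forall>e\<in>exponents n k. \<forall>b\<in>exponents n k. c e b = 0"
proof -
  obtain \<psi> where \<psi>: "nc.lin \<psi>" "\<And>v. \<psi> v = 0 \<longleftrightarrow> v \<in> R"
    and \<psi>_X: "\<And>i v. i \<in> {1..n} \<Longrightarrow> \<psi> (\<psi> v * gx i) = \<psi> (v * gx i)"
    and \<psi>_Y: "\<And>i v. i \<in> {1..n} \<Longrightarrow> \<psi> (\<psi> v * gy i) = \<psi> (v * gy i)"
    and ops: "qs_ops (\<lambda>c f. const c * f) n q (\<lambda>i v. \<psi> (v * gx i)) (\<lambda>i v. \<psi> (v * gy i))"
    by (rule right_ideal_ops[OF q R rels]) (assumption | rule that)+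
  note s = nc.lin_simps[OF \<psi>(1)]
  interpret A: qs_ops "\<lambda>c f. const c * f" n q "\<lambda>i v. \<psi> (v * gx i)" "\<lambda>i v. \<psi> (v * gy i)" by (fact ops)
  have \<psi>_Z: "\<psi> (v * gz q i) = A.Z i (\<psi> v)" if "i \<in> {1..n}" for i v
  proof -
    have "v * gz q i = (\<Sum>l = 1..i. const (inverse (q ^ 2) - 1) * (v * gy l * gx l))"
      by (simp add: gz_def sum_distrib_left mult.assoc[symmetric] const_central)
    then show ?thesis
      using that by (auto simp: A.Z_def A.Q_def s \<psi>_X \<psi>_Y intro!: sum.cong)
  qed
  have Z: "op_mono A.Z n e (\<psi> v) = \<psi> (v * nc_mono (gz q) n e)" for e v
    using nc.op_mono_intertwine[of n \<psi> "\<lambda>i v. v * gz q i" A.Z n e v] \<psi>_Z by (simp add: op_mono_times)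
  have W: "op_mono (\<lambda>i. if \<epsilon> i then (\<lambda>v. \<psi> (v * gy i)) else (\<lambda>v. \<psi> (v * gx i))) n b (\<psi> v) =
      \<psi> (v * nc_mono (\<lambda>i. if \<epsilon> i then gy i else gx i) n b)" for \<epsilon> b v
    using nc.op_mono_intertwine[of n \<psi> "\<lambda>i v. v * (if \<epsilon> i then gy i else gx i)"
        "\<lambda>i. if \<epsilon> i then (\<lambda>v. \<psi> (v * gy i)) else (\<lambda>v. \<psi> (v * gx i))" n b v]
    by (simp add: op_mono_times \<psi>_X \<psi>_Y)
  have sub: "nc.subspace (range \<psi>)"
  proof (rule nc.subspaceI)
    show "0 \<in> range \<psi>" using s(4) by (metis rangeI)
    show "u + v \<in> range \<psi>" if "u \<in> range \<psi>" "v \<in> range \<psi>" for u v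
      using that by (auto simp flip: s(2))
    show "const c * v \<in> range \<psi>" if "v \<in> range \<psi>" for c v
      using that by (auto simp flip: s(1))
  qed
  show thesis
  proof (rule A.torsion_free_growth[of "\<psi> 1" "range \<psi>"])
    show "op_mono A.Z n e (\<psi> 1) \<noteq> 0" for e
      using assms \<psi>(2) by (simp add: Z)
  next
    fix w \<epsilon>
    assume w: "w \<in> range \<psi>"
      and I: "\<And>k. \<exists>I. I \<subseteq> exponents n (2 * n * k + k) \<times> exponents n (2 * n * k + k) \<and> Suc k ^ n \<le> card I \<and>
        (\<forall>c. (\<Sum>(e, b)\<in>I. const (c (e, b)) * op_mono (\<lambda>i. if \<epsilon> i then \<lambda>v. \<psi> (v * gy i) else (\<lambda>v. \<psi> (v * gx i))) n b (op_mono A.Z n e w)) = 0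
          \<longrightarrow> (\<forall>i\<in>I. c i = 0))"
      and c: "\<And>k c. (\<And>v. v \<in> range \<psi> \<Longrightarrow> (\<Sum>b\<in>exponents n k. \<Sum>e\<in>exponents n k. const (c e b) *
          op_mono (\<lambda>i. if \<epsilon> i then \<lambda>v. \<psi> (v * gy i) else (\<lambda>v. \<psi> (v * gx i))) n b (op_mono A.Z n e v)) = 0)
          \<Longrightarrow> \<forall>e\<in>exponents n k. \<forall>b\<in>exponents n k. c e b = 0"
    from w obtain w' where w': "w = \<psi> w'" by blast
    show thesis
    proof (rule that[of w' \<epsilon>])
      show "\<exists>I. I \<subseteq> exponents n (2 * n * k + k) \<times> exponents n (2 * n * k + k) \<and> Suc k ^ n \<le> card I \<and>
        (\<forall>c. (\<Sum>(e, b)\<in>I. const (c (e, b)) *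
          (w' * nc_mono (gz q) n e * nc_mono (\<lambda>i. if \<epsilon> i then gy i else gx i) n b)) \<in> R \<longrightarrow> (\<forall>i\<in>I. c i = 0))" for k
        using I[of k] by (simp add: w' Z W s \<psi>(2)[symmetric] case_prod_unfold)
      show "\<forall>e\<in>exponents n k. \<forall>b\<in>exponents n k. c e b = 0"
        if "\<And>v. (\<Sum>b\<in>exponents n k. \<Sum>e\<in>exponents n k. const (c e b) *
          (v * nc_mono (gz q) n e * nc_mono (\<lambda>i. if \<epsilon> i then gy i else gx i) n b)) \<in> R" for k c
        using that by (intro c) (auto simp: Z W s \<psi>(2)[symmetric])
    qed
  qed (auto simp: sub)
qed

text \<open>A word is built from 1 by appending letters on the right, and each letter raises the
  degree of the ordered monomials by at most one.\<close>

lemma word_straightening: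
  assumes "w \<in> words n" "length (letters w) \<le> L"
  shows "\<exists>c. Poly_Mapping.single w 1 -
    (\<Sum>(a, b)\<in>exponents n L \<times> exponents n L. const (c (a, b)) * nc_pbw n a b) \<in> R"
proof -
  obtain \<psi> where \<psi>: "nc.lin \<psi>" "\<And>v. \<psi> v = 0 \<longleftrightarrow> v \<in> R"
    and \<psi>_X: "\<And>i v. i \<in> {1..n} \<Longrightarrow> \<psi> (\<psi> v * gx i) = \<psi> (v * gx i)"
    and \<psi>_Y: "\<And>i v. i \<in> {1..n} \<Longrightarrow> \<psi> (\<psi> v * gy i) = \<psi> (v * gy i)"
    and ops: "qs_ops (\<lambda>c f. const c * f) n q (\<lambda>i v. \<psi> (v * gx i)) (\<lambda>i v. \<psi> (v * gy i))"
    by (rule right_ideal_ops[OF q R rels]) (assumption | rule that)+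
  note s = nc.lin_simps[OF \<psi>(1)]
  interpret A: qs_ops "\<lambda>c f. const c * f" n q "\<lambda>i v. \<psi> (v * gx i)" "\<lambda>i v. \<psi> (v * gy i)" by (fact ops)
  have powX: "((\<lambda>v. \<psi> (v * gx i)) ^^ t) (\<psi> v) = \<psi> (v * gx i ^ t)" if "i \<in> {1..n}" for i t v
    by (induction t) (simp_all add: \<psi>_X[OF that] mult.assoc power_commutes)
  have powY: "((\<lambda>v. \<psi> (v * gy i)) ^^ t) (\<psi> v) = \<psi> (v * gy i ^ t)" if "i \<in> {1..n}" for i t v
    by (induction t) (simp_all add: \<psi>_Y[OF that] mult.assoc power_commutes)
  have pbw: "A.pbw j a b (\<psi> 1) = \<psi> (nc_pbw j a b)" if "j \<le> n" for j a b
    using that by (induction j) (simp_all add: powX powY)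
  have "\<psi> (Poly_Mapping.single (Word ls) 1) \<in> A.pbw_span n (length ls) (\<psi> 1)" if "Word ls \<in> words n" for ls
    using that
  proof (induction ls rule: rev_induct)
    case Nil
    have "A.pbw n (\<lambda>_. 0) (\<lambda>_. 0) (\<psi> 1) = \<psi> 1"
      unfolding pbw[OF order_refl] by (rule arg_cong[where f = \<psi>], induction n) auto
    then have "\<psi> 1 \<in> A.pbw_span n 0 (\<psi> 1)"
      unfolding A.pbw_span_def by (intro nc.span_base) force
    then show ?case by (simp add: zero_word_def[symmetric])
  next
    case (snoc l ls)
    have prod: "Poly_Mapping.single (Word (ls @ [l])) (1::'k) = Poly_Mapping.single (Word ls) 1 * Poly_Mapping.single (Word [l]) 1"
      by (simp add: mult_single plus_word_def)
    have IH: "\<psi> (Poly_Mapping.single (Word ls) 1) \<in> A.pbw_span n (length ls) (\<psi> 1)"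
      using snoc by (auto simp: words_def)
    show ?case
    proof (cases l)
      case (X i)
      then have i: "i \<in> {1..n}" using snoc.prems by (auto simp: words_def)
      have "\<psi> (Poly_Mapping.single (Word (ls @ [l])) 1) = \<psi> (\<psi> (Poly_Mapping.single (Word ls) 1) * gx i)"
        unfolding prod \<psi>_X[OF i] by (simp add: X gx_def)
      with A.pbw_span_closed[OF order_refl IH i] show ?thesis by simp
    next
      case (Y i)
      then have i: "i \<in> {1..n}" using snoc.prems by (auto simp: words_def)
      have "\<psi> (Poly_Mapping.single (Word (ls @ [l])) 1) = \<psi> (\<psi> (Poly_Mapping.single (Word ls) 1) * gy i)"
        unfolding prod \<psi>_Y[OF i] by (simp add: Y gy_def)
      with A.pbw_span_closed[OF order_refl IH i] show ?thesis by simp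
    qed
  qed
  from this[of "letters w"] assms A.pbw_span_mono[OF assms(2)] A.pbw_span_exponents[of L "\<psi> 1"]
  have "\<psi> (Poly_Mapping.single w 1) \<in> nc.span ((\<lambda>(a, b). A.pbw n a b (\<psi> 1)) ` (exponents n L \<times> exponents n L))"
    by auto
  also have "(\<lambda>(a, b). A.pbw n a b (\<psi> 1)) = \<psi> \<circ> (\<lambda>(a, b). nc_pbw n a b)"
    by (auto simp: pbw)
  finally have "\<psi> (Poly_Mapping.single w 1) \<in> nc.span (\<psi> ` (\<lambda>(a, b). nc_pbw n a b) ` (exponents n L \<times> exponents n L))"
    by (simp add: image_comp)
  also have "\<dots> = \<psi> ` nc.span ((\<lambda>(a, b). nc_pbw n a b) ` (exponents n L \<times> exponents n L))"
    using \<psi>(1) by (intro module_hom.span_image) (simp add: Vector_Spaces.module_hom_iff_linear)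
  finally obtain g where g: "g \<in> nc.span ((\<lambda>(a, b). nc_pbw n a b) ` (exponents n L \<times> exponents n L))"
    "\<psi> (Poly_Mapping.single w 1) = \<psi> g" by blast
  have "\<exists>c. g = (\<Sum>i\<in>I. const (c i) * h i)" if "finite I" "g \<in> nc.span (h ` I)" for g I and h :: "'i \<Rightarrow> 'k ncpoly"
    using that(2)
  proof (induction rule: nc.span_induct_alt)
    case base
    show ?case by (intro exI[of _ "\<lambda>_. 0"]) (simp add: const_simps)
  next
    case (step r x y)
    then obtain c i where c: "y = (\<Sum>i\<in>I. const (c i) * h i)" "i \<in> I" "x = h i" by auto
    have "const ((if j = i then r else 0) + c j) * h j =
        (if j = i then const r * h j else 0) + const (c j) * h j" for j
      by (simp add: const_simps distrib_right)
    then have "(\<Sum>j\<in>I. const ((if j = i then r else 0) + c j) * h j) =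
        (\<Sum>j\<in>I. if j = i then const r * h j else 0) + y"
      by (simp only: c(1) sum.distrib)
    also have "\<dots> = const r * x + y"
      using c(2,3) that(1) by simp
    finally show ?case by metis
  qed
  from this[OF _ g(1)] obtain c where "g = (\<Sum>i\<in>exponents n L \<times> exponents n L. const (c i) * (\<lambda>(a, b). nc_pbw n a b) i)"
    using finite_exponents by blast
  moreover have "Poly_Mapping.single w 1 - g \<in> R"
    using g(2) \<psi>(2)[of "Poly_Mapping.single w 1 - g"] by (simp add: s)
  ultimately show ?thesis by (auto simp: case_prod_unfold)
qed

end

section \<open>Growth exponents\<close>

text \<open>A bound along the multiples of \<open>C\<close> suffices, since a limsup dominates that
  of a subsequence and the constant \<open>C\<close> disappears in the quotient of
  logarithms.\<close>

lemma limsup_log_ge: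
  fixes D :: "nat \<Rightarrow> nat"
  assumes "C > 0" "\<And>k. Suc k ^ N \<le> D (C * k)"
  shows "ereal (real N) \<le> limsup (\<lambda>m. ereal (log (real m) (real (D m))))"
proof -
  \<comment> \<open>The shift by 2 keeps the base of the logarithm above 1 for every
    \<open>k\<close>.\<close>
  define r where "r k = C * (k + 2)" for k
  have r: "strict_mono r" using assms(1) by (intro strict_monoI) (simp add: r_def)
  define l where "l k = real N * ln (real k + 3) / ln (real C * (real k + 2))" for k :: nat
  have "real C > 0" using assms(1) by simp
  then have "l \<longlonglongrightarrow> real N" unfolding l_def by real_asymp
  then have "ereal (real N) = limsup (\<lambda>k. ereal (l k))"
    by (intro lim_imp_Limsup[symmetric]) auto
  also have "\<dots> \<le> limsup ((\<lambda>m. ereal (log (real m) (real (D m)))) \<circ> r)"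
  proof (intro Limsup_mono always_eventually allI)
    fix k
    have gt: "1 < real (r k)"
    proof -
      have "1 * 2 \<le> C * (k + 2)" using assms(1) by (intro mult_mono) auto
      then show ?thesis unfolding r_def by linarith
    qed
    have "real N * ln (real k + 3) = ln (real (Suc (k + 2) ^ N))"
      by (simp add: ln_realpow add.commute)
    also have "\<dots> \<le> ln (real (D (r k)))"
    proof (rule ln_mono)
      show "real (Suc (k + 2) ^ N) \<le> real (D (r k))"
        using assms(2)[of "k + 2"] unfolding r_def of_nat_le_iff .
    qed (simp only: of_nat_0_less_iff zero_less_power zero_less_Suc)
    finally show "ereal (l k) \<le> ((\<lambda>m. ereal (log (real m) (real (D m)))) \<circ> r) k"
      using gt by (auto simp: l_def log_def r_def algebra_simps intro!: divide_right_mono)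
  qed
  also have "\<dots> \<le> limsup (\<lambda>m. ereal (log (real m) (real (D m))))"
    by (rule limsup_subseq_mono[OF r])
  finally show ?thesis .
qed

lemma limsup_log_le:
  fixes D :: "nat \<Rightarrow> nat"
  assumes "\<And>m. D m \<le> Suc (d * m) ^ N"
  shows "limsup (\<lambda>m. ereal (log (real m) (real (D m)))) \<le> ereal (real N)"
proof -
  \<comment> \<open>Using d + 1 keeps the coefficient of m positive also for \<open>d = 0\<close>,
    so the limit is N in every case.\<close>
  define l where "l m = real N * ln ((real d + 1) * real m + 1) / ln (real m)" for m :: nat
  have "real d + 1 > 0" by simp
  then have "l \<longlonglongrightarrow> real N" unfolding l_def by real_asymp
  then have "limsup (\<lambda>m. ereal (l m)) = ereal (real N)"
    by (intro lim_imp_Limsup) auto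
  moreover have "limsup (\<lambda>m. ereal (log (real m) (real (D m)))) \<le> limsup (\<lambda>m. ereal (l m))"
  proof (rule Limsup_mono)
    show "\<forall>\<^sub>F m in sequentially. ereal (log (real m) (real (D m))) \<le> ereal (l m)"
      using eventually_ge_at_top[of 2]
    proof eventually_elim
      case (elim m)
      have "ln (real (D m)) \<le> real N * ln ((real d + 1) * real m + 1)"
      proof (cases "D m = 0")
        case False
        have "real (D m) \<le> real (Suc (d * m) ^ N)"
          using assms[of m] by (simp only: of_nat_le_iff)
        also have "\<dots> \<le> ((real d + 1) * real m + 1) ^ N"
          by (simp add: power_mono algebra_simps)
        finally have "ln (real (D m)) \<le> ln (((real d + 1) * real m + 1) ^ N)"
          using False by (intro ln_mono) auto
        also have "\<dots> = real N * ln ((real d + 1) * real m + 1)"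
          by (simp add: ln_realpow add_pos_nonneg)
        finally show ?thesis .
      qed simp
      with elim show ?case
        by (auto simp: l_def log_def intro!: divide_right_mono)
    qed
  qed
  ultimately show ?thesis by simp
qed

section \<open>The algebra $K_n$\<close>

lemma Kn_sel:
  "carrier (Kn n p q \<gamma>) = carrier (free_alg n Quot Kn_ideal n p q \<gamma>)"
  "mult (Kn n p q \<gamma>) = mult (free_alg n Quot Kn_ideal n p q \<gamma>)"
  "one (Kn n p q \<gamma>) = one (free_alg n Quot Kn_ideal n p q \<gamma>)"
  "zero (Kn n p q \<gamma>) = zero (free_alg n Quot Kn_ideal n p q \<gamma>)"
  "add (Kn n p q \<gamma>) = add (free_alg n Quot Kn_ideal n p q \<gamma>)"
  by (simp_all add: Kn_def ring.defs)

locale Kn_algebra =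
  fixes n :: nat and p q :: "nat \<Rightarrow> 'k::field" and \<gamma> :: "nat \<Rightarrow> nat \<Rightarrow> 'k"
begin

abbreviation A where "A \<equiv> Kn n p q \<gamma>"
abbreviation cls where "cls \<equiv> Kn_class n p q \<gamma>"
abbreviation Fr :: "'k ncpoly set" where "Fr \<equiv> carrier (free_alg n)"

sublocale A: ring A by (rule ring_Kn)

lemma cls_ring_hom: "cls \<in> ring_hom (free_alg n) (free_alg n Quot Kn_ideal n p q \<gamma>)"
  using ideal.rcos_ring_hom[OF ideal_Kn] by (simp add: Kn_class_def[abs_def])

lemma cls_closed [simp, intro]: "f \<in> Fr \<Longrightarrow> cls f \<in> carrier A"
  unfolding Kn_sel by (rule ring_hom_memE(1)[OF cls_ring_hom])

lemma cls_mult: "f \<in> Fr \<Longrightarrow> g \<in> Fr \<Longrightarrow> cls (f * g) = cls f \<otimes>\<^bsub>A\<^esub> cls g"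
  using ring_hom_memE(2)[OF cls_ring_hom, of f g] by (simp add: Kn_sel) (simp add: free_alg_def)

lemma cls_add: "f \<in> Fr \<Longrightarrow> g \<in> Fr \<Longrightarrow> cls (f + g) = cls f \<oplus>\<^bsub>A\<^esub> cls g"
  using ring_hom_memE(3)[OF cls_ring_hom, of f g] by (simp add: Kn_sel) (simp add: free_alg_def)

lemma cls_one: "cls 1 = \<one>\<^bsub>A\<^esub>"
  using ring_hom_memE(4)[OF cls_ring_hom] by (simp add: Kn_sel) (simp add: free_alg_def)

lemma cls_eq_0_iff:
  assumes "f \<in> Fr"
  shows "cls f = \<zero>\<^bsub>A\<^esub> \<longleftrightarrow> f \<in> Kn_ideal n p q \<gamma>"
proof
  assume "cls f = \<zero>\<^bsub>A\<^esub>"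
  then have "Kn_ideal n p q \<gamma> +>\<^bsub>free_alg n\<^esub> f = Kn_ideal n p q \<gamma>"
    by (simp add: Kn_sel FactRing_def Kn_class_def)
  then show "f \<in> Kn_ideal n p q \<gamma>"
    using ideal.rcos_const_imp_mem[OF ideal_Kn assms] by blast
next
  assume "f \<in> Kn_ideal n p q \<gamma>"
  then show "cls f = \<zero>\<^bsub>A\<^esub>"
    using ring.a_rcos_zero[OF ring_free_alg ideal_Kn] by (simp add: Kn_sel FactRing_def Kn_class_def)
qed

lemma cls_0: "cls 0 = \<zero>\<^bsub>A\<^esub>"
  using cls_add[OF free_alg_closed(1,1)] cls_closed[OF free_alg_closed(1)]
  by (metis A.add.l_cancel_one' add.right_neutral)

lemma cls_surj: "a \<in> carrier A \<Longrightarrow> \<exists>f\<in>Fr. a = cls f"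
  by (auto simp: Kn_sel FactRing_def A_RCOSETS_def' Kn_class_def)

lemma cls_rel:
  assumes "r \<in> Kn_rels n p q \<gamma>"
  shows "cls r = \<zero>\<^bsub>A\<^esub>"
proof -
  have "r \<in> Kn_ideal n p q \<gamma>"
    unfolding Kn_ideal_def using ring.genideal_self[OF ring_free_alg Kn_rels_carrier] assms by blast
  with subsetD[OF Kn_rels_carrier assms] show ?thesis
    using cls_eq_0_iff by blast
qed

lemma smult_cls: "f \<in> Fr \<Longrightarrow> c \<odot>\<^bsub>A\<^esub> cls f = cls (const c * f)"
  by (rule smult_Kn)

lemma smult_mult:
  assumes "a \<in> carrier A" "b \<in> carrier A"
  shows "(c \<odot>\<^bsub>A\<^esub> a) \<otimes>\<^bsub>A\<^esub> b = c \<odot>\<^bsub>A\<^esub> (a \<otimes>\<^bsub>A\<^esub> b)" "a \<otimes>\<^bsub>A\<^esub> (c \<odot>\<^bsub>A\<^esub> b) = c \<odot>\<^bsub>A\<^esub> (a \<otimes>\<^bsub>A\<^esub> b)"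
proof -
  obtain f g where fg: "f \<in> Fr" "g \<in> Fr" "a = cls f" "b = cls g"
    using cls_surj assms by metis
  have "f * (const c * g) = const c * f * g"
    by (metis const_central mult.assoc)
  with fg show "(c \<odot>\<^bsub>A\<^esub> a) \<otimes>\<^bsub>A\<^esub> b = c \<odot>\<^bsub>A\<^esub> (a \<otimes>\<^bsub>A\<^esub> b)" "a \<otimes>\<^bsub>A\<^esub> (c \<odot>\<^bsub>A\<^esub> b) = c \<odot>\<^bsub>A\<^esub> (a \<otimes>\<^bsub>A\<^esub> b)"
    by (simp_all add: smult_cls cls_mult[symmetric] free_alg_closed mult.assoc)
qed

sublocale L: lin_space A "smult A"
proof
  fix x y :: "'k ncpoly set" and c d :: 'k
  assume x: "x \<in> carrier A"
  then obtain f where f: "f \<in> Fr" "x = cls f" using cls_surj by blast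
  show "c \<odot>\<^bsub>A\<^esub> x \<in> carrier A"
    using f by (simp add: smult_cls free_alg_closed cls_closed)
  show "(c + d) \<odot>\<^bsub>A\<^esub> x = c \<odot>\<^bsub>A\<^esub> x \<oplus>\<^bsub>A\<^esub> d \<odot>\<^bsub>A\<^esub> x"
    using f by (simp add: smult_cls free_alg_closed cls_add[symmetric] const_simps distrib_right)
  show "c \<odot>\<^bsub>A\<^esub> (d \<odot>\<^bsub>A\<^esub> x) = (c * d) \<odot>\<^bsub>A\<^esub> x"
    using f by (simp add: smult_cls free_alg_closed)
  show "1 \<odot>\<^bsub>A\<^esub> x = x"
    using f by (simp add: smult_cls const_simps)
  assume "y \<in> carrier A"
  then obtain g where g: "g \<in> Fr" "y = cls g" using cls_surj by blast
  show "c \<odot>\<^bsub>A\<^esub> (x \<oplus>\<^bsub>A\<^esub> y) = c \<odot>\<^bsub>A\<^esub> x \<oplus>\<^bsub>A\<^esub> c \<odot>\<^bsub>A\<^esub> y"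
    using f g by (simp add: smult_cls free_alg_closed cls_add[symmetric] distrib_left)
qed

lemma cls_comb:
  assumes "\<And>i. i \<in> I \<Longrightarrow> f i \<in> Fr"
  shows "cls (\<Sum>i\<in>I. const (c i) * f i) = L.comb I c (\<lambda>i. cls (f i))"
  using assms
proof (induction I rule: infinite_finite_induct)
  case (infinite I)
  then show ?case by (simp add: L.comb_def cls_0 A.finsum_infinite)
next
  case empty
  then show ?case by (simp add: L.comb_empty cls_0)
next
  case (insert i I)
  then have "L.comb (insert i I) c (\<lambda>i. cls (f i)) = c i \<odot>\<^bsub>A\<^esub> cls (f i) \<oplus>\<^bsub>A\<^esub> L.comb I c (\<lambda>i. cls (f i))"
    by (intro L.comb_insert) auto
  with insert show ?case
    by (simp add: smult_cls cls_add free_alg_closed free_alg_sum_closed)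
qed

section \<open>The filtration by word length and powers of a generating space\<close>

definition Deg :: "nat \<Rightarrow> 'k ncpoly set"
  where "Deg L = {f \<in> Fr. \<forall>w\<in>Poly_Mapping.keys f. length (letters w) \<le> L}"

lemma Deg_Fr: "f \<in> Deg L \<Longrightarrow> f \<in> Fr"
  by (simp add: Deg_def)

lemma Deg_mono: "L \<le> L' \<Longrightarrow> f \<in> Deg L \<Longrightarrow> f \<in> Deg L'"
  by (auto simp: Deg_def)

lemma Deg_add: "f \<in> Deg L \<Longrightarrow> g \<in> Deg L \<Longrightarrow> f + g \<in> Deg L"
  using Poly_Mapping.keys_add[of f g] by (auto simp: Deg_def free_alg_closed)

lemma Deg_mult: "f \<in> Deg L \<Longrightarrow> g \<in> Deg L' \<Longrightarrow> f * g \<in> Deg (L + L')"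
  using keys_mult[of f g] by (fastforce simp: Deg_def free_alg_closed plus_word_def)

lemma Deg_const: "const c \<in> Deg L"
  by (auto simp: Deg_def free_alg_closed) (auto simp: const_def zero_word_def split: if_splits)

lemma subsp_cls_Deg: "L.subsp (cls ` Deg L)"
  unfolding L.subsp_def
proof (intro conjI ballI allI)
  show "cls ` Deg L \<subseteq> carrier A" by (auto simp: Deg_Fr)
  show "\<zero>\<^bsub>A\<^esub> \<in> cls ` Deg L"
    using Deg_const[of 0 L] by (auto simp: const_simps cls_0[symmetric])
  show "x \<oplus>\<^bsub>A\<^esub> y \<in> cls ` Deg L" if "x \<in> cls ` Deg L" "y \<in> cls ` Deg L" for x y
    using that Deg_add by (auto simp: cls_add[symmetric] Deg_Fr)
  show "c \<odot>\<^bsub>A\<^esub> x \<in> cls ` Deg L" if "x \<in> cls ` Deg L" for c x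
    using that Deg_mult[OF Deg_const, of _ L c 0] by (auto simp: smult_cls Deg_Fr)
qed

lemma fd_subspace_Deg:
  assumes "fd_subspace A (smult A) V"
  obtains d where "V \<subseteq> cls ` Deg d"
proof -
  obtain S where S: "finite S" "S \<subseteq> carrier A" "V = lin_span A (smult A) S"
    using assms by (auto simp: fd_subspace_def)
  have "\<exists>d. S \<subseteq> cls ` Deg d"
    using S(1,2)
  proof (induction S)
    case (insert s S)
    then obtain d f where d: "S \<subseteq> cls ` Deg d" and f: "f \<in> Fr" "s = cls f"
      using cls_surj[of s] by auto
    define e where "e = Max (insert 0 ((\<lambda>w. length (letters w)) ` Poly_Mapping.keys f))"
    have "length (letters w) \<le> e" if "w \<in> Poly_Mapping.keys f" for w
      unfolding e_def using that by (intro Max_ge) auto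
    then have "f \<in> Deg e" using f by (simp add: Deg_def)
    then have "insert s S \<subseteq> cls ` Deg (max d e)"
      using d f Deg_mono[of d "max d e"] Deg_mono[of e "max d e"] by fastforce
    then show ?case by blast
  qed simp
  then obtain d where "S \<subseteq> cls ` Deg d" by blast
  then have "V \<subseteq> cls ` Deg d"
    unfolding S(3) by (intro L.lin_span_least subsp_cls_Deg)
  then show thesis by (rule that)
qed

lemma sub_pow_Deg:
  assumes "V \<subseteq> cls ` Deg d"
  shows "sub_pow A V m \<subseteq> cls ` Deg (d * m)"
proof (induction m)
  case 0
  have "\<one>\<^bsub>A\<^esub> \<in> cls ` Deg 0"
    using Deg_const[of 1 0] by (auto simp: const_simps cls_one[symmetric])
  then show ?case by (simp add: L.lin_span_least subsp_cls_Deg)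
next
  case (Suc m)
  have "u \<otimes>\<^bsub>A\<^esub> v \<in> cls ` Deg (d * Suc m)" if "u \<in> sub_pow A V m" "v \<in> V" for u v
  proof -
    from that Suc assms obtain f g where "f \<in> Deg (d * m)" "g \<in> Deg d" "u = cls f" "v = cls g" by blast
    then show ?thesis
      using Deg_mult[of f "d * m" g d] by (auto simp: cls_mult[symmetric] Deg_Fr add.commute)
  qed
  then show ?case unfolding sub_pow.simps by (intro L.lin_span_least subsp_cls_Deg) blast
qed

lemma sub_pow_subsp:
  assumes "V \<subseteq> carrier A"
  shows "L.subsp (sub_pow A V m)"
proof (induction m)
  case (Suc m)
  then have "{u \<otimes>\<^bsub>A\<^esub> v | u v. u \<in> sub_pow A V m \<and> v \<in> V} \<subseteq> carrier A"
    using assms by (auto simp: L.subsp_def)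
  then show ?case unfolding sub_pow.simps by (rule L.subsp_lin_span)
qed (simp add: L.subsp_lin_span)

lemma sub_pow_mult:
  assumes "V \<subseteq> carrier A" "u \<in> sub_pow A V m" "v \<in> V"
  shows "u \<otimes>\<^bsub>A\<^esub> v \<in> sub_pow A V (Suc m)"
  using assms sub_pow_subsp[OF assms(1), of m] unfolding sub_pow.simps
  by (intro L.lin_span_base) (auto simp: L.subsp_def)

lemma sub_pow_mono:
  assumes "V \<subseteq> carrier A" "\<one>\<^bsub>A\<^esub> \<in> V" "k \<le> m"
  shows "sub_pow A V k \<subseteq> sub_pow A V m"
  using assms(3)
proof (induction rule: dec_induct)
  case (step m)
  have "u \<in> sub_pow A V (Suc m)" if "u \<in> sub_pow A V m" for u
    using sub_pow_mult[OF assms(1) that assms(2)] sub_pow_subsp[OF assms(1), of m] that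
    by (auto simp: L.subsp_def)
  with step show ?case by blast
qed simp

lemma nc_mono_sub_pow:
  assumes V: "V \<subseteq> carrier A" and g: "\<And>i. i \<in> {1..j} \<Longrightarrow> g i \<in> Fr \<and> cls (g i) \<in> V"
    and f: "f \<in> Fr" "cls f \<in> sub_pow A V m"
  shows "cls (f * nc_mono g j e) \<in> sub_pow A V (m + (\<Sum>i = 1..j. e i))"
  using g
proof (induction j)
  case 0
  then show ?case using f by simp
next
  case (Suc j)
  have pow: "h * g (Suc j) ^ t \<in> Fr \<and> cls (h * g (Suc j) ^ t) \<in> sub_pow A V (k + t)"
    if "h \<in> Fr" "cls h \<in> sub_pow A V k" for h k t
  proof (induction t)
    case (Suc t)
    have "h * g (Suc j) ^ Suc t = h * g (Suc j) ^ t * g (Suc j)"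
      by (simp add: power_commutes mult.assoc)
    with Suc Suc.prems[of "Suc j"] show ?case
      using sub_pow_mult[OF V] \<open>\<And>i. i \<in> {1..Suc j} \<Longrightarrow> g i \<in> Fr \<and> cls (g i) \<in> V\<close>[of "Suc j"]
      by (auto simp: cls_mult free_alg_closed)
  qed (use that in simp)
  have "f * nc_mono g j e \<in> Fr"
    using Suc.prems f by (intro free_alg_closed nc_mono_closed) auto
  moreover have "cls (f * nc_mono g j e) \<in> sub_pow A V (m + (\<Sum>i = 1..j. e i))"
    using Suc by auto
  ultimately have "cls (f * nc_mono g j e * g (Suc j) ^ e (Suc j)) \<in> sub_pow A V (m + (\<Sum>i = 1..j. e i) + e (Suc j))"
    using pow by blast
  then show ?case by (simp add: mult.assoc add.assoc)
qed

lemma Kn_Z_nc_mono: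
  assumes g: "\<And>i. i \<in> {1..n} \<Longrightarrow> g i \<in> Fr \<and> Kn_z n p q \<gamma> i = cls (g i)"
  shows "cls (nc_mono g n e) \<in> Kn_Z n p q \<gamma>"
proof -
  let ?F = "\<lambda>i a. (Kn_z n p q \<gamma> i [^]\<^bsub>A\<^esub> e i) \<otimes>\<^bsub>A\<^esub> a"
  have pow: "g i ^ t \<in> Fr \<and> cls (g i) [^]\<^bsub>A\<^esub> t = cls (g i ^ t)" if "i \<in> {1..n}" for i and t :: nat
    using g[OF that]
    by (induction t) (simp_all add: cls_one free_alg_closed cls_mult[symmetric] power_commutes)
  \<comment> \<open>\<open>foldr\<close> absorbs the last factor first, so the statement is
    generalised to an arbitrary right factor \<open>h\<close>.\<close>
  have "foldr ?F [1..<Suc j] (cls h) = cls (nc_mono g j e * h)" if "j \<le> n" "h \<in> Fr" for j h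
    using that
  proof (induction j arbitrary: h)
    case (Suc j)
    have i: "Suc j \<in> {1..n}" using Suc.prems by simp
    have "foldr ?F [1..<Suc (Suc j)] (cls h) = foldr ?F [1..<Suc j] (cls (g (Suc j) ^ e (Suc j) * h))"
      using pow[OF i] g[OF i] Suc.prems by (simp add: cls_mult)
    with Suc pow[OF i] show ?case by (simp add: free_alg_closed mult.assoc)
  qed simp
  from this[of n 1] have "foldr ?F [1..<n + 1] \<one>\<^bsub>A\<^esub> = cls (nc_mono g n e)"
    by (simp add: free_alg_closed cls_one)
  then show ?thesis unfolding Kn_Z_def by (intro CollectI exI[of _ e]) simp
qed

end

section \<open>The quantum symplectic space\<close>

locale quantum_symplectic_algebra =
  fixes n :: nat and q :: "'k::field"
  assumes n: "n \<ge> 1" and q: "q \<noteq> 0" "\<And>k. k > 0 \<Longrightarrow> q ^ k \<noteq> 1"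
begin

sublocale Kn_algebra n sp_p "sp_q q" "sp_gamma q" .

lemma gens_Fr:
  assumes "i \<in> {1..n}"
  shows "gx i \<in> Fr" "gy i \<in> Fr" "gz q i \<in> Fr"
  using assms by (auto intro: free_alg_closed gz_closed)

lemma Kn_z_gz:
  assumes "i \<in> {1..n}"
  shows "Kn_z n sp_p (sp_q q) (sp_gamma q) i = cls (gz q i)"
proof -
  have l: "gy l * gx l \<in> Fr" if "l \<in> {1..i}" for l
    using assms that by (intro free_alg_closed) auto
  have "cls (gz q i) = L.comb {1..i} (\<lambda>_. inverse (q ^ 2) - 1) (\<lambda>l. cls (gy l * gx l))"
    unfolding gz_def by (rule cls_comb) (rule l)
  also have "\<dots> = Kn_z n sp_p (sp_q q) (sp_gamma q) i"
    unfolding L.comb_def Kn_z_def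
  proof (rule A.finsum_cong')
    show "(\<lambda>l. (sp_q q l - sp_p l) \<odot>\<^bsub>A\<^esub> (cls (gy l) \<otimes>\<^bsub>A\<^esub> cls (gx l))) \<in> {1..i} \<rightarrow> carrier A"
      using assms gens_Fr by auto
    show "(inverse (q ^ 2) - 1) \<odot>\<^bsub>A\<^esub> cls (gy l * gx l) = (sp_q q l - sp_p l) \<odot>\<^bsub>A\<^esub> (cls (gy l) \<otimes>\<^bsub>A\<^esub> cls (gx l))"
      if "l \<in> {1..i}" for l
      using assms that gens_Fr[of l] by (simp add: cls_mult sp_q_def sp_p_def)
  qed simp
  finally show ?thesis by simp
qed

section \<open>The dimension of the algebra\<close>

definition pbw_set :: "nat \<Rightarrow> 'k ncpoly set set"
  where "pbw_set L = (\<lambda>(a, b). cls (nc_pbw n a b)) ` (exponents n L \<times> exponents n L)"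

lemma finite_pbw_set: "finite (pbw_set L)"
  by (simp add: pbw_set_def finite_exponents)

lemma card_pbw_set: "card (pbw_set L) \<le> Suc L ^ (2 * n)"
proof -
  have "card (pbw_set L) \<le> card (exponents n L \<times> exponents n L)"
    unfolding pbw_set_def by (rule card_image_le) (simp add: finite_exponents)
  also have "\<dots> = Suc L ^ (2 * n)"
    by (simp only: card_cartesian_product card_exponents mult_2 power_add)
  finally show ?thesis .
qed

lemma nc_pbw_Fr: "nc_pbw n a b \<in> Fr"
proof -
  have pow: "f ^ t \<in> Fr" if "f \<in> Fr" for f :: "'k ncpoly" and t
    using that by (induction t) (auto intro: free_alg_closed)
  have "nc_pbw j a b \<in> Fr" if "j \<le> n" for j
    using that by (induction j) (auto intro!: free_alg_closed pow gens_Fr)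
  then show ?thesis by simp
qed

lemma pbw_set_carrier: "pbw_set L \<subseteq> carrier A"
  by (auto simp: pbw_set_def nc_pbw_Fr)

text \<open>This is the kernel of \<open>cls\<close> composed with \<open>restr n\<close>, a ring
  homomorphism from the full polynomial type to the algebra.\<close>

lemma right_ideal_Kn_ideal: "right_ideal n q {f. cls (restr n f) = \<zero>\<^bsub>A\<^esub>}"
proof
  show "nc.subspace {f. cls (restr n f) = \<zero>\<^bsub>A\<^esub>}"
  proof (rule nc.subspaceI)
    show "0 \<in> {f. cls (restr n f) = \<zero>\<^bsub>A\<^esub>}"
      by (simp add: restr_id free_alg_closed cls_0)
    show "const c * f \<in> {f. cls (restr n f) = \<zero>\<^bsub>A\<^esub>}" if "f \<in> {f. cls (restr n f) = \<zero>\<^bsub>A\<^esub>}" for c f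
      using that by (simp add: restr_mult cls_mult restr_carrier)
  qed (simp add: restr_add cls_add restr_carrier)
  show "v * gx i \<in> {f. cls (restr n f) = \<zero>\<^bsub>A\<^esub>}" "v * gy i \<in> {f. cls (restr n f) = \<zero>\<^bsub>A\<^esub>}"
    if "i \<in> {1..n}" "v \<in> {f. cls (restr n f) = \<zero>\<^bsub>A\<^esub>}" for v i
    using that by (simp_all add: restr_mult cls_mult restr_carrier)
  show "v * r \<in> {f. cls (restr n f) = \<zero>\<^bsub>A\<^esub>}" if "r \<in> sp_rels n q" for v r
    using cls_rel[OF that] subsetD[OF Kn_rels_carrier that]
    by (simp add: restr_mult cls_mult restr_carrier restr_id)
qed (use q in auto)

lemma cls_Deg_span: "cls ` Deg L \<subseteq> lin_span A (smult A) (pbw_set L)"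
proof safe
  fix f assume f: "f \<in> Deg L"
  have sub: "L.subsp (lin_span A (smult A) (pbw_set L))"
    by (rule L.subsp_lin_span[OF pbw_set_carrier])
  have word: "Poly_Mapping.single w 1 \<in> Fr \<and> cls (Poly_Mapping.single w 1) \<in> lin_span A (smult A) (pbw_set L)"
    if "w \<in> Poly_Mapping.keys f" for w
  proof -
    have w: "w \<in> words n" "length (letters w) \<le> L"
      using f that by (auto simp: Deg_def free_alg_def)
    then have wFr: "Poly_Mapping.single w (1::'k) \<in> Fr" by (auto simp: free_alg_def)
    obtain c where c: "cls (restr n (Poly_Mapping.single w 1 -
        (\<Sum>(a, b)\<in>exponents n L \<times> exponents n L. const (c (a, b)) * nc_pbw n a b))) = \<zero>\<^bsub>A\<^esub>"
      using right_ideal.word_straightening[OF right_ideal_Kn_ideal w] by auto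
    let ?g = "\<Sum>i\<in>exponents n L \<times> exponents n L. const (c i) * (\<lambda>(a, b). nc_pbw n a b) i"
    have gFr: "?g \<in> Fr"
      by (intro free_alg_sum_closed free_alg_closed) (auto simp: nc_pbw_Fr)
    have "cls (Poly_Mapping.single w 1) = cls ((Poly_Mapping.single w 1 - ?g) + ?g)" by simp
    also have "\<dots> = cls (Poly_Mapping.single w 1 - ?g) \<oplus>\<^bsub>A\<^esub> cls ?g"
      using wFr gFr by (intro cls_add free_alg_closed)
    also have "cls (Poly_Mapping.single w 1 - ?g) = \<zero>\<^bsub>A\<^esub>"
      using c restr_id[OF free_alg_closed(6)[OF wFr gFr]] by (simp add: case_prod_unfold)
    also have "cls ?g = L.comb (exponents n L \<times> exponents n L) c (\<lambda>i. cls ((\<lambda>(a, b). nc_pbw n a b) i))"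
      by (rule cls_comb) (auto simp: nc_pbw_Fr)
    also have "\<zero>\<^bsub>A\<^esub> \<oplus>\<^bsub>A\<^esub> \<dots> = \<dots>"
      by (intro A.l_zero L.comb_closed) (auto simp: nc_pbw_Fr)
    also have "\<dots> \<in> lin_span A (smult A) (pbw_set L)"
      by (intro L.comb_in_subsp[OF sub] funcsetI L.lin_span_base[OF pbw_set_carrier]) (auto simp: pbw_set_def)
    finally show ?thesis using wFr by blast
  qed
  have "f = (\<Sum>w\<in>Poly_Mapping.keys f. const (Poly_Mapping.lookup f w) * Poly_Mapping.single w 1)"
    by (subst poly_mapping_sum_single[of f]) (simp add: const_def mult_single)
  then have "cls f = cls (\<Sum>w\<in>Poly_Mapping.keys f. const (Poly_Mapping.lookup f w) * Poly_Mapping.single w 1)"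
    by (rule arg_cong)
  also have "\<dots> = L.comb (Poly_Mapping.keys f) (Poly_Mapping.lookup f) (\<lambda>w. cls (Poly_Mapping.single w 1))"
    using word by (intro cls_comb) blast
  also have "\<dots> \<in> lin_span A (smult A) (pbw_set L)"
    using word by (intro L.comb_in_subsp[OF sub]) blast
  finally show "cls f \<in> lin_span A (smult A) (pbw_set L)" .
qed

text \<open>Every V lies in some degree d, so V^m is spanned by ordered monomials with exponents at
  most dm, of which there are at most (dm+1)^{2n}.\<close>

lemma GKdim_alg_le: "GKdim_alg A \<le> ereal (real (2 * n))"
  unfolding GKdim_alg_def
proof (rule SUP_least)
  fix V assume "V \<in> {V. fd_subspace A (smult A) V \<and> \<one>\<^bsub>A\<^esub> \<in> V}"
  then obtain d where d: "V \<subseteq> cls ` Deg d"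
    using fd_subspace_Deg by auto
  then have V: "V \<subseteq> carrier A" using Deg_Fr by blast
  show "limsup (\<lambda>m. ereal (log (real m) (real (lin_dim A (smult A) (sub_pow A V m))))) \<le> ereal (real (2 * n))"
  proof (rule limsup_log_le)
    fix m
    have "lin_dim A (smult A) (sub_pow A V m) \<le> card (pbw_set (d * m))"
      using sub_pow_Deg[OF d, of m] cls_Deg_span sub_pow_subsp[OF V]
      by (intro L.lin_dim_le finite_pbw_set pbw_set_carrier) blast+
    also have "\<dots> \<le> Suc (d * m) ^ (2 * n)" by (rule card_pbw_set)
    finally show "lin_dim A (smult A) (sub_pow A V m) \<le> Suc (d * m) ^ (2 * n)" .
  qed
qed

text \<open>Including the z_i along with the generators lets every factor of z^e w^b cost just one
  power of \<open>V0\<close>.\<close>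

definition V0 :: "'k ncpoly set set"
  where "V0 = lin_span A (smult A)
    ({\<one>\<^bsub>A\<^esub>} \<union> (\<lambda>i. cls (gx i)) ` {1..n} \<union> (\<lambda>i. cls (gy i)) ` {1..n} \<union> (\<lambda>i. cls (gz q i)) ` {1..n})"

lemma V0:
  shows "fd_subspace A (smult A) V0" "V0 \<subseteq> carrier A" "\<one>\<^bsub>A\<^esub> \<in> V0"
    and "i \<in> {1..n} \<Longrightarrow> cls (gx i) \<in> V0" "i \<in> {1..n} \<Longrightarrow> cls (gy i) \<in> V0" "i \<in> {1..n} \<Longrightarrow> cls (gz q i) \<in> V0"
proof -
  define G where "G = {\<one>\<^bsub>A\<^esub>} \<union> (\<lambda>i. cls (gx i)) ` {1..n} \<union> (\<lambda>i. cls (gy i)) ` {1..n} \<union> (\<lambda>i. cls (gz q i)) ` {1..n}"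
  have V0: "V0 = lin_span A (smult A) G" by (simp only: V0_def G_def)
  have G: "finite G" "G \<subseteq> carrier A" using gens_Fr by (auto simp: G_def)
  show "fd_subspace A (smult A) V0"
    unfolding fd_subspace_def by (rule exI[of _ G]) (intro conjI G V0)
  show "V0 \<subseteq> carrier A"
    using L.subsp_lin_span[OF G(2)] unfolding V0 L.subsp_def by blast
  have base: "x \<in> V0" if "x \<in> G" for x
    unfolding V0 using G(2) that by (rule L.lin_span_base)
  show "\<one>\<^bsub>A\<^esub> \<in> V0" by (rule base) (simp add: G_def)
  show "cls (gx i) \<in> V0" "cls (gy i) \<in> V0" "cls (gz q i) \<in> V0" if "i \<in> {1..n}"
    by (rule base, use that in \<open>auto simp: G_def\<close>)+
qed

definition mon :: "(nat \<Rightarrow> bool) \<Rightarrow> (nat \<Rightarrow> nat) \<Rightarrow> (nat \<Rightarrow> nat) \<Rightarrow> 'k ncpoly"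
  where "mon \<epsilon> e b = nc_mono (gz q) n e * nc_mono (\<lambda>i. if \<epsilon> i then gy i else gx i) n b"

lemma mon_Fr: "mon \<epsilon> e b \<in> Fr"
  unfolding mon_def using gens_Fr by (intro free_alg_closed nc_mono_closed) auto

text \<open>There are 2n factors, each raised to a power of at most k; smaller powers of
  \<open>V0\<close> are contained in larger ones since \<open>V0\<close> contains 1.\<close>

lemma mon_sub_pow:
  assumes "e \<in> exponents n k" "b \<in> exponents n k"
  shows "cls (mon \<epsilon> e b) \<in> sub_pow A V0 (2 * n * k)"
proof -
  have sum: "(\<Sum>i = 1..n. e i) \<le> n * k" if "e \<in> exponents n k" for e
    using sum_bounded_above[of "{1..n}" e k] that by (auto simp: exponents_def PiE_iff)
  have "cls (1 * nc_mono (gz q) n e) \<in> sub_pow A V0 (0 + (\<Sum>i = 1..n. e i))"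
    using gens_Fr V0(6) L.lin_span_base[of "{\<one>\<^bsub>A\<^esub>}"]
    by (intro nc_mono_sub_pow V0(2)) (auto simp: free_alg_closed cls_one)
  then have "cls (mon \<epsilon> e b) \<in> sub_pow A V0 ((\<Sum>i = 1..n. e i) + (\<Sum>i = 1..n. b i))"
    unfolding mon_def using gens_Fr V0(4,5)
    by (intro nc_mono_sub_pow V0(2)) (auto intro!: nc_mono_closed)
  moreover have "(\<Sum>i = 1..n. e i) + (\<Sum>i = 1..n. b i) \<le> 2 * n * k"
    using sum[OF assms(1)] sum[OF assms(2)] by simp
  ultimately show ?thesis
    using sub_pow_mono[OF V0(2,3)] by blast
qed

lemma sub_pow_V0_span:
  obtains d where "\<And>m. sub_pow A V0 m \<subseteq> lin_span A (smult A) (pbw_set (d * m))"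
proof -
  obtain d where "V0 \<subseteq> cls ` Deg d"
    using fd_subspace_Deg[OF V0(1)] by blast
  from sub_pow_Deg[OF this] cls_Deg_span that show thesis by (meson order_trans)
qed

lemma GKdim_alg_ge:
  assumes "\<And>k c. cls (\<Sum>b\<in>exponents n k. \<Sum>e\<in>exponents n k. const (c e b) * mon \<epsilon> e b) = \<zero>\<^bsub>A\<^esub> \<Longrightarrow>
    \<forall>e\<in>exponents n k. \<forall>b\<in>exponents n k. c e b = 0"
  shows "GKdim_alg A \<ge> ereal (real (2 * n))"
proof -
  obtain d where d: "\<And>m. sub_pow A V0 m \<subseteq> lin_span A (smult A) (pbw_set (d * m))"
    using sub_pow_V0_span by blast
  have "ereal (real (2 * n)) \<le> limsup (\<lambda>m. ereal (log (real m) (real (lin_dim A (smult A) (sub_pow A V0 m)))))"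
  proof (rule limsup_log_ge)
    show "2 * n > 0" using n by simp
    show "Suc k ^ (2 * n) \<le> lin_dim A (smult A) (sub_pow A V0 (2 * n * k))" for k
    proof -
      let ?I = "exponents n k \<times> exponents n k"
      have "Suc k ^ (2 * n) = card ?I"
        by (simp add: card_cartesian_product card_exponents mult_2 power_add)
      also have "\<dots> \<le> lin_dim A (smult A) (sub_pow A V0 (2 * n * k))"
      proof (rule L.card_le_lin_dim[OF finite_pbw_set pbw_set_carrier d sub_pow_subsp[OF V0(2)]])
        show "finite ?I" by (simp add: finite_exponents)
        show "(\<lambda>(e, b). cls (mon \<epsilon> e b)) \<in> ?I \<rightarrow> sub_pow A V0 (2 * n * k)"
          using mon_sub_pow by auto
        fix c assume "L.comb ?I c (\<lambda>(e, b). cls (mon \<epsilon> e b)) = \<zero>\<^bsub>A\<^esub>"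
        then have "cls (\<Sum>i\<in>?I. const (c i) * mon \<epsilon> (fst i) (snd i)) = \<zero>\<^bsub>A\<^esub>"
          by (subst cls_comb) (simp_all add: mon_Fr case_prod_unfold)
        also have "(\<Sum>i\<in>?I. const (c i) * mon \<epsilon> (fst i) (snd i)) =
            (\<Sum>b\<in>exponents n k. \<Sum>e\<in>exponents n k. const (c (e, b)) * mon \<epsilon> e b)"
          by (subst sum.swap) (simp add: sum.cartesian_product case_prod_unfold)
        finally show "\<forall>i\<in>?I. c i = 0"
          using assms[of "\<lambda>e b. c (e, b)" k] by auto
      qed
      finally show ?thesis .
    qed
  qed
  also have "\<dots> \<le> GKdim_alg A"
    unfolding GKdim_alg_def using V0(1,3) by (intro SUP_upper) simp
  finally show ?thesis .
qed

end

section \<open>The cyclic submodule generated by a torsion-free vector\<close>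

locale quantum_symplectic_module = quantum_symplectic_algebra n q
  for n :: nat and q :: "'k::field" +
  fixes M :: "('k ncpoly set, 'm) right_module" and m0 :: 'm
  assumes M: "right_module A M" and m0: "m0 \<in> carrier M"
    and m0_torsion_free: "s \<in> quantum_symplectic_Z n q \<Longrightarrow> m0 \<triangleleft>\<^bsub>M\<^esub> s \<noteq> \<zero>\<^bsub>M\<^esub>"
begin

sublocale M: right_module A M by (rule M)

lemma ract_smult:
  assumes "m \<in> carrier M" "a \<in> carrier A"
  shows "m \<triangleleft>\<^bsub>M\<^esub> (c \<odot>\<^bsub>A\<^esub> a) = mod_scale A M c (m \<triangleleft>\<^bsub>M\<^esub> a)"
  using assms smult_mult(2)[of a "\<one>\<^bsub>A\<^esub>" c]
  by (simp add: mod_scale_def M.ract_mult[symmetric])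

sublocale LM: lin_space M "mod_scale A M"
proof
  fix x y :: 'm and c d :: 'k
  assume x: "x \<in> carrier M"
  show "mod_scale A M c x \<in> carrier M"
    using x by (simp add: mod_scale_def M.ract_closed)
  show "mod_scale A M (c + d) x = mod_scale A M c x \<oplus>\<^bsub>M\<^esub> mod_scale A M d x"
    using x by (simp add: mod_scale_def M.ract_add_right L.add_sc)
  show "mod_scale A M c (mod_scale A M d x) = mod_scale A M (c * d) x"
    using x by (simp add: mod_scale_def M.ract_mult[symmetric] smult_mult L.sc_sc mult.commute)
  show "mod_scale A M 1 x = x"
    using x by (simp add: mod_scale_def L.sc_one M.ract_one)
  assume "y \<in> carrier M"
  with x show "mod_scale A M c (x \<oplus>\<^bsub>M\<^esub> y) = mod_scale A M c x \<oplus>\<^bsub>M\<^esub> mod_scale A M c y"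
    by (simp add: mod_scale_def M.ract_add_left)
qed

lemma zero_ract: "a \<in> carrier A \<Longrightarrow> \<zero>\<^bsub>M\<^esub> \<triangleleft>\<^bsub>M\<^esub> a = \<zero>\<^bsub>M\<^esub>"
  using M.ract_add_left[of "\<zero>\<^bsub>M\<^esub>" "\<zero>\<^bsub>M\<^esub>" a] M.ract_closed[of "\<zero>\<^bsub>M\<^esub>" a]
  by (simp add: M.M.add.l_cancel_one)

lemma ract_zero: "m \<in> carrier M \<Longrightarrow> m \<triangleleft>\<^bsub>M\<^esub> \<zero>\<^bsub>A\<^esub> = \<zero>\<^bsub>M\<^esub>"
  using M.ract_add_right[of m "\<zero>\<^bsub>A\<^esub>" "\<zero>\<^bsub>A\<^esub>"] M.ract_closed[of m "\<zero>\<^bsub>A\<^esub>"]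
  by (simp add: M.M.add.l_cancel_one)

text \<open>The orbit map of \<open>m0\<close>, extended to all polynomials. Its kernel is the right
  ideal through which module questions become questions about the free algebra.\<close>

definition phi :: "'k ncpoly \<Rightarrow> 'm"
  where "phi f = m0 \<triangleleft>\<^bsub>M\<^esub> cls (restr n f)"

lemma phi_closed [simp, intro]: "phi f \<in> carrier M"
  by (simp add: phi_def M.ract_closed m0 restr_carrier)

lemma phi_add: "phi (f + g) = phi f \<oplus>\<^bsub>M\<^esub> phi g"
  by (simp add: phi_def restr_add cls_add restr_carrier M.ract_add_right m0)

lemma phi_mult: "phi (f * g) = phi f \<triangleleft>\<^bsub>M\<^esub> cls (restr n g)"
  by (simp add: phi_def restr_mult cls_mult restr_carrier M.ract_mult m0)

lemma phi_const: "phi (const c * f) = mod_scale A M c (phi f)"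
  by (simp add: phi_def restr_mult restr_id[OF free_alg_closed(3)] smult_cls[symmetric] restr_carrier ract_smult m0)

lemma phi_0: "phi 0 = \<zero>\<^bsub>M\<^esub>"
  using phi_const[of 0 0] by (simp add: const_simps)

lemma phi_sum: "phi (\<Sum>i\<in>I. const (c i) * f i) = LM.comb I c (\<lambda>i. phi (f i))"
proof (induction I rule: infinite_finite_induct)
  case (infinite I)
  then show ?case by (simp add: LM.comb_def phi_0 M.M.finsum_infinite)
next
  case empty
  then show ?case by (simp add: LM.comb_empty phi_0)
next
  case (insert i I)
  then have "LM.comb (insert i I) c (\<lambda>i. phi (f i)) = mod_scale A M (c i) (phi (f i)) \<oplus>\<^bsub>M\<^esub> LM.comb I c (\<lambda>i. phi (f i))"
    by (intro LM.comb_insert) auto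
  with insert show ?case by (simp add: phi_add phi_const)
qed

lemma right_ideal_phi: "right_ideal n q {f. phi f = \<zero>\<^bsub>M\<^esub>}"
proof
  show "nc.subspace {f. phi f = \<zero>\<^bsub>M\<^esub>}"
    by (rule nc.subspaceI) (simp_all add: phi_0 phi_add phi_const)
  show "v * gx i \<in> {f. phi f = \<zero>\<^bsub>M\<^esub>}" "v * gy i \<in> {f. phi f = \<zero>\<^bsub>M\<^esub>}"
    if "i \<in> {1..n}" "v \<in> {f. phi f = \<zero>\<^bsub>M\<^esub>}" for v i
    using that by (simp_all add: phi_mult zero_ract restr_carrier)
  show "v * r \<in> {f. phi f = \<zero>\<^bsub>M\<^esub>}" if "r \<in> sp_rels n q" for v r
    using cls_rel[OF that] subsetD[OF Kn_rels_carrier that]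
    by (simp add: phi_mult restr_id ract_zero)
qed (use q in auto)

lemma phi_mon: "phi (w * mon \<epsilon> e b) = phi w \<triangleleft>\<^bsub>M\<^esub> cls (mon \<epsilon> e b)"
  by (simp add: phi_mult restr_id[OF mon_Fr])

text \<open>The supremum is bounded below at one pair: V = \<open>V0\<close>, and F the line through
  \<open>phi w\<close>.\<close>

lemma GKdim_mod_ge:
  assumes I: "\<And>k. \<exists>I. I \<subseteq> exponents n (2 * n * k + k) \<times> exponents n (2 * n * k + k) \<and> Suc k ^ n \<le> card I \<and>
      (\<forall>c. phi (\<Sum>(e, b)\<in>I. const (c (e, b)) * (w * mon \<epsilon> e b)) = \<zero>\<^bsub>M\<^esub> \<longrightarrow> (\<forall>i\<in>I. c i = 0))"
  shows "ereal (real n) \<le> GKdim_mod A M"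
proof -
  have indep: "LM.comb I c (\<lambda>(e, b). phi w \<triangleleft>\<^bsub>M\<^esub> cls (mon \<epsilon> e b)) =
      phi (\<Sum>(e, b)\<in>I. const (c (e, b)) * (w * mon \<epsilon> e b))" for I c
    using phi_sum[of c "\<lambda>i. w * mon \<epsilon> (fst i) (snd i)" I] by (simp add: phi_mon case_prod_unfold)

  let ?sc = "mod_scale A M"
  define F where "F = lin_span M ?sc {phi w}"
  have wF: "phi w \<in> F"
    unfolding F_def by (rule LM.lin_span_base) auto
  \<comment> \<open>Otherwise all vectors of the independent family vanish, although already for k =
    0 the family has a member.\<close>
  have "phi w \<noteq> \<zero>\<^bsub>M\<^esub>"
  proof
    assume "phi w = \<zero>\<^bsub>M\<^esub>"
    obtain I where I0: "Suc 0 ^ n \<le> card I"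
      "\<And>c. phi (\<Sum>(e, b)\<in>I. const (c (e, b)) * (w * mon \<epsilon> e b)) = \<zero>\<^bsub>M\<^esub> \<Longrightarrow> \<forall>i\<in>I. c i = 0"
      using I[of 0] by blast
    have "LM.comb I (\<lambda>_. 1) (\<lambda>(e, b). phi w \<triangleleft>\<^bsub>M\<^esub> cls (mon \<epsilon> e b)) = \<zero>\<^bsub>M\<^esub>"
      unfolding LM.comb_def \<open>phi w = \<zero>\<^bsub>M\<^esub>\<close>
      by (rule M.M.add.finprod_one_eqI) (auto simp: zero_ract mon_Fr)
    then have "\<forall>i\<in>I. (1::'k) = 0"
      unfolding indep by (rule I0(2)[of "\<lambda>_. 1"])
    then have "I = {}" by auto
    with I0(1) show False by simp
  qed
  with wF have F0: "F \<noteq> {\<zero>\<^bsub>M\<^esub>}" by blast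
  have Ffd: "fd_subspace M ?sc F"
    unfolding fd_subspace_def F_def by (intro exI[of _ "{phi w}"]) auto

  obtain d where d: "\<And>m. sub_pow A V0 m \<subseteq> lin_span A (smult A) (pbw_set (d * m))"
    using sub_pow_V0_span by blast
  define P where "P m = {f \<triangleleft>\<^bsub>M\<^esub> a | f a. f \<in> F \<and> a \<in> sub_pow A V0 m}" for m
  \<comment> \<open>A finite spanning set for F V0^m, which ensures that \<open>lin_dim\<close> is
    evaluated at a finite-dimensional space.\<close>
  define S where "S m = (\<lambda>s. phi w \<triangleleft>\<^bsub>M\<^esub> s) ` pbw_set (d * m)" for m
  have S: "finite (S m)" "S m \<subseteq> carrier M" for m
    using finite_pbw_set pbw_set_carrier[of "d * m"] by (auto simp: S_def intro!: M.ract_closed)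
  have sub: "LM.subsp (lin_span M ?sc (S m))" for m
    by (rule LM.subsp_lin_span[OF S(2)])
  have PS: "P m \<subseteq> lin_span M ?sc (S m)" for m
  proof -
    let ?B = "{a \<in> carrier A. phi w \<triangleleft>\<^bsub>M\<^esub> a \<in> lin_span M ?sc (S m)}"
    have "L.subsp ?B"
      using sub[of m] unfolding L.subsp_def LM.subsp_def
      by (auto simp: M.ract_add_right ract_zero ract_smult)
    moreover have "pbw_set (d * m) \<subseteq> ?B"
      using pbw_set_carrier[of "d * m"] LM.lin_span_base[OF S(2)[of m]] by (auto simp: S_def)
    ultimately have B: "sub_pow A V0 m \<subseteq> ?B"
      using d[of m] L.lin_span_least by (meson order_trans)
    have "f \<triangleleft>\<^bsub>M\<^esub> a \<in> lin_span M ?sc (S m)" if "f \<in> F" "a \<in> sub_pow A V0 m" for f a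
    proof -
      have a: "a \<in> carrier A" using that(2) B by blast
      have "F = range (\<lambda>c. LM.comb {phi w} c (\<lambda>v. v))"
        unfolding F_def by (rule LM.lin_span_finite) auto
      with that(1) have "f \<in> range (\<lambda>c. LM.comb {phi w} c (\<lambda>v. v))" by (simp only:)
      then obtain c where "f = LM.comb {phi w} c (\<lambda>v. v)" by blast
      then have "f = ?sc (c (phi w)) (phi w)"
        by (simp add: LM.comb_insert LM.comb_empty)
      then have "f \<triangleleft>\<^bsub>M\<^esub> a = phi w \<triangleleft>\<^bsub>M\<^esub> (c (phi w) \<odot>\<^bsub>A\<^esub> a)"
        using a by (simp add: mod_scale_def M.ract_mult[symmetric] smult_mult)
      also have "\<dots> = ?sc (c (phi w)) (phi w \<triangleleft>\<^bsub>M\<^esub> a)"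
        using a by (simp add: ract_smult)
      also have "\<dots> \<in> lin_span M ?sc (S m)"
        using that(2) B sub[of m] unfolding LM.subsp_def by blast
      finally show ?thesis .
    qed
    then show ?thesis by (auto simp: P_def)
  qed
  then have PM: "P m \<subseteq> carrier M" for m
    using sub[of m] unfolding LM.subsp_def by blast

  \<comment> \<open>The family uses exponents up to 2nk + k = (2n+1)k, and exponents up to K stay
    inside the power 2nK of \<open>V0\<close>.\<close>
  define C where "C = 2 * n * (2 * n + 1)"
  have "ereal (real n) \<le> limsup (\<lambda>m. ereal (log (real m) (real (lin_dim M ?sc (lin_span M ?sc (P m))))))"
  proof (rule limsup_log_ge)
    show "C > 0" using n by (simp add: C_def)
    show "Suc k ^ n \<le> lin_dim M ?sc (lin_span M ?sc (P (C * k)))" for k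
    proof -
      obtain I where I: "I \<subseteq> exponents n (2 * n * k + k) \<times> exponents n (2 * n * k + k)" "Suc k ^ n \<le> card I"
        "\<And>c. phi (\<Sum>(e, b)\<in>I. const (c (e, b)) * (w * mon \<epsilon> e b)) = \<zero>\<^bsub>M\<^esub> \<Longrightarrow> \<forall>i\<in>I. c i = 0"
        using I[of k] by blast
      have "2 * n * (2 * n * k + k) = C * k"
        by (simp add: C_def algebra_simps)
      then have mon: "cls (mon \<epsilon> e b) \<in> sub_pow A V0 (C * k)" if "(e, b) \<in> I" for e b
        using mon_sub_pow[of e "2 * n * k + k" b \<epsilon>] that I(1) by auto
      have "card I \<le> lin_dim M ?sc (lin_span M ?sc (P (C * k)))"
      proof (rule LM.card_le_lin_dim[OF S])
        show "lin_span M ?sc (P (C * k)) \<subseteq> lin_span M ?sc (S (C * k))"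
          by (rule LM.lin_span_least[OF PS sub])
        show "LM.subsp (lin_span M ?sc (P (C * k)))"
          by (rule LM.subsp_lin_span[OF PM])
        show "finite I"
          using I(1) finite_exponents by (meson finite_SigmaI finite_subset)
        show "(\<lambda>(e, b). phi w \<triangleleft>\<^bsub>M\<^esub> cls (mon \<epsilon> e b)) \<in> I \<rightarrow> lin_span M ?sc (P (C * k))"
        proof safe
          fix e b assume "(e, b) \<in> I"
          with mon wF have "phi w \<triangleleft>\<^bsub>M\<^esub> cls (mon \<epsilon> e b) \<in> P (C * k)"
            unfolding P_def by blast
          then show "phi w \<triangleleft>\<^bsub>M\<^esub> cls (mon \<epsilon> e b) \<in> lin_span M ?sc (P (C * k))"
            by (rule LM.lin_span_base[OF PM])
        qed
        show "\<forall>i\<in>I. c i = 0" if "LM.comb I c (\<lambda>(e, b). phi w \<triangleleft>\<^bsub>M\<^esub> cls (mon \<epsilon> e b)) = \<zero>\<^bsub>M\<^esub>" for c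
          using that I(3) unfolding indep by blast
      qed
      with I(2) show ?thesis by linarith
    qed
  qed
  also have "\<dots> \<le> GKdim_mod A M"
    unfolding GKdim_mod_def P_def
    by (rule SUP_upper2[of "(V0, F)"]) (use V0(1,3) F0 Ffd in auto)
  finally show ?thesis .
qed

text \<open>A relation between the monomials in the algebra acts as zero after any polynomial v, so
  independence of the operators on the module forces independence in the algebra.\<close>

lemma GKdim_alg_ge_mod:
  assumes "\<And>k c. (\<And>v. phi (\<Sum>b\<in>exponents n k. \<Sum>e\<in>exponents n k. const (c e b) * (v * mon \<epsilon> e b)) = \<zero>\<^bsub>M\<^esub>) \<Longrightarrow>
      \<forall>e\<in>exponents n k. \<forall>b\<in>exponents n k. c e b = 0"
  shows "ereal (real (2 * n)) \<le> GKdim_alg A"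
proof (rule GKdim_alg_ge)
    fix k c
    let ?g = "\<Sum>b\<in>exponents n k. \<Sum>e\<in>exponents n k. const (c e b) * mon \<epsilon> e b"
    assume "cls ?g = \<zero>\<^bsub>A\<^esub>"
    moreover have "?g \<in> Fr"
      by (intro free_alg_sum_closed free_alg_closed mon_Fr)
    ultimately have "phi (v * ?g) = \<zero>\<^bsub>M\<^esub>" for v
      by (simp add: phi_mult restr_id ract_zero)
    moreover have "v * ?g = (\<Sum>b\<in>exponents n k. \<Sum>e\<in>exponents n k. const (c e b) * (v * mon \<epsilon> e b))" for v
      by (simp add: sum_distrib_left mult.assoc[symmetric] const_central)
    ultimately show "\<forall>e\<in>exponents n k. \<forall>b\<in>exponents n k. c e b = 0"
      by (intro assms) simp
qed

lemma GKdims: "GKdim_mod A M \<ge> ereal (real n) \<and> GKdim_alg A \<ge> ereal (real (2 * n))"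
proof -
  have "nc_mono (gz q) n e \<notin> {f. phi f = \<zero>\<^bsub>M\<^esub>}" for e
  proof -
    have "cls (nc_mono (gz q) n e) \<in> quantum_symplectic_Z n q"
      using gens_Fr Kn_z_gz by (intro Kn_Z_nc_mono) auto
    moreover have "nc_mono (gz q) n e \<in> Fr"
      using gens_Fr by (intro nc_mono_closed) auto
    ultimately show ?thesis
      using m0_torsion_free by (simp add: phi_def restr_id)
  qed
  then show ?thesis
  proof (rule right_ideal.growth[OF right_ideal_phi])
    fix \<epsilon> w
    have mon: "v * nc_mono (gz q) n e * nc_mono (\<lambda>i. if \<epsilon> i then gy i else gx i) n b = v * mon \<epsilon> e b" for v e b
      by (simp add: mon_def mult.assoc)
    assume I: "\<And>k. \<exists>I. I \<subseteq> exponents n (2 * n * k + k) \<times> exponents n (2 * n * k + k) \<and> Suc k ^ n \<le> card I \<and>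
        (\<forall>c. (\<Sum>(e, b)\<in>I. const (c (e, b)) *
          (w * nc_mono (gz q) n e * nc_mono (\<lambda>i. if \<epsilon> i then gy i else gx i) n b)) \<in> {f. phi f = \<zero>\<^bsub>M\<^esub>}
          \<longrightarrow> (\<forall>i\<in>I. c i = 0))"
      and alg: "\<And>k c. (\<And>v. (\<Sum>b\<in>exponents n k. \<Sum>e\<in>exponents n k. const (c e b) *
          (v * nc_mono (gz q) n e * nc_mono (\<lambda>i. if \<epsilon> i then gy i else gx i) n b)) \<in> {f. phi f = \<zero>\<^bsub>M\<^esub>}) \<Longrightarrow>
        \<forall>e\<in>exponents n k. \<forall>b\<in>exponents n k. c e b = 0"
    show ?thesis
    proof
      show "ereal (real n) \<le> GKdim_mod A M"
        by (rule GKdim_mod_ge[OF I[unfolded mon mem_Collect_eq]])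
      show "ereal (real (2 * n)) \<le> GKdim_alg A"
        by (rule GKdim_alg_ge_mod[where \<epsilon> = \<epsilon>], rule alg) (simp only: mon mem_Collect_eq)
    qed
  qed
qed

end

theorem corollary1p2:
  fixes n :: nat and q :: "'k::field"
    and M :: "('k ncpoly set, 'm) right_module"
  assumes "n \<ge> 1"
    and "q \<noteq> 0"
    and "\<forall>k::nat. k > 0 \<longrightarrow> q ^ k \<noteq> 1"
    and "right_module (quantum_symplectic n q) M"
    and "carrier M \<noteq> {\<zero>\<^bsub>M\<^esub>}"
    and "fin_gen_right_module (quantum_symplectic n q) M"
    and "\<not> torsion_right_module (quantum_symplectic_Z n q) M"
  shows "GKdim_mod (quantum_symplectic n q) M \<ge> ereal (real n) \<and>
    ereal (real n) = GKdim_alg (quantum_symplectic n q) / 2"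
proof -
  \<comment> \<open>Negating torsion gives one vector that survives every element of the Ore set;
    its annihilator is the right ideal to be studied.\<close>
  obtain m0 where m0: "m0 \<in> carrier M" "\<And>s. s \<in> quantum_symplectic_Z n q \<Longrightarrow> m0 \<triangleleft>\<^bsub>M\<^esub> s \<noteq> \<zero>\<^bsub>M\<^esub>"
    using assms(7) unfolding torsion_right_module_def by blast
  interpret quantum_symplectic_module n q M m0
    by (intro quantum_symplectic_module.intro quantum_symplectic_algebra.intro
        quantum_symplectic_module_axioms.intro) (use assms(1-4) m0 in auto)
  have "GKdim_alg (quantum_symplectic n q) = ereal (real (2 * n))"
    using GKdims GKdim_alg_le by (intro antisym) auto
  with GKdims show ?thesis by simp
qed

end
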